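(* Let $F$ be a constructive field and $n\in\mathbf{N}$. Every non-singular $n\times n$ matrix $A$ all of whose entries lie in $F$ is invertible, i.e. there exists an $n\times n$ matrix $B$ all of whose entries lie in $F$ such that $B\ast A=E$, where $(B\ast A)(k,l)=\sum_{i=1}^n B(k,i)\cdot A(i,l)$ and $E$ is the $n\times n$ identity matrix.
   Context: Matrices are square with real entries; a matrix is non-singular if its columns are linearly independent. The setting is the paper's semi-constructive logic (intuitionistic first-order logic with inductive/coinductive definitions, extended by concurrency operators), with a sort of reals satisfying the axioms of a real closed field and the Archimedean axiom, and with Brouwer's thesis $\mathbf{BT}$: $\forall x\,(\neg\mathbf{Path}_\prec(x)\to\mathbf{Acc}_\prec(x))$ for non-computational relations $\prec$, where $\mathbf{Path}_\prec$ is the greatest predicate with $\mathbf{Path}_\prec(x)\leftrightarrow\exists y\,(y\prec x\land\mathbf{Path}_\prec(y))$ and $\mathbf{Acc}_\prec$ the least predicate with $\mathbf{Acc}_\prec(x)\leftrightarrow\forall y\,(y\prec x\to\mathbf{Acc}_\prec(y))$. $\mathbf{N}$ is the least predicate on reals containing $0$ and closed under $x\mapsto x+1$; $\mathbf{Q}(x)$ means $\exists y,z,u\in\mathbf{N}\ x=\frac{y-z}{u+1}$. A real $x$ is constructive, $\mathbf{C}(x)$, if $\forall m\in\mathbf{N}\,\exists q\in\mathbf{Q}\,|x-q|\le 2^{-m}$; $x$ is apart from $0$ if $\exists k\in\mathbf{N}\,|x|\ge 2^{-k}$. A ring is a predicate on reals containing $0,1$ and closed under $+,-,\cdot$; a field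 is a ring closed under division by elements apart from $0$; a constructive field is a field $F\subseteq\mathbf{C}$. Statements are understood as provable in this system. *)

theory Defs
  imports Main
begin

(* Provability in intuitionistic first-order logic with strictly positive inductive and
   coinductive definitions is formalized by a deep embedding: the connectives and quantifiers of
   Isabelle/HOL are classical, and over the HOL type of reals every number is constructive and
   every nonzero number is apart from 0.  The concurrency operators of the full logic are omitted;
   a derivation in the present fragment is a derivation in the full logic.

   There are two sorts, reals and matrices (arrays of reals with real indices).  Binding uses
   de Bruijn indices with three separate index spaces: real variables "Var i", matrix variables
   (the first argument of Entry), and predicate variables (the first argument of PVar). *)

section \<open>Syntax\<close>

datatype tm =
    Var nat
  | Zero
  | One
  | Add tm tm  (infixl "\<^bold>+" 65)
  | Sub tm tm  (infixl "\<^bold>-" 65)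
  | Mul tm tm  (infixl "\<^bold>*" 70)
  | Div tm tm  (infixl "\<^bold>'/" 70)
  | Absv tm
  | Pow2 tm
  | Entry nat tm tm

(* Mu k A ts  is  (mu X. lambda x_0 ... x_{k-1}. A) ts:  inside A the predicate variable 0 and the
   real variables 0, ..., k-1 are bound, Var i standing for the i-th argument.  Nu likewise. *)

datatype fm =
    Bot  ("\<^bold>\<bottom>")
  | Eq tm tm  (infix "\<^bold>=" 50)
  | Le tm tm  (infix "\<^bold>\<le>" 50)
  | PVar nat "tm list"
  | Mu nat fm "tm list"
  | Nu nat fm "tm list"
  | Conj fm fm  (infixr "\<^bold>\<and>" 35)
  | Disj fm fm  (infixr "\<^bold>\<or>" 30)
  | Imp fm fm  (infixr "\<^bold>\<rightarrow>" 25)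
  | Forall fm
  | Exists fm
  | ForallM fm
  | ExistsM fm

abbreviation Neg :: "fm \<Rightarrow> fm"  ("\<^bold>\<not> _" [40] 40)
  where "\<^bold>\<not> A \<equiv> A \<^bold>\<rightarrow> \<^bold>\<bottom>"


section \<open>Substitution\<close>

primrec subst_tm :: "(nat \<Rightarrow> tm) \<Rightarrow> (nat \<Rightarrow> nat) \<Rightarrow> tm \<Rightarrow> tm" where
  "subst_tm \<sigma> \<tau> (Var i) = \<sigma> i"
| "subst_tm \<sigma> \<tau> Zero = Zero"
| "subst_tm \<sigma> \<tau> One = One"
| "subst_tm \<sigma> \<tau> (s \<^bold>+ t) = subst_tm \<sigma> \<tau> s \<^bold>+ subst_tm \<sigma> \<tau> t"
| "subst_tm \<sigma> \<tau> (s \<^bold>- t) = subst_tm \<sigma> \<tau> s \<^bold>- subst_tm \<sigma> \<tau> t"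
| "subst_tm \<sigma> \<tau> (s \<^bold>* t) = subst_tm \<sigma> \<tau> s \<^bold>* subst_tm \<sigma> \<tau> t"
| "subst_tm \<sigma> \<tau> (s \<^bold>/ t) = subst_tm \<sigma> \<tau> s \<^bold>/ subst_tm \<sigma> \<tau> t"
| "subst_tm \<sigma> \<tau> (Absv t) = Absv (subst_tm \<sigma> \<tau> t)"
| "subst_tm \<sigma> \<tau> (Pow2 t) = Pow2 (subst_tm \<sigma> \<tau> t)"
| "subst_tm \<sigma> \<tau> (Entry a s t) = Entry (\<tau> a) (subst_tm \<sigma> \<tau> s) (subst_tm \<sigma> \<tau> t)"

(* weakening of a term by k real variables, resp. one matrix variable *)

definition lift_tm :: "nat \<Rightarrow> tm \<Rightarrow> tm"
  where "lift_tm k = subst_tm (\<lambda>i. Var (i + k)) id"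

definition liftM_tm :: "tm \<Rightarrow> tm"
  where "liftM_tm = subst_tm Var Suc"

definition up :: "nat \<Rightarrow> (nat \<Rightarrow> tm) \<Rightarrow> nat \<Rightarrow> tm"
  where "up k \<sigma> = (\<lambda>i. if i < k then Var i else lift_tm k (\<sigma> (i - k)))"

definition upM :: "(nat \<Rightarrow> nat) \<Rightarrow> nat \<Rightarrow> nat"
  where "upM \<tau> = case_nat 0 (\<lambda>a. Suc (\<tau> a))"

primrec subst :: "(nat \<Rightarrow> tm) \<Rightarrow> (nat \<Rightarrow> nat) \<Rightarrow> fm \<Rightarrow> fm" where
  "subst \<sigma> \<tau> \<^bold>\<bottom> = \<^bold>\<bottom>"
| "subst \<sigma> \<tau> (s \<^bold>= t) = (subst_tm \<sigma> \<tau> s \<^bold>= subst_tm \<sigma> \<tau> t)"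
| "subst \<sigma> \<tau> (s \<^bold>\<le> t) = (subst_tm \<sigma> \<tau> s \<^bold>\<le> subst_tm \<sigma> \<tau> t)"
| "subst \<sigma> \<tau> (PVar p ts) = PVar p (map (subst_tm \<sigma> \<tau>) ts)"
| "subst \<sigma> \<tau> (Mu k A ts) = Mu k (subst (up k \<sigma>) \<tau> A) (map (subst_tm \<sigma> \<tau>) ts)"
| "subst \<sigma> \<tau> (Nu k A ts) = Nu k (subst (up k \<sigma>) \<tau> A) (map (subst_tm \<sigma> \<tau>) ts)"
| "subst \<sigma> \<tau> (A \<^bold>\<and> B) = (subst \<sigma> \<tau> A \<^bold>\<and> subst \<sigma> \<tau> B)"
| "subst \<sigma> \<tau> (A \<^bold>\<or> B) = (subst \<sigma> \<tau> A \<^bold>\<or> subst \<sigma> \<tau> B)"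
| "subst \<sigma> \<tau> (A \<^bold>\<rightarrow> B) = (subst \<sigma> \<tau> A \<^bold>\<rightarrow> subst \<sigma> \<tau> B)"
| "subst \<sigma> \<tau> (Forall A) = Forall (subst (up 1 \<sigma>) \<tau> A)"
| "subst \<sigma> \<tau> (Exists A) = Exists (subst (up 1 \<sigma>) \<tau> A)"
| "subst \<sigma> \<tau> (ForallM A) = ForallM (subst (\<lambda>i. liftM_tm (\<sigma> i)) (upM \<tau>) A)"
| "subst \<sigma> \<tau> (ExistsM A) = ExistsM (subst (\<lambda>i. liftM_tm (\<sigma> i)) (upM \<tau>) A)"

(* insert k fresh real variables at position c *)

definition lift :: "nat \<Rightarrow> nat \<Rightarrow> fm \<Rightarrow> fm"
  where "lift c k = subst (\<lambda>i. if i < c then Var i else Var (i + k)) id"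

definition liftM :: "fm \<Rightarrow> fm"
  where "liftM = subst Var Suc"

(* A formula P with parameters Var 0, ..., Var (k-1) represents the k-ary predicate
   lambda x_0 ... x_{k-1}. P;  inst ts P  is its application to ts. *)

definition inst :: "tm list \<Rightarrow> fm \<Rightarrow> fm"
  where "inst ts = subst (\<lambda>i. if i < length ts then ts ! i else Var (i - length ts)) id"

definition instM :: "nat \<Rightarrow> fm \<Rightarrow> fm"
  where "instM a = subst Var (case_nat a id)"

(* insert a fresh predicate variable at position c *)

primrec liftP :: "nat \<Rightarrow> fm \<Rightarrow> fm" where
  "liftP c \<^bold>\<bottom> = \<^bold>\<bottom>"
| "liftP c (s \<^bold>= t) = (s \<^bold>= t)"
| "liftP c (s \<^bold>\<le> t) = (s \<^bold>\<le> t)"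
| "liftP c (PVar p ts) = PVar (if p < c then p else Suc p) ts"
| "liftP c (Mu k A ts) = Mu k (liftP (Suc c) A) ts"
| "liftP c (Nu k A ts) = Nu k (liftP (Suc c) A) ts"
| "liftP c (A \<^bold>\<and> B) = (liftP c A \<^bold>\<and> liftP c B)"
| "liftP c (A \<^bold>\<or> B) = (liftP c A \<^bold>\<or> liftP c B)"
| "liftP c (A \<^bold>\<rightarrow> B) = (liftP c A \<^bold>\<rightarrow> liftP c B)"
| "liftP c (Forall A) = Forall (liftP c A)"
| "liftP c (Exists A) = Exists (liftP c A)"
| "liftP c (ForallM A) = ForallM (liftP c A)"
| "liftP c (ExistsM A) = ExistsM (liftP c A)"

(* substitute the k-ary predicate P for the predicate variable p and remove p *)

primrec psubst :: "nat \<Rightarrow> nat \<Rightarrow> fm \<Rightarrow> fm \<Rightarrow> fm" where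
  "psubst p k P \<^bold>\<bottom> = \<^bold>\<bottom>"
| "psubst p k P (s \<^bold>= t) = (s \<^bold>= t)"
| "psubst p k P (s \<^bold>\<le> t) = (s \<^bold>\<le> t)"
| "psubst p k P (PVar q ts) = (if q = p then inst ts P else PVar (if q < p then q else q - 1) ts)"
| "psubst p k P (Mu j A ts) = Mu j (psubst (Suc p) k (liftP 0 (lift k j P)) A) ts"
| "psubst p k P (Nu j A ts) = Nu j (psubst (Suc p) k (liftP 0 (lift k j P)) A) ts"
| "psubst p k P (A \<^bold>\<and> B) = (psubst p k P A \<^bold>\<and> psubst p k P B)"
| "psubst p k P (A \<^bold>\<or> B) = (psubst p k P A \<^bold>\<or> psubst p k P B)"
| "psubst p k P (A \<^bold>\<rightarrow> B) = (psubst p k P A \<^bold>\<rightarrow> psubst p k P B)"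
| "psubst p k P (Forall A) = Forall (psubst p k (lift k 1 P) A)"
| "psubst p k P (Exists A) = Exists (psubst p k (lift k 1 P) A)"
| "psubst p k P (ForallM A) = ForallM (psubst p k (liftM P) A)"
| "psubst p k P (ExistsM A) = ExistsM (psubst p k (liftM P) A)"


section \<open>Strict positivity and non-computational formulas\<close>

primrec poccurs :: "nat \<Rightarrow> fm \<Rightarrow> bool" where
  "poccurs p \<^bold>\<bottom> = False"
| "poccurs p (s \<^bold>= t) = False"
| "poccurs p (s \<^bold>\<le> t) = False"
| "poccurs p (PVar q ts) = (q = p)"
| "poccurs p (Mu k A ts) = poccurs (Suc p) A"
| "poccurs p (Nu k A ts) = poccurs (Suc p) A"
| "poccurs p (A \<^bold>\<and> B) = (poccurs p A \<or> poccurs p B)"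
| "poccurs p (A \<^bold>\<or> B) = (poccurs p A \<or> poccurs p B)"
| "poccurs p (A \<^bold>\<rightarrow> B) = (poccurs p A \<or> poccurs p B)"
| "poccurs p (Forall A) = poccurs p A"
| "poccurs p (Exists A) = poccurs p A"
| "poccurs p (ForallM A) = poccurs p A"
| "poccurs p (ExistsM A) = poccurs p A"

(* p occurs only strictly positively (never to the left of an implication) and with k arguments *)

primrec strictly_pos :: "nat \<Rightarrow> nat \<Rightarrow> fm \<Rightarrow> bool" where
  "strictly_pos p k \<^bold>\<bottom> = True"
| "strictly_pos p k (s \<^bold>= t) = True"
| "strictly_pos p k (s \<^bold>\<le> t) = True"
| "strictly_pos p k (PVar q ts) = (q = p \<longrightarrow> length ts = k)"
| "strictly_pos p k (Mu j A ts) = strictly_pos (Suc p) k A"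
| "strictly_pos p k (Nu j A ts) = strictly_pos (Suc p) k A"
| "strictly_pos p k (A \<^bold>\<and> B) = (strictly_pos p k A \<and> strictly_pos p k B)"
| "strictly_pos p k (A \<^bold>\<or> B) = (strictly_pos p k A \<and> strictly_pos p k B)"
| "strictly_pos p k (A \<^bold>\<rightarrow> B) = (\<not> poccurs p A \<and> strictly_pos p k B)"
| "strictly_pos p k (Forall A) = strictly_pos p k A"
| "strictly_pos p k (Exists A) = strictly_pos p k A"
| "strictly_pos p k (ForallM A) = strictly_pos p k A"
| "strictly_pos p k (ExistsM A) = strictly_pos p k A"

(* well-formed: fixed points are taken of strictly positive operators and all arities match *)

primrec wf_fm :: "fm \<Rightarrow> bool" where
  "wf_fm \<^bold>\<bottom> = True"
| "wf_fm (s \<^bold>= t) = True"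
| "wf_fm (s \<^bold>\<le> t) = True"
| "wf_fm (PVar q ts) = True"
| "wf_fm (Mu k A ts) = (strictly_pos 0 k A \<and> length ts = k \<and> wf_fm A)"
| "wf_fm (Nu k A ts) = (strictly_pos 0 k A \<and> length ts = k \<and> wf_fm A)"
| "wf_fm (A \<^bold>\<and> B) = (wf_fm A \<and> wf_fm B)"
| "wf_fm (A \<^bold>\<or> B) = (wf_fm A \<and> wf_fm B)"
| "wf_fm (A \<^bold>\<rightarrow> B) = (wf_fm A \<and> wf_fm B)"
| "wf_fm (Forall A) = wf_fm A"
| "wf_fm (Exists A) = wf_fm A"
| "wf_fm (ForallM A) = wf_fm A"
| "wf_fm (ExistsM A) = wf_fm A"

(* no disjunction, no predicate variable except those bound by the b enclosing fixed points *)

primrec non_comp :: "nat \<Rightarrow> fm \<Rightarrow> bool" where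
  "non_comp b \<^bold>\<bottom> = True"
| "non_comp b (s \<^bold>= t) = True"
| "non_comp b (s \<^bold>\<le> t) = True"
| "non_comp b (PVar q ts) = (q < b)"
| "non_comp b (Mu k A ts) = non_comp (Suc b) A"
| "non_comp b (Nu k A ts) = non_comp (Suc b) A"
| "non_comp b (A \<^bold>\<and> B) = (non_comp b A \<and> non_comp b B)"
| "non_comp b (A \<^bold>\<or> B) = False"
| "non_comp b (A \<^bold>\<rightarrow> B) = (non_comp b A \<and> non_comp b B)"
| "non_comp b (Forall A) = non_comp b A"
| "non_comp b (Exists A) = non_comp b A"
| "non_comp b (ForallM A) = non_comp b A"
| "non_comp b (ExistsM A) = non_comp b A"


section \<open>Defined predicates\<close>

(* The relation y < x is given by a formula R with Var 0 = y and Var 1 = x. *)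

definition Path :: "fm \<Rightarrow> tm \<Rightarrow> fm"
  where "Path R t = Nu 1 (Exists (R \<^bold>\<and> PVar 0 [Var 0])) [t]"

definition Acc :: "fm \<Rightarrow> tm \<Rightarrow> fm"
  where "Acc R t = Mu 1 (Forall (R \<^bold>\<rightarrow> PVar 0 [Var 0])) [t]"

definition N :: "tm \<Rightarrow> fm"
  where "N t = Mu 1 (Var 0 \<^bold>= Zero \<^bold>\<or> Exists (PVar 0 [Var 0] \<^bold>\<and> Var 1 \<^bold>= Var 0 \<^bold>+ One)) [t]"

(* Bound variables: u = Var 0, z = Var 1, y = Var 2. *)

definition Q :: "tm \<Rightarrow> fm"
  where "Q t = Exists (Exists (Exists (N (Var 2) \<^bold>\<and> N (Var 1) \<^bold>\<and> N (Var 0) \<^bold>\<and>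
           lift_tm 3 t \<^bold>= (Var 2 \<^bold>- Var 1) \<^bold>/ (Var 0 \<^bold>+ One))))"

definition neg_pow2 :: "tm \<Rightarrow> tm"
  where "neg_pow2 t = Pow2 (Zero \<^bold>- t)"

definition C :: "tm \<Rightarrow> fm"
  where "C t = Forall (N (Var 0) \<^bold>\<rightarrow>
           Exists (Q (Var 0) \<^bold>\<and> Absv (lift_tm 2 t \<^bold>- Var 0) \<^bold>\<le> neg_pow2 (Var 1)))"

definition apart0 :: "tm \<Rightarrow> fm"
  where "apart0 t = Exists (N (Var 0) \<^bold>\<and> neg_pow2 (Var 0) \<^bold>\<le> Absv (lift_tm 1 t))"


section \<open>Axioms\<close>

(* r_0 + r_1 x + ... + r_{d-1} x^{d-1} + x^d  for rs = [r_0, ..., r_{d-1}] *)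

primrec monic_poly :: "tm list \<Rightarrow> tm \<Rightarrow> tm" where
  "monic_poly [] x = One"
| "monic_poly (r # rs) x = r \<^bold>+ x \<^bold>* monic_poly rs x"

(* The axioms for the real numbers are disjunction-free except inside N: totality of the order in
   the form  s <= t or t <= s  would make the order decidable, and  "for each x there is a natural
   number n with x <= n"  would carry computational content.  All axioms are schematic in terms,
   which may contain free variables, i.e. they are implicitly universally quantified. *)

inductive axiom :: "fm \<Rightarrow> bool" where
  add_assoc: "axiom ((r \<^bold>+ s) \<^bold>+ t \<^bold>= r \<^bold>+ (s \<^bold>+ t))"
| add_comm: "axiom (s \<^bold>+ t \<^bold>= t \<^bold>+ s)"
| add_zero: "axiom (t \<^bold>+ Zero \<^bold>= t)"
| sub_add: "axiom ((s \<^bold>- t) \<^bold>+ t \<^bold>= s)"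
| mul_assoc: "axiom ((r \<^bold>* s) \<^bold>* t \<^bold>= r \<^bold>* (s \<^bold>* t))"
| mul_comm: "axiom (s \<^bold>* t \<^bold>= t \<^bold>* s)"
| mul_one: "axiom (t \<^bold>* One \<^bold>= t)"
| distrib: "axiom (r \<^bold>* (s \<^bold>+ t) \<^bold>= r \<^bold>* s \<^bold>+ r \<^bold>* t)"
| zero_neq_one: "axiom (\<^bold>\<not> Zero \<^bold>= One)"
| div_mul: "axiom (\<^bold>\<not> t \<^bold>= Zero \<^bold>\<rightarrow> (s \<^bold>/ t) \<^bold>* t \<^bold>= s)"
| le_refl: "axiom (t \<^bold>\<le> t)"
| le_antisym: "axiom (s \<^bold>\<le> t \<^bold>\<rightarrow> t \<^bold>\<le> s \<^bold>\<rightarrow> s \<^bold>= t)"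
| le_trans: "axiom (r \<^bold>\<le> s \<^bold>\<rightarrow> s \<^bold>\<le> t \<^bold>\<rightarrow> r \<^bold>\<le> t)"
| le_total: "axiom (\<^bold>\<not> s \<^bold>\<le> t \<^bold>\<rightarrow> t \<^bold>\<le> s)"
| le_stable: "axiom (\<^bold>\<not> \<^bold>\<not> s \<^bold>\<le> t \<^bold>\<rightarrow> s \<^bold>\<le> t)"
| le_add: "axiom (s \<^bold>\<le> t \<^bold>\<rightarrow> s \<^bold>+ r \<^bold>\<le> t \<^bold>+ r)"
| le_mul: "axiom (Zero \<^bold>\<le> s \<^bold>\<rightarrow> Zero \<^bold>\<le> t \<^bold>\<rightarrow> Zero \<^bold>\<le> s \<^bold>* t)"
| sqrt_ex: "axiom (Zero \<^bold>\<le> t \<^bold>\<rightarrow> Exists (Var 0 \<^bold>* Var 0 \<^bold>= lift_tm 1 t))"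
| odd_root_ex: "odd (length rs) \<Longrightarrow>
    axiom (Exists (monic_poly (map (lift_tm 1) rs) (Var 0) \<^bold>= Zero))"
| abs_nonneg: "axiom (Zero \<^bold>\<le> t \<^bold>\<rightarrow> Absv t \<^bold>= t)"
| abs_nonpos: "axiom (t \<^bold>\<le> Zero \<^bold>\<rightarrow> Absv t \<^bold>= Zero \<^bold>- t)"
| pow2_zero: "axiom (Pow2 Zero \<^bold>= One)"
| pow2_succ: "axiom (Pow2 (t \<^bold>+ One) \<^bold>= (One \<^bold>+ One) \<^bold>* Pow2 t)"
| archimedean: "axiom (Forall (N (Var 0) \<^bold>\<rightarrow> Absv (lift_tm 1 t) \<^bold>\<le> neg_pow2 (Var 0)) \<^bold>\<rightarrow> t \<^bold>= Zero)"
| brouwer_thesis: "wf_fm R \<Longrightarrow> non_comp 0 R \<Longrightarrow> axiom (\<^bold>\<not> Path R t \<^bold>\<rightarrow> Acc R t)"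
| update_ex: "axiom (ExistsM
    (Entry 0 (liftM_tm s) (liftM_tm t) \<^bold>= liftM_tm r \<^bold>\<and>
     Forall (Forall (\<^bold>\<not> (Var 1 \<^bold>= lift_tm 2 (liftM_tm s) \<^bold>\<and> Var 0 \<^bold>= lift_tm 2 (liftM_tm t)) \<^bold>\<rightarrow>
       Entry 0 (Var 1) (Var 0) \<^bold>= Entry (Suc a) (Var 1) (Var 0)))))"


section \<open>Derivability\<close>

(* For a k-ary operator Phi = lambda X. lambda x_0 ... x_{k-1}. A and a k-ary predicate P,
   op_app k A P  is the k-ary predicate  Phi(P). *)

definition op_app :: "nat \<Rightarrow> fm \<Rightarrow> fm \<Rightarrow> fm"
  where "op_app k A P = psubst 0 k (lift k k P) A"

definition Mu_pred :: "nat \<Rightarrow> fm \<Rightarrow> fm"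
  where "Mu_pred k A = Mu k (lift k k A) (map Var [0..<k])"

definition Nu_pred :: "nat \<Rightarrow> fm \<Rightarrow> fm"
  where "Nu_pred k A = Nu k (lift k k A) (map Var [0..<k])"

inductive derivable :: "fm list \<Rightarrow> fm \<Rightarrow> bool"  (infix "\<turnstile>" 20) where
  hyp: "A \<in> set \<Gamma> \<Longrightarrow> \<Gamma> \<turnstile> A"
| ax: "axiom A \<Longrightarrow> \<Gamma> \<turnstile> A"
| botE: "\<Gamma> \<turnstile> \<^bold>\<bottom> \<Longrightarrow> \<Gamma> \<turnstile> A"
| conjI: "\<Gamma> \<turnstile> A \<Longrightarrow> \<Gamma> \<turnstile> B \<Longrightarrow> \<Gamma> \<turnstile> (A \<^bold>\<and> B)"
| conjE1: "\<Gamma> \<turnstile> (A \<^bold>\<and> B) \<Longrightarrow> \<Gamma> \<turnstile> A"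
| conjE2: "\<Gamma> \<turnstile> (A \<^bold>\<and> B) \<Longrightarrow> \<Gamma> \<turnstile> B"
| disjI1: "\<Gamma> \<turnstile> A \<Longrightarrow> \<Gamma> \<turnstile> (A \<^bold>\<or> B)"
| disjI2: "\<Gamma> \<turnstile> B \<Longrightarrow> \<Gamma> \<turnstile> (A \<^bold>\<or> B)"
| disjE: "\<Gamma> \<turnstile> (A \<^bold>\<or> B) \<Longrightarrow> A # \<Gamma> \<turnstile> D \<Longrightarrow> B # \<Gamma> \<turnstile> D \<Longrightarrow> \<Gamma> \<turnstile> D"
| impI: "A # \<Gamma> \<turnstile> B \<Longrightarrow> \<Gamma> \<turnstile> (A \<^bold>\<rightarrow> B)"
| impE: "\<Gamma> \<turnstile> (A \<^bold>\<rightarrow> B) \<Longrightarrow> \<Gamma> \<turnstile> A \<Longrightarrow> \<Gamma> \<turnstile> B"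
| forallI: "map (lift 0 1) \<Gamma> \<turnstile> A \<Longrightarrow> \<Gamma> \<turnstile> Forall A"
| forallE: "\<Gamma> \<turnstile> Forall A \<Longrightarrow> \<Gamma> \<turnstile> inst [t] A"
| existsI: "\<Gamma> \<turnstile> inst [t] A \<Longrightarrow> \<Gamma> \<turnstile> Exists A"
| existsE: "\<Gamma> \<turnstile> Exists A \<Longrightarrow> A # map (lift 0 1) \<Gamma> \<turnstile> lift 0 1 D \<Longrightarrow> \<Gamma> \<turnstile> D"
| forallMI: "map liftM \<Gamma> \<turnstile> A \<Longrightarrow> \<Gamma> \<turnstile> ForallM A"
| forallME: "\<Gamma> \<turnstile> ForallM A \<Longrightarrow> \<Gamma> \<turnstile> instM a A"
| existsMI: "\<Gamma> \<turnstile> instM a A \<Longrightarrow> \<Gamma> \<turnstile> ExistsM A"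
| existsME: "\<Gamma> \<turnstile> ExistsM A \<Longrightarrow> A # map liftM \<Gamma> \<turnstile> liftM D \<Longrightarrow> \<Gamma> \<turnstile> D"
| eq_refl: "\<Gamma> \<turnstile> (t \<^bold>= t)"
| eq_subst: "\<Gamma> \<turnstile> (s \<^bold>= t) \<Longrightarrow> \<Gamma> \<turnstile> inst [s] A \<Longrightarrow> \<Gamma> \<turnstile> inst [t] A"
| closure: "strictly_pos 0 k A \<Longrightarrow> length ts = k \<Longrightarrow>
    \<Gamma> \<turnstile> inst ts (op_app k A (Mu_pred k A)) \<Longrightarrow> \<Gamma> \<turnstile> Mu k A ts"
| induction: "strictly_pos 0 k A \<Longrightarrow> length ts = k \<Longrightarrow>
    map (lift 0 k) \<Gamma> \<turnstile> (op_app k A P \<^bold>\<rightarrow> P) \<Longrightarrow> \<Gamma> \<turnstile> Mu k A ts \<Longrightarrow> \<Gamma> \<turnstile> inst ts P"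
| coclosure: "strictly_pos 0 k A \<Longrightarrow> length ts = k \<Longrightarrow>
    \<Gamma> \<turnstile> Nu k A ts \<Longrightarrow> \<Gamma> \<turnstile> inst ts (op_app k A (Nu_pred k A))"
| coinduction: "strictly_pos 0 k A \<Longrightarrow> length ts = k \<Longrightarrow>
    map (lift 0 k) \<Gamma> \<turnstile> (P \<^bold>\<rightarrow> op_app k A P) \<Longrightarrow> \<Gamma> \<turnstile> inst ts P \<Longrightarrow> \<Gamma> \<turnstile> Nu k A ts"


section \<open>Fields of reals\<close>

(* F is a unary predicate variable; provability with F free means provability for every predicate
   on the reals. *)

definition is_ring :: "nat \<Rightarrow> fm"
  where "is_ring F =
    (PVar F [Zero] \<^bold>\<and> PVar F [One] \<^bold>\<and>
     Forall (Forall (PVar F [Var 1] \<^bold>\<rightarrow> PVar F [Var 0] \<^bold>\<rightarrow>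
       PVar F [Var 1 \<^bold>+ Var 0] \<^bold>\<and> PVar F [Var 1 \<^bold>- Var 0] \<^bold>\<and> PVar F [Var 1 \<^bold>* Var 0])))"

definition is_field :: "nat \<Rightarrow> fm"
  where "is_field F =
    (is_ring F \<^bold>\<and>
     Forall (Forall (PVar F [Var 1] \<^bold>\<rightarrow> PVar F [Var 0] \<^bold>\<rightarrow> apart0 (Var 0) \<^bold>\<rightarrow>
       PVar F [Var 1 \<^bold>/ Var 0])))"

definition constructive_field :: "nat \<Rightarrow> fm"
  where "constructive_field F = (is_field F \<^bold>\<and> Forall (PVar F [Var 0] \<^bold>\<rightarrow> C (Var 0)))"


section \<open>Matrices\<close>

definition index :: "tm \<Rightarrow> tm \<Rightarrow> fm"
  where "index n t = (N t \<^bold>\<and> One \<^bold>\<le> t \<^bold>\<and> t \<^bold>\<le> n)"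

(* sum_is f n s  expresses  f(1) + ... + f(n) = s,  where f is a term with the summation index
   Var 0.  The graph of the partial sums is the least relation X with X(0,0) and
   X(m,s) --> X(m+1, s + f(m+1)).  In the second disjunct the variables are
   Var 0, Var 1 = the previous sum and index, Var 2 = the index, Var 3 = the sum, and the
   variables of the context from Var 4 on. *)

definition sum_is :: "tm \<Rightarrow> tm \<Rightarrow> tm \<Rightarrow> fm"
  where "sum_is f n s =
    Mu 2 ((Var 0 \<^bold>= Zero \<^bold>\<and> Var 1 \<^bold>= Zero) \<^bold>\<or>
          Exists (Exists (PVar 0 [Var 1, Var 0] \<^bold>\<and> Var 2 \<^bold>= Var 1 \<^bold>+ One \<^bold>\<and>
            Var 3 \<^bold>= Var 0 \<^bold>+ subst_tm (case_nat (Var 2) (\<lambda>i. Var (i + 4))) id f)))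
      [n, s]"

(* A matrix variable represents a square matrix of any size n through its entries with indices in
   {1, ..., n}, and a vector through its first column. *)

definition entries_in :: "nat \<Rightarrow> tm \<Rightarrow> nat \<Rightarrow> fm"
  where "entries_in F n A =
    Forall (Forall (index (lift_tm 2 n) (Var 1) \<^bold>\<rightarrow> index (lift_tm 2 n) (Var 0) \<^bold>\<rightarrow>
      PVar F [Entry A (Var 1) (Var 0)]))"

(* the columns of A are linearly independent *)

definition non_singular :: "tm \<Rightarrow> nat \<Rightarrow> fm"
  where "non_singular n A = ForallM
    (Forall (index (lift_tm 1 (liftM_tm n)) (Var 0) \<^bold>\<rightarrow>
       sum_is (Entry 0 (Var 0) One \<^bold>* Entry (Suc A) (Var 1) (Var 0)) (lift_tm 1 (liftM_tm n)) Zero)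
     \<^bold>\<rightarrow>
     Forall (index (lift_tm 1 (liftM_tm n)) (Var 0) \<^bold>\<rightarrow> Entry 0 (Var 0) One \<^bold>= Zero))"

(* (B * A)(k,l) = z *)

definition product_entry_is :: "tm \<Rightarrow> nat \<Rightarrow> nat \<Rightarrow> tm \<Rightarrow> tm \<Rightarrow> tm \<Rightarrow> fm"
  where "product_entry_is n B A k l z =
    sum_is (Entry B (lift_tm 1 k) (Var 0) \<^bold>* Entry A (Var 0) (lift_tm 1 l)) n z"

(* B * A = E, with k = Var 1 and l = Var 0 *)

definition product_is_identity :: "tm \<Rightarrow> nat \<Rightarrow> nat \<Rightarrow> fm"
  where "product_is_identity n B A =
    Forall (Forall (index (lift_tm 2 n) (Var 1) \<^bold>\<rightarrow> index (lift_tm 2 n) (Var 0) \<^bold>\<rightarrow>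
      (Var 1 \<^bold>= Var 0 \<^bold>\<rightarrow> product_entry_is (lift_tm 2 n) B A (Var 1) (Var 0) One) \<^bold>\<and>
      (\<^bold>\<not> Var 1 \<^bold>= Var 0 \<^bold>\<rightarrow> product_entry_is (lift_tm 2 n) B A (Var 1) (Var 0) Zero)))"

definition invertible :: "nat \<Rightarrow> tm \<Rightarrow> nat \<Rightarrow> fm"
  where "invertible F n A = ExistsM
    (entries_in F (liftM_tm n) 0 \<^bold>\<and> product_is_identity (liftM_tm n) 0 (Suc A))"

end

theory Submission
  imports Defs
begin

text \<open>For a vector \<open>v\<close> put \<open>w = A v\<close> and \<open>q = A\<^sup>T w\<close>.  Since \<open>v \<bullet> q = |w|\<^sup>2\<close>, non-singularity gives
  \<open>v \<bullet> q \<noteq> 0\<close> as soon as \<open>v \<noteq> 0\<close>, so elimination with \<open>A\<^sup>T A\<close> instead of \<open>A\<close> never has to search for a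
  pivot.  It yields, for each \<open>k\<close>, a vector \<open>v\<close> over the field with \<open>v\<^sub>k = 1\<close> and \<open>q\<^sub>l = 0\<close> for \<open>l \<noteq> k\<close>;
  then \<open>q\<^sub>k = |w|\<^sup>2 \<noteq> 0\<close>, and \<open>w / q\<^sub>k\<close> is the \<open>k\<close>-th row of the inverse.  The field is closed under
  division only by elements apart from \<open>0\<close>; that a nonzero constructive real \<open>x\<close> is apart from \<open>0\<close>
  follows by induction along \<open>x, 2x, 4x, \<dots>\<close>, which Brouwer's thesis and the Archimedean axiom justify.

  Derivations are built as in a Kripke model whose worlds are the contexts: a universal formula is
  derivable iff all its instances are, an implication iff it preserves derivability in every larger
  context, and \<open>subst \<sigma> \<tau> A\<close> plays the role of \<open>A\<close> in the environment \<open>\<sigma>\<close>, \<open>\<tau>\<close>.\<close>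

text \<open>Ordinary elimination looks for a nonzero entry in a column. Nothing provides its
  position here: non-singularity is a universal statement that concludes an equation, so it yields
  no witness. For A^T A the pivot sits at a known place: the elimination step arranges that p . r,
  with r = A^T A p, reduces to the product at the newest index, and p . r equals |A p|^2. Hence only
  a negation has to be extracted from the matrix. The matrix found is the inverse of A^T A times
  A^T, although A^T A is never formed.

  Two kinds of case distinction are available. The order of natural numbers is decidable, by
  induction; and order and equality of reals are stable, so goals of that form may be proved
  classically. Existential and disjunctive goals get only the former. Sums are relations and arrays
  change one entry at a time, so sums, vectors and the inverse are all produced by induction on a
  natural number, each witness being handed to the continuation \<open>D\<close>.\<close>

abbreviation scons :: "'a \<Rightarrow> (nat \<Rightarrow> 'a) \<Rightarrow> nat \<Rightarrow> 'a"  (infixr "\<triangleright>" 60)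
  where "a \<triangleright> f \<equiv> case_nat a f"

section \<open>The algebra of substitutions\<close>

lemma subst_tm_cong:
  "(\<And>i. \<sigma> i = \<sigma>' i) \<Longrightarrow> (\<And>a. \<tau> a = \<tau>' a) \<Longrightarrow> subst_tm \<sigma> \<tau> t = subst_tm \<sigma>' \<tau>' t"
  by (induction t) auto

lemma subst_tm_id: "subst_tm Var id t = t"
  by (induction t) auto

lemma subst_tm_subst_tm:
  "subst_tm \<sigma> \<tau> (subst_tm \<sigma>' \<tau>' t) = subst_tm (\<lambda>i. subst_tm \<sigma> \<tau> (\<sigma>' i)) (\<lambda>a. \<tau> (\<tau>' a)) t"
  by (induction t) auto

lemma subst_tm_lift_tm: "subst_tm \<sigma> \<tau> (lift_tm k t) = subst_tm (\<lambda>i. \<sigma> (i + k)) \<tau> t"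
  by (simp add: lift_tm_def subst_tm_subst_tm)

lemma subst_tm_liftM_tm: "subst_tm \<sigma> \<tau> (liftM_tm t) = subst_tm \<sigma> (\<lambda>a. \<tau> (Suc a)) t"
  by (simp add: liftM_tm_def subst_tm_subst_tm)

lemma up_subst_tm: "subst_tm (up k \<sigma>) \<tau> (up k \<sigma>' i) = up k (\<lambda>i. subst_tm \<sigma> \<tau> (\<sigma>' i)) i"
proof -
  have "subst_tm (up k \<sigma>) \<tau> (lift_tm k t) = lift_tm k (subst_tm \<sigma> \<tau> t)" for t
    by (simp add: subst_tm_lift_tm) (simp add: up_def lift_tm_def subst_tm_subst_tm)
  then show ?thesis by (simp add: up_def)
qed

lemma liftM_subst_tm:
  "subst_tm (\<lambda>i. liftM_tm (\<sigma> i)) (upM \<tau>) (liftM_tm t) = liftM_tm (subst_tm \<sigma> \<tau> t)"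
  by (simp add: subst_tm_liftM_tm) (simp add: upM_def liftM_tm_def subst_tm_subst_tm)

lemma upM_upM: "upM \<tau> (upM \<tau>' a) = upM (\<lambda>a. \<tau> (\<tau>' a)) a"
  by (simp add: upM_def split: nat.split)

lemma subst_subst:
  "subst \<sigma> \<tau> (subst \<sigma>' \<tau>' A) = subst (\<lambda>i. subst_tm \<sigma> \<tau> (\<sigma>' i)) (\<lambda>a. \<tau> (\<tau>' a)) A"
  by (induction A arbitrary: \<sigma> \<tau> \<sigma>' \<tau>')
    (auto simp: subst_tm_subst_tm up_subst_tm liftM_subst_tm upM_upM)

lemma up_Var: "up k Var = Var"
  by (rule ext) (simp add: up_def lift_tm_def)

lemma liftM_tm_Var: "liftM_tm (Var i) = Var i"
  by (simp add: liftM_tm_def)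

lemma upM_id: "upM id = id"
  by (auto simp: upM_def split: nat.split)

lemma subst_id: "subst Var id A = A"
  by (induction A)
    (simp_all add: up_Var subst_tm_id liftM_tm_Var upM_id map_idI del: id_apply)

lemma scons_Var: "(Var 0 \<triangleright> (\<lambda>i. Var (Suc i))) = Var"
  by (auto split: nat.split)

section \<open>Bounds on free variables and the coincidence lemma\<close>

primrec vars_below_tm :: "nat \<Rightarrow> nat \<Rightarrow> tm \<Rightarrow> bool" where
  "vars_below_tm n m (Var i) = (i < n)"
| "vars_below_tm n m Zero = True"
| "vars_below_tm n m One = True"
| "vars_below_tm n m (s \<^bold>+ t) = (vars_below_tm n m s \<and> vars_below_tm n m t)"
| "vars_below_tm n m (s \<^bold>- t) = (vars_below_tm n m s \<and> vars_below_tm n m t)"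
| "vars_below_tm n m (s \<^bold>* t) = (vars_below_tm n m s \<and> vars_below_tm n m t)"
| "vars_below_tm n m (s \<^bold>/ t) = (vars_below_tm n m s \<and> vars_below_tm n m t)"
| "vars_below_tm n m (Absv t) = vars_below_tm n m t"
| "vars_below_tm n m (Pow2 t) = vars_below_tm n m t"
| "vars_below_tm n m (Entry a s t) = (a < m \<and> vars_below_tm n m s \<and> vars_below_tm n m t)"

text \<open>The bounds \<open>n\<close> and \<open>m\<close> are kept apart because real and matrix
  variables are numbered separately: a real quantifier raises only \<open>n\<close>, a matrix
  quantifier only \<open>m\<close>. Predicate variables are not counted, since \<open>subst\<close>
  leaves them alone.\<close>

primrec vars_below :: "nat \<Rightarrow> nat \<Rightarrow> fm \<Rightarrow> bool" where
  "vars_below n m \<^bold>\<bottom> = True"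
| "vars_below n m (s \<^bold>= t) = (vars_below_tm n m s \<and> vars_below_tm n m t)"
| "vars_below n m (s \<^bold>\<le> t) = (vars_below_tm n m s \<and> vars_below_tm n m t)"
| "vars_below n m (PVar p ts) = (\<forall>t\<in>set ts. vars_below_tm n m t)"
| "vars_below n m (Mu k A ts) = (vars_below (n + k) m A \<and> (\<forall>t\<in>set ts. vars_below_tm n m t))"
| "vars_below n m (Nu k A ts) = (vars_below (n + k) m A \<and> (\<forall>t\<in>set ts. vars_below_tm n m t))"
| "vars_below n m (A \<^bold>\<and> B) = (vars_below n m A \<and> vars_below n m B)"
| "vars_below n m (A \<^bold>\<or> B) = (vars_below n m A \<and> vars_below n m B)"
| "vars_below n m (A \<^bold>\<rightarrow> B) = (vars_below n m A \<and> vars_below n m B)"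
| "vars_below n m (Forall A) = vars_below (Suc n) m A"
| "vars_below n m (Exists A) = vars_below (Suc n) m A"
| "vars_below n m (ForallM A) = vars_below n (Suc m) A"
| "vars_below n m (ExistsM A) = vars_below n (Suc m) A"

lemma vars_below_tm_subst:
  "vars_below_tm n m t \<Longrightarrow> (\<And>i. i < n \<Longrightarrow> \<sigma> i = \<sigma>' i) \<Longrightarrow> (\<And>a. a < m \<Longrightarrow> \<tau> a = \<tau>' a) \<Longrightarrow>
    subst_tm \<sigma> \<tau> t = subst_tm \<sigma>' \<tau>' t"
  by (induction t) auto

text \<open>The coincidence lemma. It serves two purposes: infinite environments are cut off at a
  finite bound, and a renaming that treats one fresh variable specially is recognised as plain
  lifting on formulas without that variable.\<close>

lemma vars_below_subst:
  "vars_below n m A \<Longrightarrow> (\<And>i. i < n \<Longrightarrow> \<sigma> i = \<sigma>' i) \<Longrightarrow> (\<And>a. a < m \<Longrightarrow> \<tau> a = \<tau>' a) \<Longrightarrow>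
    subst \<sigma> \<tau> A = subst \<sigma>' \<tau>' A"
proof (induction A arbitrary: n m \<sigma> \<sigma>' \<tau> \<tau>')
  case (Mu k A ts)
  have "subst (up k \<sigma>) \<tau> A = subst (up k \<sigma>') \<tau>' A"
    using Mu.prems by (intro Mu.IH[of "n + k" m]) (auto simp: up_def)
  moreover have "map (subst_tm \<sigma> \<tau>) ts = map (subst_tm \<sigma>' \<tau>') ts"
    using Mu.prems by (auto intro!: vars_below_tm_subst[of n m])
  ultimately show ?case by simp
next
  case (Nu k A ts)
  have "subst (up k \<sigma>) \<tau> A = subst (up k \<sigma>') \<tau>' A"
    using Nu.prems by (intro Nu.IH[of "n + k" m]) (auto simp: up_def)
  moreover have "map (subst_tm \<sigma> \<tau>) ts = map (subst_tm \<sigma>' \<tau>') ts"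
    using Nu.prems by (auto intro!: vars_below_tm_subst[of n m])
  ultimately show ?case by simp
next
  case (Forall A)
  have "subst (up 1 \<sigma>) \<tau> A = subst (up 1 \<sigma>') \<tau>' A"
    using Forall.prems by (intro Forall.IH[of "Suc n" m]) (auto simp: up_def)
  then show ?case by simp
next
  case (Exists A)
  have "subst (up 1 \<sigma>) \<tau> A = subst (up 1 \<sigma>') \<tau>' A"
    using Exists.prems by (intro Exists.IH[of "Suc n" m]) (auto simp: up_def)
  then show ?case by simp
next
  case (ForallM A)
  have "subst (\<lambda>i. liftM_tm (\<sigma> i)) (upM \<tau>) A = subst (\<lambda>i. liftM_tm (\<sigma>' i)) (upM \<tau>') A"
    using ForallM.prems by (intro ForallM.IH[of n "Suc m"]) (auto simp: upM_def split: nat.split)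
  then show ?case by simp
next
  case (ExistsM A)
  have "subst (\<lambda>i. liftM_tm (\<sigma> i)) (upM \<tau>) A = subst (\<lambda>i. liftM_tm (\<sigma>' i)) (upM \<tau>') A"
    using ExistsM.prems by (intro ExistsM.IH[of n "Suc m"]) (auto simp: upM_def split: nat.split)
  then show ?case by simp
next
  case (Eq s t)
  have "subst_tm \<sigma> \<tau> u = subst_tm \<sigma>' \<tau>' u" if "vars_below_tm n m u" for u
    using that Eq.prems(2,3) by (rule vars_below_tm_subst)
  with Eq.prems(1) show ?case by simp
next
  case (Le s t)
  have "subst_tm \<sigma> \<tau> u = subst_tm \<sigma>' \<tau>' u" if "vars_below_tm n m u" for u
    using that Le.prems(2,3) by (rule vars_below_tm_subst)
  with Le.prems(1) show ?case by simp
next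
  case (PVar p ts)
  have "subst_tm \<sigma> \<tau> u = subst_tm \<sigma>' \<tau>' u" if "vars_below_tm n m u" for u
    using that PVar.prems(2,3) by (rule vars_below_tm_subst)
  with PVar.prems(1) show ?case by simp
next
  case (Conj A B)
  have "subst \<sigma> \<tau> A = subst \<sigma>' \<tau>' A"
    by (rule Conj.IH(1)[of n m, OF _ Conj.prems(2,3)]) (use Conj.prems(1) in simp_all)
  moreover have "subst \<sigma> \<tau> B = subst \<sigma>' \<tau>' B"
    by (rule Conj.IH(2)[of n m, OF _ Conj.prems(2,3)]) (use Conj.prems(1) in simp_all)
  ultimately show ?case by simp
next
  case (Disj A B)
  have "subst \<sigma> \<tau> A = subst \<sigma>' \<tau>' A"
    by (rule Disj.IH(1)[of n m, OF _ Disj.prems(2,3)]) (use Disj.prems(1) in simp_all)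
  moreover have "subst \<sigma> \<tau> B = subst \<sigma>' \<tau>' B"
    by (rule Disj.IH(2)[of n m, OF _ Disj.prems(2,3)]) (use Disj.prems(1) in simp_all)
  ultimately show ?case by simp
next
  case (Imp A B)
  have "subst \<sigma> \<tau> A = subst \<sigma>' \<tau>' A"
    by (rule Imp.IH(1)[of n m, OF _ Imp.prems(2,3)]) (use Imp.prems(1) in simp_all)
  moreover have "subst \<sigma> \<tau> B = subst \<sigma>' \<tau>' B"
    by (rule Imp.IH(2)[of n m, OF _ Imp.prems(2,3)]) (use Imp.prems(1) in simp_all)
  ultimately show ?case by simp
qed simp_all

lemma vars_below_tm_mono: "vars_below_tm n m t \<Longrightarrow> n \<le> n' \<Longrightarrow> m \<le> m' \<Longrightarrow> vars_below_tm n' m' t"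
  by (induction t) auto

lemma vars_below_mono: "vars_below n m A \<Longrightarrow> n \<le> n' \<Longrightarrow> m \<le> m' \<Longrightarrow> vars_below n' m' A"
proof (induction A arbitrary: n m n' m')
  case (Mu k A ts)
  then show ?case by simp (meson add_le_mono1 vars_below_tm_mono)
next
  case (Nu k A ts)
  then show ?case by simp (meson add_le_mono1 vars_below_tm_mono)
qed (simp_all, (meson vars_below_tm_mono Suc_le_mono)+)

lemma ex_vars_below_tm: "\<exists>n. vars_below_tm n n t"
proof (induction t)
  case (Var i)
  then show ?case by auto
next
  case (Entry a s t)
  then obtain n n' where "vars_below_tm n n s" "vars_below_tm n' n' t" by blast
  then have "vars_below_tm (Suc (a + n + n')) (Suc (a + n + n')) (Entry a s t)"
    by (auto intro: vars_below_tm_mono)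
  then show ?case by blast
qed (auto, (meson vars_below_tm_mono nat_le_linear)+)

lemma ex_vars_below_tms: "\<exists>n. \<forall>t\<in>set ts. vars_below_tm n n t"
proof (induction ts)
  case (Cons t ts)
  then obtain n n' where "vars_below_tm n n t" "\<forall>t\<in>set ts. vars_below_tm n' n' t" using ex_vars_below_tm by blast
  then have "\<forall>t\<in>set (t # ts). vars_below_tm (n + n') (n + n') t"
    by (auto intro: vars_below_tm_mono)
  then show ?case by blast
qed simp

lemma ex_vars_below: "\<exists>n. vars_below n n A"
proof (induction A)
  case (Eq s t)
  show ?case using ex_vars_below_tms[of "[s, t]"] by simp
next
  case (Le s t)
  show ?case using ex_vars_below_tms[of "[s, t]"] by simp
next
  case (PVar p ts)
  show ?case using ex_vars_below_tms by simp
next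
  case (Mu k A ts)
  obtain n n' where "vars_below n n A" "\<forall>t\<in>set ts. vars_below_tm n' n' t" using Mu ex_vars_below_tms by blast
  then have "vars_below (n + n') (n + n') (Mu k A ts)" by (auto intro: vars_below_mono vars_below_tm_mono)
  then show ?case by blast
next
  case (Nu k A ts)
  obtain n n' where "vars_below n n A" "\<forall>t\<in>set ts. vars_below_tm n' n' t" using Nu ex_vars_below_tms by blast
  then have "vars_below (n + n') (n + n') (Nu k A ts)" by (auto intro: vars_below_mono vars_below_tm_mono)
  then show ?case by blast
next
  case (Forall A)
  then show ?case by simp (meson vars_below_mono lessI less_imp_le order_refl)
next
  case (Exists A)
  then show ?case by simp (meson vars_below_mono lessI less_imp_le order_refl)
next
  case (ForallM A)
  then show ?case by simp (meson vars_below_mono lessI less_imp_le order_refl)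
next
  case (ExistsM A)
  then show ?case by simp (meson vars_below_mono lessI less_imp_le order_refl)
qed (auto, (meson vars_below_mono nat_le_linear)+)

lemma ex_vars_below_list: "\<exists>n. \<forall>A\<in>set \<Gamma>. vars_below n n A"
proof (induction \<Gamma>)
  case (Cons A \<Gamma>)
  then obtain n n' where "vars_below n n A" "\<forall>A\<in>set \<Gamma>. vars_below n' n' A" using ex_vars_below by blast
  then have "\<forall>B\<in>set (A # \<Gamma>). vars_below (n + n') (n + n') B"
    by (auto intro: vars_below_mono)
  then show ?case by blast
qed simp


section \<open>Derived rules\<close>

text \<open>The unqualified names of the natural deduction rules (\<open>impI\<close>, \<open>disjE\<close>, ...) denote those of the
  object calculus; the rules of HOL need the prefix \<open>HOL\<close>.\<close>

abbreviation ext :: "fm list \<Rightarrow> fm list \<Rightarrow> bool"  (infix "\<sqsubseteq>" 50)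
  where "\<Gamma> \<sqsubseteq> \<Delta> \<equiv> set \<Gamma> \<subseteq> set \<Delta>"

text \<open>Contexts are compared as sets, so exchange and contraction are included. The rules that
  add hypotheses or lift the context are treated separately, because their induction hypothesis must
  be used at a correspondingly changed \<open>\<Delta>\<close>.\<close>

lemma weaken: "\<Gamma> \<turnstile> A \<Longrightarrow> \<Gamma> \<sqsubseteq> \<Delta> \<Longrightarrow> \<Delta> \<turnstile> A"
proof (induction arbitrary: \<Delta> rule: derivable.induct)
  case (disjE \<Gamma> A B D)
  have "A # \<Delta> \<turnstile> D" using disjE.prems by (intro disjE.IH(2)) auto
  moreover have "B # \<Delta> \<turnstile> D" using disjE.prems by (intro disjE.IH(3)) auto
  moreover note disjE.IH(1)[OF disjE.prems]
  ultimately show ?case by (blast intro: derivable.disjE)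
next
  case (existsE \<Gamma> A D)
  have "A # map (lift 0 1) \<Delta> \<turnstile> lift 0 1 D" using existsE.prems by (intro existsE.IH) auto
  with existsE show ?case by (blast intro: derivable.existsE)
next
  case (existsME \<Gamma> A D)
  have "A # map liftM \<Delta> \<turnstile> liftM D" using existsME.prems by (intro existsME.IH) auto
  with existsME show ?case by (blast intro: derivable.existsME)
next
  case (impI A \<Gamma> B)
  have "A # \<Delta> \<turnstile> B" using impI.prems by (intro impI.IH) auto
  then show ?case by (rule derivable.impI)
next
  case (forallI \<Gamma> A)
  have "map (lift 0 1) \<Delta> \<turnstile> A" using forallI.prems by (intro forallI.IH) auto
  then show ?case by (rule derivable.forallI)
next
  case (forallMI \<Gamma> A)
  have "map liftM \<Delta> \<turnstile> A" using forallMI.prems by (intro forallMI.IH) auto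
  then show ?case by (rule derivable.forallMI)
next
  case (induction k A ts \<Gamma> P)
  have "map (lift 0 k) \<Delta> \<turnstile> (op_app k A P \<^bold>\<rightarrow> P)"
    using induction.prems by (intro induction.IH) auto
  with induction show ?case by (blast intro: derivable.induction)
next
  case (coinduction k A ts \<Gamma> P)
  have "map (lift 0 k) \<Delta> \<turnstile> (P \<^bold>\<rightarrow> op_app k A P)"
    using coinduction.prems by (intro coinduction.IH) auto
  with coinduction show ?case by (blast intro: derivable.coinduction)
qed (blast intro: derivable.intros)+

text \<open>Moving the context into the formula reduces substitution in a sequent to the empty
  context, where \<open>forallI\<close> and \<open>forallMI\<close> impose no condition on
  hypotheses.\<close>

fun imps :: "fm list \<Rightarrow> fm \<Rightarrow> fm" where
  "imps [] A = A"
| "imps (B # \<Gamma>) A = imps \<Gamma> (B \<^bold>\<rightarrow> A)"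

lemma impD: "\<Gamma> \<turnstile> (A \<^bold>\<rightarrow> B) \<Longrightarrow> A # \<Gamma> \<turnstile> B"
  by (rule impE[of _ A]) (auto intro: weaken hyp)

lemma imps_iff: "([] \<turnstile> imps \<Gamma> A) = (\<Gamma> \<turnstile> A)"
proof (induction \<Gamma> arbitrary: A)
  case (Cons B \<Gamma>)
  then show ?case by (auto intro: derivable.impI impD)
qed simp

lemma subst_imps: "subst \<sigma> \<tau> (imps \<Gamma> A) = imps (map (subst \<sigma> \<tau>) \<Gamma>) (subst \<sigma> \<tau> A)"
  by (induction \<Gamma> arbitrary: A) auto

lemma inst_single: "inst [t] A = subst (t \<triangleright> Var) id A"
  unfolding inst_def by (rule arg_cong[of _ _ "\<lambda>\<sigma>. subst \<sigma> id A"]) (auto split: nat.split)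

lemma lift_0_1: "lift 0 1 A = subst (\<lambda>i. Var (Suc i)) id A"
  by (simp add: lift_def)

text \<open>From the empty context one may generalise and instantiate, one term at a time. The head
  term is weakened by \<open>length ts\<close>, since the instantiations that follow would otherwise
  act on its own variables.\<close>

lemma derivable_inst: "[] \<turnstile> A \<Longrightarrow> [] \<turnstile> inst ts A"
proof (induction ts arbitrary: A)
  case Nil
  then show ?case by (simp add: inst_def subst_id)
next
  case (Cons t ts)
  have "[] \<turnstile> inst [lift_tm (length ts) t] A"
    using Cons.prems by (intro forallE derivable.forallI) simp
  then have "[] \<turnstile> inst ts (inst [lift_tm (length ts) t] A)" by (rule Cons.IH)
  also have "inst ts (inst [lift_tm (length ts) t] A) = inst (t # ts) A"
    unfolding inst_single unfolding inst_def subst_subst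
    by (rule arg_cong2[of _ _ _ _ "\<lambda>\<sigma> \<tau>. subst \<sigma> \<tau> A"])
      (auto simp: fun_eq_iff subst_tm_lift_tm subst_tm_id split: nat.split)
  finally show ?case .
qed

lemma derivable_instM: "[] \<turnstile> A \<Longrightarrow> [] \<turnstile> subst Var (\<lambda>a. if a < length as then as ! a else a - length as) A"
proof (induction as arbitrary: A)
  case Nil
  then show ?case by (simp add: subst_id[unfolded id_def])
next
  case (Cons b as)
  have "[] \<turnstile> instM (b + length as) A"
    using Cons.prems by (intro forallME derivable.forallMI) simp
  from Cons.IH[OF this] show ?case
    unfolding instM_def subst_subst
    by (rule back_subst[of "derivable []"], intro arg_cong2[of _ _ _ _ "\<lambda>\<sigma> \<tau>. subst \<sigma> \<tau> A"])
      (auto split: nat.split)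
qed

text \<open>Only variables below \<open>n\<close> occur in \<open>A\<close>, so finite lists can
  replace the infinite substitutions. Matrix variables are renamed before real variables are
  instantiated; in the other order \<open>\<tau>\<close> would also rename the matrix variables
  inside the terms of \<open>\<sigma>\<close>.\<close>

lemma derivable_subst_nil:
  assumes "[] \<turnstile> A"
  shows "[] \<turnstile> subst \<sigma> \<tau> A"
proof -
  obtain n where n: "vars_below n n A" using ex_vars_below by blast
  define as where "as = map \<tau> [0..<n]"
  define \<rho> :: "nat \<Rightarrow> nat" where "\<rho> a = (if a < n then \<tau> a else a - n)" for a
  have 1: "[] \<turnstile> subst Var \<rho> A"
    using derivable_instM[OF assms, of as] by (simp add: as_def \<rho>_def[abs_def] cong: if_cong)
  have 2: "[] \<turnstile> inst (map \<sigma> [0..<n]) (subst Var \<rho> A)" by (rule derivable_inst[OF 1])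
  also have "inst (map \<sigma> [0..<n]) (subst Var \<rho> A) = subst \<sigma> \<tau> A"
    unfolding inst_def subst_subst by (rule vars_below_subst[OF n]) (auto simp: \<rho>_def)
  finally show ?thesis .
qed

lemma derivable_subst: "\<Gamma> \<turnstile> A \<Longrightarrow> map (subst \<sigma> \<tau>) \<Gamma> \<turnstile> subst \<sigma> \<tau> A"
  using derivable_subst_nil[of "imps \<Gamma> A" \<sigma> \<tau>] by (simp add: subst_imps imps_iff)

text \<open>The eigenvariable condition disappears if the premise is required for all terms: one of them
  is a variable that does not occur in the context.\<close>

lemma forall_intro:
  assumes "\<And>t. \<Gamma> \<turnstile> subst (t \<triangleright> Var) id A"
  shows "\<Gamma> \<turnstile> Forall A"
proof -
  obtain k where k: "\<forall>B\<in>set (A # \<Gamma>). vars_below k k B" using ex_vars_below_list by blast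
  \<comment> \<open>\<open>Var k\<close> is the fresh eigenvariable. The substitution turns it into
    the bound \<open>Var 0\<close> and shifts all others as \<open>lift 0 1\<close> does.\<close>
  define \<rho> :: "nat \<Rightarrow> tm" where "\<rho> i = (if i = k then Var 0 else Var (Suc i))" for i
  have "map (subst \<rho> id) \<Gamma> \<turnstile> subst \<rho> id (subst (Var k \<triangleright> Var) id A)"
    using assms by (rule derivable_subst)
  also have "map (subst \<rho> id) \<Gamma> = map (lift 0 1) \<Gamma>"
    using k by (auto simp: lift_def \<rho>_def intro!: vars_below_subst[of k k])
  also have "subst \<rho> id (subst (Var k \<triangleright> Var) id A) = subst Var id A"
    unfolding subst_subst using k by (intro vars_below_subst[of k k]) (auto simp: \<rho>_def split: nat.split)
  finally show ?thesis unfolding subst_id by (rule forallI)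
qed

text \<open>The premise \<open>step\<close> speaks of all terms and all larger contexts, yet it is
  applied just once, to a variable fresh for \<open>A\<close>, \<open>D\<close> and
  \<open>\<Gamma>\<close>; renaming that variable to the bound one gives the premise of
  \<open>existsE\<close>.\<close>

lemma exists_elim:
  assumes ex: "\<Gamma> \<turnstile> Exists A"
    and step: "\<And>\<Delta> t. \<Gamma> \<sqsubseteq> \<Delta> \<Longrightarrow> \<Delta> \<turnstile> subst (t \<triangleright> Var) id A \<Longrightarrow> \<Delta> \<turnstile> D"
  shows "\<Gamma> \<turnstile> D"
proof -
  obtain k where k: "\<forall>B\<in>set (A # D # \<Gamma>). vars_below k k B" using ex_vars_below_list by blast
  define \<rho> :: "nat \<Rightarrow> tm" where "\<rho> i = (if i = k then Var 0 else Var (Suc i))" for i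
  have "subst (Var k \<triangleright> Var) id A # \<Gamma> \<turnstile> D"
    by (rule step[of _ "Var k"]) (auto intro: hyp)
  then have "map (subst \<rho> id) (subst (Var k \<triangleright> Var) id A # \<Gamma>) \<turnstile> subst \<rho> id D"
    by (rule derivable_subst)
  also have "map (subst \<rho> id) (subst (Var k \<triangleright> Var) id A # \<Gamma>) =
      subst \<rho> id (subst (Var k \<triangleright> Var) id A) # map (lift 0 1) \<Gamma>"
    using k by (auto simp: lift_def \<rho>_def intro!: vars_below_subst[of k k])
  also have "subst \<rho> id (subst (Var k \<triangleright> Var) id A) = subst Var id A"
    unfolding subst_subst using k by (intro vars_below_subst[of k k]) (auto simp: \<rho>_def split: nat.split)
  also have "subst \<rho> id D = lift 0 1 D"
    using k by (auto simp: lift_def \<rho>_def intro!: vars_below_subst[of k k])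
  finally show ?thesis unfolding subst_id by (rule existsE[OF ex])
qed

lemma forallM_intro:
  assumes "\<And>a. \<Gamma> \<turnstile> subst Var (a \<triangleright> id) A"
  shows "\<Gamma> \<turnstile> ForallM A"
proof -
  obtain k where k: "\<forall>B\<in>set (A # \<Gamma>). vars_below k k B" using ex_vars_below_list by blast
  define \<rho> :: "nat \<Rightarrow> nat" where "\<rho> i = (if i = k then 0 else Suc i)" for i
  have "map (subst Var \<rho>) \<Gamma> \<turnstile> subst Var \<rho> (subst Var (k \<triangleright> id) A)"
    using assms by (rule derivable_subst)
  also have "map (subst Var \<rho>) \<Gamma> = map liftM \<Gamma>"
    using k by (auto simp: liftM_def \<rho>_def intro!: vars_below_subst[of k k])
  also have "subst Var \<rho> (subst Var (k \<triangleright> id) A) = subst Var id A"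
    unfolding subst_subst using k by (intro vars_below_subst[of k k]) (auto simp: \<rho>_def split: nat.split)
  finally show ?thesis unfolding subst_id by (rule forallMI)
qed

lemma existsM_elim:
  assumes ex: "\<Gamma> \<turnstile> ExistsM A"
    and step: "\<And>\<Delta> a. \<Gamma> \<sqsubseteq> \<Delta> \<Longrightarrow> \<Delta> \<turnstile> subst Var (a \<triangleright> id) A \<Longrightarrow> \<Delta> \<turnstile> D"
  shows "\<Gamma> \<turnstile> D"
proof -
  obtain k where k: "\<forall>B\<in>set (A # D # \<Gamma>). vars_below k k B" using ex_vars_below_list by blast
  define \<rho> :: "nat \<Rightarrow> nat" where "\<rho> i = (if i = k then 0 else Suc i)" for i
  have "subst Var (k \<triangleright> id) A # \<Gamma> \<turnstile> D"
    by (rule step[of _ k]) (auto intro: hyp)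
  then have "map (subst Var \<rho>) (subst Var (k \<triangleright> id) A # \<Gamma>) \<turnstile> subst Var \<rho> D"
    by (rule derivable_subst)
  also have "map (subst Var \<rho>) (subst Var (k \<triangleright> id) A # \<Gamma>) =
      subst Var \<rho> (subst Var (k \<triangleright> id) A) # map liftM \<Gamma>"
    using k by (auto simp: liftM_def \<rho>_def intro!: vars_below_subst[of k k])
  also have "subst Var \<rho> (subst Var (k \<triangleright> id) A) = subst Var id A"
    unfolding subst_subst using k by (intro vars_below_subst[of k k]) (auto simp: \<rho>_def split: nat.split)
  also have "subst Var \<rho> D = liftM D"
    using k by (auto simp: liftM_def \<rho>_def intro!: vars_below_subst[of k k])
  finally show ?thesis unfolding subst_id by (rule existsME[OF ex])
qed

text \<open>With the quantifier clauses switched off, a quantified formula keeps the form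
  \<open>subst \<sigma> \<tau> (Forall A)\<close>. Its environment then grows by
  \<open>scons\<close> at each quantifier instead of being pushed into the body through
  \<open>up\<close>.\<close>

declare subst.simps(10-13) [simp del]

text \<open>The weak congruence rule would keep the simplifier from evaluating inside environments.\<close>

declare nat.case_cong_weak [cong del]

lemma subst_ident [simp]:
  "subst_tm Var id t = t" "subst_tm Var (\<lambda>a. a) t = t" "subst Var id A = A" "subst Var (\<lambda>a. a) A = A"
  by (simp_all add: subst_tm_id subst_id subst_tm_id[unfolded id_def] subst_id[unfolded id_def])

text \<open>Opening a binder after a substitution amounts to extending the environment. This
  identity turns the quantifier rules into semantic clauses.\<close>

lemma subst_scons_up: "subst (t \<triangleright> Var) id (subst (up (Suc 0) \<sigma>) \<tau> A) = subst (t \<triangleright> \<sigma>) \<tau> A"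
  unfolding subst_subst
  by (rule arg_cong2[of _ _ _ _ "\<lambda>\<sigma> \<tau>. subst \<sigma> \<tau> A"])
    (auto simp: fun_eq_iff up_def subst_tm_lift_tm subst_tm_id split: nat.split)

lemma subst_scons_upM:
  "subst Var (a \<triangleright> id) (subst (\<lambda>i. liftM_tm (\<sigma> i)) (upM \<tau>) A) = subst \<sigma> (a \<triangleright> \<tau>) A"
  unfolding subst_subst
  by (rule arg_cong2[of _ _ _ _ "\<lambda>\<sigma> \<tau>. subst \<sigma> \<tau> A"])
    (auto simp: fun_eq_iff upM_def subst_tm_liftM_tm subst_tm_id[unfolded id_def] split: nat.split)

lemma subst_tm_scons [simp]:
  "subst_tm \<sigma> \<tau> ((t \<triangleright> f) i) = (subst_tm \<sigma> \<tau> t \<triangleright> (\<lambda>j. subst_tm \<sigma> \<tau> (f j))) i"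
  by (simp split: nat.split)

section \<open>Forcing clauses\<close>

lemma derivable_Forall: "(\<Gamma> \<turnstile> Forall A) = (\<forall>t. \<Gamma> \<turnstile> subst (t \<triangleright> Var) id A)"
  by (metis forallE forall_intro inst_single)

lemma derivable_subst_Forall:
  "(\<Gamma> \<turnstile> subst \<sigma> \<tau> (Forall A)) = (\<forall>t. \<Gamma> \<turnstile> subst (t \<triangleright> \<sigma>) \<tau> A)"
  by (simp add: derivable_Forall subst.simps subst_scons_up)

lemma derivable_ForallM: "(\<Gamma> \<turnstile> ForallM A) = (\<forall>a. \<Gamma> \<turnstile> subst Var (a \<triangleright> id) A)"
  by (metis forallME forallM_intro instM_def)

lemma derivable_subst_ForallM:
  "(\<Gamma> \<turnstile> subst \<sigma> \<tau> (ForallM A)) = (\<forall>a. \<Gamma> \<turnstile> subst \<sigma> (a \<triangleright> \<tau>) A)"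
  by (simp add: derivable_ForallM subst.simps subst_scons_upM)

text \<open>As in a canonical model, the right-hand side need only be tested at the context extended
  by \<open>A\<close> itself; the other direction is weakening and modus ponens.\<close>

lemma derivable_Imp: "(\<Gamma> \<turnstile> (A \<^bold>\<rightarrow> B)) = (\<forall>\<Delta>. \<Gamma> \<sqsubseteq> \<Delta> \<longrightarrow> (\<Delta> \<turnstile> A) \<longrightarrow> (\<Delta> \<turnstile> B))"
proof
  assume "\<forall>\<Delta>. \<Gamma> \<sqsubseteq> \<Delta> \<longrightarrow> (\<Delta> \<turnstile> A) \<longrightarrow> (\<Delta> \<turnstile> B)"
  moreover have "\<Gamma> \<sqsubseteq> A # \<Gamma>" "A # \<Gamma> \<turnstile> A" by (auto intro: hyp)
  ultimately have "A # \<Gamma> \<turnstile> B" by blast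
  then show "\<Gamma> \<turnstile> (A \<^bold>\<rightarrow> B)" by (rule impI)
qed (blast intro: impE weaken)

lemma derivable_Conj: "(\<Gamma> \<turnstile> (A \<^bold>\<and> B)) = ((\<Gamma> \<turnstile> A) \<and> (\<Gamma> \<turnstile> B))"
  by (blast intro: derivable.conjI conjE1 conjE2)

lemmas forces = derivable_Forall derivable_subst_Forall derivable_ForallM derivable_subst_ForallM
  derivable_Imp derivable_Conj

text \<open>Disjunction and existence admit no equivalence of the kind collected in
  \<open>forces\<close>: a context may derive a disjunction without deriving either disjunct. Their
  elimination rules keep the goal \<open>D\<close> and move to a larger context in which a disjunct
  or an instance is derivable.\<close>

lemma Disj_elim:
  assumes "\<Gamma> \<turnstile> (A \<^bold>\<or> B)"
    and "\<And>\<Delta>. \<Gamma> \<sqsubseteq> \<Delta> \<Longrightarrow> \<Delta> \<turnstile> A \<Longrightarrow> \<Delta> \<turnstile> D" and "\<And>\<Delta>. \<Gamma> \<sqsubseteq> \<Delta> \<Longrightarrow> \<Delta> \<turnstile> B \<Longrightarrow> \<Delta> \<turnstile> D"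
  shows "\<Gamma> \<turnstile> D"
  by (rule disjE[OF assms(1)]; rule assms(2,3)) (auto intro: hyp)

lemma Exists_intro: "\<Gamma> \<turnstile> subst (t \<triangleright> \<sigma>) \<tau> A \<Longrightarrow> \<Gamma> \<turnstile> subst \<sigma> \<tau> (Exists A)"
  by (simp add: subst.simps) (rule existsI[of _ t], simp add: inst_single subst_scons_up)

lemma Exists_elim:
  assumes "\<Gamma> \<turnstile> subst \<sigma> \<tau> (Exists A)"
    and "\<And>\<Delta> t. \<Gamma> \<sqsubseteq> \<Delta> \<Longrightarrow> \<Delta> \<turnstile> subst (t \<triangleright> \<sigma>) \<tau> A \<Longrightarrow> \<Delta> \<turnstile> D"
  shows "\<Gamma> \<turnstile> D"
  using assms(1)[unfolded subst.simps] by (rule exists_elim) (simp add: subst_scons_up assms(2))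

lemma Exists_intro': "\<Gamma> \<turnstile> subst (t \<triangleright> Var) id A \<Longrightarrow> \<Gamma> \<turnstile> Exists A"
  using Exists_intro[of \<Gamma> t Var id A] by (simp only: subst_id)

lemma ExistsM_intro: "\<Gamma> \<turnstile> subst \<sigma> (a \<triangleright> \<tau>) A \<Longrightarrow> \<Gamma> \<turnstile> subst \<sigma> \<tau> (ExistsM A)"
  by (simp add: subst.simps) (rule existsMI[of _ a], simp add: instM_def subst_scons_upM)

lemma ExistsM_elim:
  assumes "\<Gamma> \<turnstile> subst \<sigma> \<tau> (ExistsM A)"
    and "\<And>\<Delta> a. \<Gamma> \<sqsubseteq> \<Delta> \<Longrightarrow> \<Delta> \<turnstile> subst \<sigma> (a \<triangleright> \<tau>) A \<Longrightarrow> \<Delta> \<turnstile> D"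
  shows "\<Gamma> \<turnstile> D"
  using assms(1)[unfolded subst.simps] by (rule existsM_elim) (simp add: subst_scons_upM assms(2))

lemma ExistsM_intro': "\<Gamma> \<turnstile> subst Var (a \<triangleright> id) A \<Longrightarrow> \<Gamma> \<turnstile> ExistsM A"
  using ExistsM_intro[of \<Gamma> Var a id A] by (simp only: subst_id)


section \<open>Equality\<close>

lemma eq_subst_env:
  assumes eq: "\<Gamma> \<turnstile> (s \<^bold>= t)" and A: "\<Gamma> \<turnstile> subst (s \<triangleright> \<sigma>) \<tau> A"
  shows "\<Gamma> \<turnstile> subst (t \<triangleright> \<sigma>) \<tau> A"
  using eq_subst[OF eq, of "subst (up (Suc 0) \<sigma>) \<tau> A"] A by (simp add: inst_single subst_scons_up)

text \<open>The rule for equality replaces one term, so the environments are exchanged value by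
  value: \<open>mix j\<close> has the first \<open>j\<close> values replaced, and since
  \<open>A\<close> has finitely many variables, finitely many exchanges suffice. The substitution
  \<open>\<rho>\<close> isolates variable \<open>j\<close> as \<open>Var 0\<close>.\<close>

lemma eq_env:
  assumes eq: "\<And>i. \<Gamma> \<turnstile> (\<sigma> i \<^bold>= \<sigma>' i)" and A: "\<Gamma> \<turnstile> subst \<sigma> \<tau> A"
  shows "\<Gamma> \<turnstile> subst \<sigma>' \<tau> A"
proof -
  define mix where "mix j = (\<lambda>i. if i < j then \<sigma>' i else \<sigma> i)" for j :: nat
  have "\<Gamma> \<turnstile> subst (mix j) \<tau> A" for j
  proof (induction j)
    case 0
    then show ?case using A by (simp add: mix_def)
  next
    case (Suc j)
    define \<rho> :: "nat \<Rightarrow> tm" where "\<rho> i = (if i = j then Var 0 else Var (Suc i))" for i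
    have mix: "subst (t \<triangleright> mix j) \<tau> (subst \<rho> id A) = subst ((mix j)(j := t)) \<tau> A" for t
      unfolding subst_subst
      by (rule arg_cong2[of _ _ _ _ "\<lambda>\<sigma> \<tau>. subst \<sigma> \<tau> A"]) (auto simp: fun_eq_iff \<rho>_def)
    have "(mix j)(j := \<sigma> j) = mix j" "(mix j)(j := \<sigma>' j) = mix (Suc j)"
      by (auto simp: mix_def fun_eq_iff)
    with eq_subst_env[OF eq, of j "mix j" \<tau> "subst \<rho> id A"] Suc show ?case by (simp add: mix)
  qed
  moreover obtain n where "vars_below n n A" using ex_vars_below by blast
  then have "subst (mix n) \<tau> A = subst \<sigma>' \<tau> A" by (rule vars_below_subst) (simp_all add: mix_def)
  ultimately show ?thesis by metis
qed

lemma eq_sym: "\<Gamma> \<turnstile> (s \<^bold>= t) \<Longrightarrow> \<Gamma> \<turnstile> (t \<^bold>= s)"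
  using eq_subst_env[of \<Gamma> s t "s \<triangleright> Var" id "Var 0 \<^bold>= Var 1"] by (simp add: eq_refl)

lemma eq_trans: "\<Gamma> \<turnstile> (r \<^bold>= s) \<Longrightarrow> \<Gamma> \<turnstile> (s \<^bold>= t) \<Longrightarrow> \<Gamma> \<turnstile> (r \<^bold>= t)"
  using eq_subst_env[of \<Gamma> s t "r \<triangleright> Var" id "Var 1 \<^bold>= Var 0"] by simp

text \<open>Congruence comes from \<open>eq_env\<close> for an equation between two copies of
  \<open>t\<close> whose variables are separated by parity: the even ones keep reading
  \<open>\<sigma>\<close>, while the odd ones pass from \<open>\<sigma>\<close> to
  \<open>\<sigma>'\<close>, starting from reflexivity.\<close>

lemma eq_env_tm:
  assumes eq: "\<And>i. \<Gamma> \<turnstile> (\<sigma> i \<^bold>= \<sigma>' i)"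
  shows "\<Gamma> \<turnstile> (subst_tm \<sigma> \<tau> t \<^bold>= subst_tm \<sigma>' \<tau> t)"
proof -
  define A where "A = (subst_tm (\<lambda>i. Var (2 * i)) id t \<^bold>= subst_tm (\<lambda>i. Var (2 * i + 1)) id t)"
  define \<rho> where "\<rho> \<rho>' i = (if even i then \<sigma> (i div 2) else \<rho>' (i div 2))" for \<rho>' and i :: nat
  have [simp]: "\<rho> \<rho>' (2 * i) = \<sigma> i" "\<rho> \<rho>' (Suc (2 * i)) = \<rho>' i" for \<rho>' i by (auto simp: \<rho>_def)
  have "\<Gamma> \<turnstile> subst (\<rho> \<sigma>') \<tau> A"
    by (rule eq_env[of _ "\<rho> \<sigma>"]) (auto simp: A_def subst_tm_subst_tm eq_refl \<rho>_def eq)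
  then show ?thesis by (simp add: A_def subst_tm_subst_tm)
qed

lemma eq_add: "\<Gamma> \<turnstile> (s \<^bold>= s') \<Longrightarrow> \<Gamma> \<turnstile> (t \<^bold>= t') \<Longrightarrow> \<Gamma> \<turnstile> (s \<^bold>+ t \<^bold>= s' \<^bold>+ t')"
  using eq_env_tm[of \<Gamma> "s \<triangleright> t \<triangleright> Var" "s' \<triangleright> t' \<triangleright> Var" id "Var 0 \<^bold>+ Var 1"]
  by (simp add: eq_refl split: nat.split)

lemma eq_sub: "\<Gamma> \<turnstile> (s \<^bold>= s') \<Longrightarrow> \<Gamma> \<turnstile> (t \<^bold>= t') \<Longrightarrow> \<Gamma> \<turnstile> (s \<^bold>- t \<^bold>= s' \<^bold>- t')"
  using eq_env_tm[of \<Gamma> "s \<triangleright> t \<triangleright> Var" "s' \<triangleright> t' \<triangleright> Var" id "Var 0 \<^bold>- Var 1"]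
  by (simp add: eq_refl split: nat.split)

lemma eq_mul: "\<Gamma> \<turnstile> (s \<^bold>= s') \<Longrightarrow> \<Gamma> \<turnstile> (t \<^bold>= t') \<Longrightarrow> \<Gamma> \<turnstile> (s \<^bold>* t \<^bold>= s' \<^bold>* t')"
  using eq_env_tm[of \<Gamma> "s \<triangleright> t \<triangleright> Var" "s' \<triangleright> t' \<triangleright> Var" id "Var 0 \<^bold>* Var 1"]
  by (simp add: eq_refl split: nat.split)

lemma eq_Entry: "\<Gamma> \<turnstile> (s \<^bold>= s') \<Longrightarrow> \<Gamma> \<turnstile> (t \<^bold>= t') \<Longrightarrow> \<Gamma> \<turnstile> (Entry a s t \<^bold>= Entry a s' t')"
  using eq_env_tm[of \<Gamma> "s \<triangleright> t \<triangleright> Var" "s' \<triangleright> t' \<triangleright> Var" id "Entry a (Var 0) (Var 1)"]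
  by (simp add: eq_refl split: nat.split)

lemma eq_Pow2: "\<Gamma> \<turnstile> (s \<^bold>= s') \<Longrightarrow> \<Gamma> \<turnstile> (Pow2 s \<^bold>= Pow2 s')"
  using eq_env_tm[of \<Gamma> "s \<triangleright> Var" "s' \<triangleright> Var" id "Pow2 (Var 0)"]
  by (simp add: eq_refl split: nat.split)

lemma eq_PVar: "\<Gamma> \<turnstile> (s \<^bold>= t) \<Longrightarrow> \<Gamma> \<turnstile> PVar F [s] \<Longrightarrow> \<Gamma> \<turnstile> PVar F [t]"
  using eq_subst_env[of \<Gamma> s t Var id "PVar F [Var 0]"] by simp

lemma eq_le: "\<Gamma> \<turnstile> (s \<^bold>= s') \<Longrightarrow> \<Gamma> \<turnstile> (t \<^bold>= t') \<Longrightarrow> \<Gamma> \<turnstile> (s \<^bold>\<le> t) \<Longrightarrow> \<Gamma> \<turnstile> (s' \<^bold>\<le> t')"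
  using eq_env[of \<Gamma> "s \<triangleright> t \<triangleright> Var" "s' \<triangleright> t' \<triangleright> Var" id "Var 0 \<^bold>\<le> Var 1"]
  by (simp add: eq_refl split: nat.split)


section \<open>Arithmetic of the reals\<close>

text \<open>Terms up to provable equality form a commutative ring, so that ring identities between terms
  can be left to the simplifier.\<close>

definition eq_tm :: "tm \<Rightarrow> tm \<Rightarrow> bool"
  where "eq_tm s t \<longleftrightarrow> ([] \<turnstile> (s \<^bold>= t))"

quotient_type rt = tm / eq_tm
  by (auto intro!: equivpI reflpI sympI transpI simp: eq_tm_def intro: eq_refl eq_sym eq_trans)

text \<open>The class \<open>comm_ring_1\<close> would demand 0 \<noteq> 1 in the quotient, which
  amounts to consistency of the calculus. The two weaker classes make no such demand and still
  support normalisation with \<open>algebra_simps\<close>.\<close>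

instantiation rt :: "{comm_ring, comm_monoid_mult}"
begin
lift_definition zero_rt :: rt is Zero .
lift_definition one_rt :: rt is One .
lift_definition plus_rt :: "rt \<Rightarrow> rt \<Rightarrow> rt" is Add by (simp add: eq_tm_def eq_add)
lift_definition minus_rt :: "rt \<Rightarrow> rt \<Rightarrow> rt" is Sub by (simp add: eq_tm_def eq_sub)
lift_definition times_rt :: "rt \<Rightarrow> rt \<Rightarrow> rt" is Mul by (simp add: eq_tm_def eq_mul)
definition uminus_rt :: "rt \<Rightarrow> rt" where "uminus_rt x = 0 - x"
instance
proof
  have sub_add: "x - y + y = x" for x y :: rt
    by transfer (auto simp: eq_tm_def intro: ax axiom.intros)
  show assoc: "x + y + z = x + (y + z)" for x y z :: rt
    by transfer (auto simp: eq_tm_def intro: ax axiom.intros)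
  show comm: "x + y = y + x" for x y :: rt
    by transfer (auto simp: eq_tm_def intro: ax axiom.intros)
  have zero: "x + 0 = x" for x :: rt
    by transfer (auto simp: eq_tm_def intro: ax axiom.intros)
  then show "0 + x = x" for x :: rt
    by (metis comm)
  show neg: "- x + x = 0" for x :: rt
    by (simp add: uminus_rt_def sub_add)
  show "x - y = x + - y" for x y :: rt
    by (metis assoc comm neg sub_add zero)
  show "x * y * z = x * (y * z)" for x y z :: rt
    by transfer (auto simp: eq_tm_def intro: ax axiom.intros)
  show mcomm: "x * y = y * x" for x y :: rt
    by transfer (auto simp: eq_tm_def intro: ax axiom.intros)
  have "x * 1 = x" for x :: rt
    by transfer (auto simp: eq_tm_def intro: ax axiom.intros)
  then show "1 * x = x" for x :: rt
    by (metis mcomm)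
  have "x * (y + z) = x * y + x * z" for x y z :: rt
    by transfer (auto simp: eq_tm_def intro: ax axiom.intros)
  then show "(x + y) * z = x * z + y * z" for x y z :: rt
    by (simp add: mcomm)
qed
end

abbreviation rt :: "tm \<Rightarrow> rt"  where "rt \<equiv> abs_rt"

lemma rt_simps [simp]:
  "rt Zero = 0" "rt One = 1" "rt (s \<^bold>+ t) = rt s + rt t" "rt (s \<^bold>- t) = rt s - rt t"
  "rt (s \<^bold>* t) = rt s * rt t"
  by (simp_all add: zero_rt_def one_rt_def plus_rt.abs_eq minus_rt.abs_eq times_rt.abs_eq)

lemma ring_eq: "rt s = rt t \<Longrightarrow> \<Gamma> \<turnstile> (s \<^bold>= t)"
  by (rule weaken[of "[]"]) (simp_all add: rt.abs_eq_iff eq_tm_def)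

lemma ex_rt: "\<exists>s. rt s = x"
  by (rule exI[of _ "rep_rt x"]) (rule Quotient3_abs_rep[OF Quotient3_rt])

text \<open>Certificates: the goal is a combination of the hypotheses, with coefficients \<open>k\<close>, \<open>k'\<close>, \<open>k''\<close> in the
  case of equations, and the witnessing ring identity is left to the simplifier.\<close>

lemma eq_cert1:
  assumes "\<Gamma> \<turnstile> (a \<^bold>= b)" and "rt t - rt s = k * (rt b - rt a)"
  shows "\<Gamma> \<turnstile> (s \<^bold>= t)"
proof -
  obtain c where c: "rt c = k" using ex_rt by blast
  have "\<Gamma> \<turnstile> (s \<^bold>+ c \<^bold>* (b \<^bold>- a) \<^bold>= s \<^bold>+ c \<^bold>* (b \<^bold>- b))"
    using assms(1) by (intro eq_add eq_mul eq_sub) (auto intro: eq_refl)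
  moreover have "\<Gamma> \<turnstile> (t \<^bold>= s \<^bold>+ c \<^bold>* (b \<^bold>- a))"
    using assms(2) by (intro ring_eq) (simp add: c algebra_simps)
  moreover have "\<Gamma> \<turnstile> (s \<^bold>+ c \<^bold>* (b \<^bold>- b) \<^bold>= s)"
    by (intro ring_eq) (simp add: c)
  ultimately show ?thesis by (blast intro: eq_sym eq_trans)
qed

lemma eq_cert2:
  assumes "\<Gamma> \<turnstile> (a \<^bold>= b)" "\<Gamma> \<turnstile> (a' \<^bold>= b')"
    and "rt t - rt s = k * (rt b - rt a) + k' * (rt b' - rt a')"
  shows "\<Gamma> \<turnstile> (s \<^bold>= t)"
proof -
  obtain c where c: "rt c = k" using ex_rt by blast
  have "\<Gamma> \<turnstile> (s \<^bold>= s \<^bold>+ c \<^bold>* (b \<^bold>- a))"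
    by (rule eq_cert1[OF assms(1)]) (simp add: c)
  moreover have "\<Gamma> \<turnstile> (s \<^bold>+ c \<^bold>* (b \<^bold>- a) \<^bold>= t)"
    using assms(3) by (intro eq_cert1[OF assms(2), of _ _ k']) (simp add: c algebra_simps)
  ultimately show ?thesis by (rule eq_trans)
qed

lemma eq_cert3:
  assumes "\<Gamma> \<turnstile> (a \<^bold>= b)" "\<Gamma> \<turnstile> (a' \<^bold>= b')" "\<Gamma> \<turnstile> (a'' \<^bold>= b'')"
    and "rt t - rt s = k * (rt b - rt a) + k' * (rt b' - rt a') + k'' * (rt b'' - rt a'')"
  shows "\<Gamma> \<turnstile> (s \<^bold>= t)"
proof -
  obtain c where c: "rt c = k" using ex_rt by blast
  have "\<Gamma> \<turnstile> (s \<^bold>= s \<^bold>+ c \<^bold>* (b \<^bold>- a))"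
    by (rule eq_cert1[OF assms(1)]) (simp add: c)
  moreover have "\<Gamma> \<turnstile> (s \<^bold>+ c \<^bold>* (b \<^bold>- a) \<^bold>= t)"
    using assms(4) by (intro eq_cert2[OF assms(2,3), of _ _ k' k'']) (simp add: c algebra_simps)
  ultimately show ?thesis by (rule eq_trans)
qed

section \<open>Order\<close>

lemma eq_imp_le: "\<Gamma> \<turnstile> (s \<^bold>= t) \<Longrightarrow> \<Gamma> \<turnstile> (s \<^bold>\<le> t)"
  using eq_le[of \<Gamma> s s s t] by (simp add: eq_refl ax le_refl)

lemma le_antisymD: "\<Gamma> \<turnstile> (s \<^bold>\<le> t) \<Longrightarrow> \<Gamma> \<turnstile> (t \<^bold>\<le> s) \<Longrightarrow> \<Gamma> \<turnstile> (s \<^bold>= t)"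
  by (blast intro: impE ax le_antisym)

lemma le_transD: "\<Gamma> \<turnstile> (r \<^bold>\<le> s) \<Longrightarrow> \<Gamma> \<turnstile> (s \<^bold>\<le> t) \<Longrightarrow> \<Gamma> \<turnstile> (r \<^bold>\<le> t)"
  by (blast intro: impE ax le_trans)

lemma le_cert1:
  assumes "\<Gamma> \<turnstile> (a \<^bold>\<le> b)" and "rt t - rt s = rt b - rt a"
  shows "\<Gamma> \<turnstile> (s \<^bold>\<le> t)"
proof -
  have "\<Gamma> \<turnstile> (a \<^bold>+ (s \<^bold>- a) \<^bold>\<le> b \<^bold>+ (s \<^bold>- a))"
    using assms(1) by (blast intro: impE ax le_add)
  moreover have "\<Gamma> \<turnstile> (a \<^bold>+ (s \<^bold>- a) \<^bold>= s)" by (intro ring_eq) simp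
  moreover have "\<Gamma> \<turnstile> (b \<^bold>+ (s \<^bold>- a) \<^bold>= t)"
    using assms(2) by (intro ring_eq) (simp add: algebra_simps)
  ultimately show ?thesis by (blast intro: eq_le)
qed

lemma le_cert2:
  assumes "\<Gamma> \<turnstile> (a \<^bold>\<le> b)" "\<Gamma> \<turnstile> (a' \<^bold>\<le> b')" and "rt t - rt s = (rt b - rt a) + (rt b' - rt a')"
  shows "\<Gamma> \<turnstile> (s \<^bold>\<le> t)"
proof -
  have "\<Gamma> \<turnstile> (s \<^bold>\<le> s \<^bold>+ (b \<^bold>- a))" by (rule le_cert1[OF assms(1)]) simp
  moreover have "\<Gamma> \<turnstile> (s \<^bold>+ (b \<^bold>- a) \<^bold>\<le> t)"
    using assms(3) by (intro le_cert1[OF assms(2)]) (simp add: algebra_simps)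
  ultimately show ?thesis by (rule le_transD)
qed

lemma le_cert3:
  assumes "\<Gamma> \<turnstile> (a \<^bold>\<le> b)" "\<Gamma> \<turnstile> (a' \<^bold>\<le> b')" "\<Gamma> \<turnstile> (a'' \<^bold>\<le> b'')"
    and "rt t - rt s = (rt b - rt a) + (rt b' - rt a') + (rt b'' - rt a'')"
  shows "\<Gamma> \<turnstile> (s \<^bold>\<le> t)"
proof -
  have "\<Gamma> \<turnstile> (s \<^bold>\<le> s \<^bold>+ (b \<^bold>- a))" by (rule le_cert1[OF assms(1)]) simp
  moreover have "\<Gamma> \<turnstile> (s \<^bold>+ (b \<^bold>- a) \<^bold>\<le> t)"
    using assms(4) by (intro le_cert2[OF assms(2,3)]) (simp add: algebra_simps)
  ultimately show ?thesis by (rule le_transD)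
qed

text \<open>Since the order is stable by \<open>le_stable\<close>, the double negation of excluded
  middle for \<open>A\<close> is enough when the goal is an inequality. This is the only access to
  classical reasoning, and it extends to equations by antisymmetry.\<close>

lemma le_classical:
  assumes "\<And>\<Delta>. \<Gamma> \<sqsubseteq> \<Delta> \<Longrightarrow> \<Delta> \<turnstile> A \<Longrightarrow> \<Delta> \<turnstile> (s \<^bold>\<le> t)"
    and "\<And>\<Delta>. \<Gamma> \<sqsubseteq> \<Delta> \<Longrightarrow> \<Delta> \<turnstile> (\<^bold>\<not> A) \<Longrightarrow> \<Delta> \<turnstile> (s \<^bold>\<le> t)"
  shows "\<Gamma> \<turnstile> (s \<^bold>\<le> t)"
proof -
  have "\<Delta> \<turnstile> \<^bold>\<bottom>" if \<Delta>: "\<Gamma> \<sqsubseteq> \<Delta>" "\<Delta> \<turnstile> (\<^bold>\<not> s \<^bold>\<le> t)" for \<Delta>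
  proof -
    have "\<Delta> \<turnstile> (\<^bold>\<not> A)"
      unfolding derivable_Imp using \<Delta> assms(1) by (meson impE subset_trans weaken)
    with \<Delta> assms(2) show ?thesis by (blast intro: impE)
  qed
  then have "\<Gamma> \<turnstile> (\<^bold>\<not> \<^bold>\<not> s \<^bold>\<le> t)" unfolding derivable_Imp[of \<Gamma>] by blast
  then show ?thesis by (blast intro: impE ax le_stable)
qed

lemma eq_classical:
  assumes "\<And>\<Delta>. \<Gamma> \<sqsubseteq> \<Delta> \<Longrightarrow> \<Delta> \<turnstile> A \<Longrightarrow> \<Delta> \<turnstile> (s \<^bold>= t)"
    and "\<And>\<Delta>. \<Gamma> \<sqsubseteq> \<Delta> \<Longrightarrow> \<Delta> \<turnstile> (\<^bold>\<not> A) \<Longrightarrow> \<Delta> \<turnstile> (s \<^bold>= t)"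
  shows "\<Gamma> \<turnstile> (s \<^bold>= t)"
  by (rule le_antisymD; rule le_classical[of _ A]) (blast intro: assms eq_imp_le eq_sym)+

lemma le_cases:
  assumes "\<And>\<Delta>. \<Gamma> \<sqsubseteq> \<Delta> \<Longrightarrow> \<Delta> \<turnstile> (a \<^bold>\<le> b) \<Longrightarrow> \<Delta> \<turnstile> (s \<^bold>\<le> t)"
    and "\<And>\<Delta>. \<Gamma> \<sqsubseteq> \<Delta> \<Longrightarrow> \<Delta> \<turnstile> (b \<^bold>\<le> a) \<Longrightarrow> \<Delta> \<turnstile> (s \<^bold>\<le> t)"
  shows "\<Gamma> \<turnstile> (s \<^bold>\<le> t)"
  by (rule le_classical[of _ "a \<^bold>\<le> b"]) (blast intro: assms impE ax le_total)+

lemma mul_nonneg: "\<Gamma> \<turnstile> (Zero \<^bold>\<le> s) \<Longrightarrow> \<Gamma> \<turnstile> (Zero \<^bold>\<le> t) \<Longrightarrow> \<Gamma> \<turnstile> (Zero \<^bold>\<le> s \<^bold>* t)"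
  by (blast intro: impE ax le_mul)

lemma square_nonneg: "\<Gamma> \<turnstile> (Zero \<^bold>\<le> t \<^bold>* t)"
proof (rule le_cases[of _ Zero t])
  fix \<Delta> assume "\<Delta> \<turnstile> (t \<^bold>\<le> Zero)"
  then have "\<Delta> \<turnstile> (Zero \<^bold>\<le> Zero \<^bold>- t)" by (rule le_cert1) simp
  then have "\<Delta> \<turnstile> (Zero \<^bold>\<le> (Zero \<^bold>- t) \<^bold>* (Zero \<^bold>- t))" by (simp add: mul_nonneg)
  then show "\<Delta> \<turnstile> (Zero \<^bold>\<le> t \<^bold>* t)" by (rule le_cert1) (simp add: algebra_simps)
qed (simp add: mul_nonneg)

lemma zero_le_one: "\<Gamma> \<turnstile> (Zero \<^bold>\<le> One)"
  by (rule le_cert1[OF square_nonneg[of _ One]]) simp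

text \<open>The uniform exit from impossible index situations: with 0 \<le> 1, the hypothesis gives
  0 = 1, and \<open>A\<close> is arbitrary.\<close>

lemma one_le_zero: "\<Gamma> \<turnstile> (One \<^bold>\<le> Zero) \<Longrightarrow> \<Gamma> \<turnstile> A"
  by (rule botE) (blast intro: impE ax zero_neq_one le_antisymD zero_le_one)

text \<open>Halving without division: if t \<le> s, then adding this to s + s \<le> t + t leaves s
  \<le> t. The case distinction is legitimate because the goal is an inequality.\<close>

lemma le_double: "\<Gamma> \<turnstile> (s \<^bold>+ s \<^bold>\<le> t \<^bold>+ t) \<Longrightarrow> \<Gamma> \<turnstile> (s \<^bold>\<le> t)"
proof (rule le_cases[of _ s t])
  fix \<Delta> assume "\<Gamma> \<turnstile> (s \<^bold>+ s \<^bold>\<le> t \<^bold>+ t)" "\<Gamma> \<sqsubseteq> \<Delta>" "\<Delta> \<turnstile> (t \<^bold>\<le> s)"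
  then have "\<Delta> \<turnstile> (s \<^bold>+ s \<^bold>\<le> t \<^bold>+ t)" "\<Delta> \<turnstile> (t \<^bold>\<le> s)" by (auto intro: weaken)
  then show "\<Delta> \<turnstile> (s \<^bold>\<le> t)" by (rule le_cert2) (simp add: algebra_simps)
qed

lemma divide_mul: "\<Gamma> \<turnstile> (\<^bold>\<not> t \<^bold>= Zero) \<Longrightarrow> \<Gamma> \<turnstile> ((s \<^bold>/ t) \<^bold>* t \<^bold>= s)"
  by (blast intro: impE ax div_mul)


section \<open>Natural numbers\<close>

lemma subst_N [simp]: "subst \<sigma> \<tau> (N t) = N (subst_tm \<sigma> \<tau> t)"
  by (simp add: N_def subst.simps up_def lift_tm_def)

text \<open>The converse of \<open>forallI\<close>. It brings a quantified premise, which can be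
  proved term by term, into the open form that the rule \<open>induction\<close> expects.\<close>

lemma Forall_open: "\<Gamma> \<turnstile> Forall A \<Longrightarrow> map (lift 0 1) \<Gamma> \<turnstile> A"
proof -
  assume "\<Gamma> \<turnstile> Forall A"
  then have "map (lift 0 1) \<Gamma> \<turnstile> lift 0 1 (Forall A)"
    unfolding lift_0_1[abs_def] by (rule derivable_subst)
  then have "map (lift 0 1) \<Gamma> \<turnstile> subst (Var 0 \<triangleright> (\<lambda>i. Var (Suc i))) id A"
    unfolding lift_0_1 by (simp add: forces)
  then show ?thesis by (simp only: scons_Var subst_id)
qed

text \<open>The rules for fixed points are stated through \<open>psubst\<close>; this computes the
  result for arbitrary \<open>P\<close>. Under the existential, \<open>Var 0\<close> is the
  predecessor and \<open>Var 1\<close> the argument, so the parameters of \<open>P\<close> move past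
  two variables.\<close>

lemma op_app_N:
  "op_app 1 (Var 0 \<^bold>= Zero \<^bold>\<or> Exists (PVar 0 [Var 0] \<^bold>\<and> Var 1 \<^bold>= Var 0 \<^bold>+ One)) P =
    (Var 0 \<^bold>= Zero \<^bold>\<or> Exists (subst (Var 0 \<triangleright> (\<lambda>i. Var (Suc (Suc i)))) id P \<^bold>\<and> Var 1 \<^bold>= Var 0 \<^bold>+ One))"
  by (auto simp: op_app_def inst_def lift_def subst_subst fun_eq_iff
      intro!: arg_cong2[of _ _ _ _ "\<lambda>\<sigma> \<tau>. subst \<sigma> \<tau> P"] split: nat.split)

lemma Mu_pred_N:
  "Mu_pred 1 (Var 0 \<^bold>= Zero \<^bold>\<or> Exists (PVar 0 [Var 0] \<^bold>\<and> Var 1 \<^bold>= Var 0 \<^bold>+ One)) = N (Var 0)"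
  by (simp add: Mu_pred_def N_def lift_def subst.simps up_def subst_tm_lift_tm) (simp add: lift_tm_def)

lemma N_zero: "\<Gamma> \<turnstile> N Zero"
  unfolding N_def
  by (rule closure) (simp_all add: op_app_N[simplified] inst_single disjI1 eq_refl)

lemma N_eq: "\<Gamma> \<turnstile> (s \<^bold>= t) \<Longrightarrow> \<Gamma> \<turnstile> N s \<Longrightarrow> \<Gamma> \<turnstile> N t"
  using eq_subst_env[of \<Gamma> s t Var id "N (Var 0)"] by simp

lemma N_succ: "\<Gamma> \<turnstile> N t \<Longrightarrow> \<Gamma> \<turnstile> N (t \<^bold>+ One)"
  apply (subst N_def)
  apply (rule closure)
    apply simp
   apply simp
  apply (simp only: op_app_N Mu_pred_N inst_single)
  apply (simp only: subst.simps(8))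
  apply (rule disjI2)
  apply (rule Exists_intro[of _ t])
  apply (simp add: forces eq_refl)
  done

text \<open>The rule \<open>induction\<close> is applied to the conjunction of \<open>N\<close> with
  the intended predicate, which supplies \<open>N x\<close> in the step. The environment is compiled
  into the formula \<open>P'\<close>, because the rule knows predicates only as formulas with a
  distinguished \<open>Var 0\<close>.\<close>

lemma N_induct:
  assumes t: "\<Gamma> \<turnstile> N t"
    and zero: "\<Gamma> \<turnstile> subst (Zero \<triangleright> \<sigma>) \<tau> P"
    and succ: "\<And>\<Delta> x. \<Gamma> \<sqsubseteq> \<Delta> \<Longrightarrow> \<Delta> \<turnstile> N x \<Longrightarrow> \<Delta> \<turnstile> subst (x \<triangleright> \<sigma>) \<tau> P \<Longrightarrow> \<Delta> \<turnstile> subst (x \<^bold>+ One \<triangleright> \<sigma>) \<tau> P"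
  shows "\<Gamma> \<turnstile> subst (t \<triangleright> \<sigma>) \<tau> P"
proof -
  define P' where "P' = (N (Var 0) \<^bold>\<and> subst (Var 0 \<triangleright> (\<lambda>i. lift_tm 1 (\<sigma> i))) \<tau> P)"
  have P': "subst (x \<triangleright> \<sigma>') id P' = (N x \<^bold>\<and> subst (x \<triangleright> (\<lambda>i. subst_tm \<sigma>' id (\<sigma> i))) \<tau> P)" for x \<sigma>'
    by (simp add: P'_def subst_subst subst_tm_lift_tm del: One_nat_def) (simp add: id_def)
  have id: "(\<lambda>i. subst_tm Var id (\<sigma> i)) = \<sigma>" by (simp add: subst_tm_id)
  let ?A = "Var 0 \<^bold>= Zero \<^bold>\<or> Exists (PVar 0 [Var 0] \<^bold>\<and> Var 1 \<^bold>= Var 0 \<^bold>+ One)"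
  have "\<Gamma> \<turnstile> Forall (op_app 1 ?A P' \<^bold>\<rightarrow> P')"
  proof (rule forall_intro, unfold subst.simps(9) derivable_Imp, intro allI HOL.impI)
    fix x and \<Delta> :: "fm list" assume \<Delta>: "\<Gamma> \<sqsubseteq> \<Delta>" and hyp: "\<Delta> \<turnstile> subst (x \<triangleright> Var) id (op_app 1 ?A P')"
    from hyp show "\<Delta> \<turnstile> subst (x \<triangleright> Var) id P'"
      unfolding op_app_N subst.simps(8)
    proof (rule Disj_elim)
      fix \<Delta>' :: "fm list" assume \<Delta>': "\<Delta> \<sqsubseteq> \<Delta>'" and "\<Delta>' \<turnstile> subst (x \<triangleright> Var) id (Var 0 \<^bold>= Zero)"
      then have eq: "\<Delta>' \<turnstile> (Zero \<^bold>= x)" by (simp add: eq_sym)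
      have "\<Delta>' \<turnstile> subst (Zero \<triangleright> Var) id P'"
        using weaken[OF zero] \<Delta> \<Delta>' by (auto simp: P' id forces N_zero)
      then show "\<Delta>' \<turnstile> subst (x \<triangleright> Var) id P'" by (rule eq_subst_env[OF eq])
    next
      fix \<Delta>' :: "fm list" assume \<Delta>': "\<Delta> \<sqsubseteq> \<Delta>'" and ex:
        "\<Delta>' \<turnstile> subst (x \<triangleright> Var) id
          (Exists (subst (Var 0 \<triangleright> (\<lambda>i. Var (Suc (Suc i)))) id P' \<^bold>\<and> Var 1 \<^bold>= Var 0 \<^bold>+ One))"
      from ex show "\<Delta>' \<turnstile> subst (x \<triangleright> Var) id P'"
      proof (rule Exists_elim)
        fix \<Theta> :: "fm list" and y assume \<Theta>: "\<Delta>' \<sqsubseteq> \<Theta>" and "\<Theta> \<turnstile> subst (y \<triangleright> x \<triangleright> Var) id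
          (subst (Var 0 \<triangleright> (\<lambda>i. Var (Suc (Suc i)))) id P' \<^bold>\<and> Var 1 \<^bold>= Var 0 \<^bold>+ One)"
        then have y: "\<Theta> \<turnstile> N y" "\<Theta> \<turnstile> subst (y \<triangleright> \<sigma>) \<tau> P" and eq: "\<Theta> \<turnstile> (y \<^bold>+ One \<^bold>= x)"
          by (simp_all add: forces subst_subst subst_tm_subst_tm P' id eq_sym)
        have "\<Theta> \<turnstile> subst (y \<^bold>+ One \<triangleright> Var) id P'"
          using y \<Delta> \<Delta>' \<Theta> by (auto simp: P' id forces N_succ intro!: succ)
        then show "\<Theta> \<turnstile> subst (x \<triangleright> Var) id P'" by (rule eq_subst_env[OF eq])
      qed
    qed
  qed
  then have "\<Gamma> \<turnstile> inst [t] P'"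
    using t unfolding N_def by (intro induction[of 1 ?A]) (simp_all add: Forall_open[simplified])
  then show ?thesis by (simp add: inst_single P' id forces)
qed

declare id_def [simp]

lemma N_cases:
  assumes t: "\<Gamma> \<turnstile> N t"
    and zero: "\<And>\<Delta>. \<Gamma> \<sqsubseteq> \<Delta> \<Longrightarrow> \<Delta> \<turnstile> (t \<^bold>= Zero) \<Longrightarrow> \<Delta> \<turnstile> D"
    and succ: "\<And>\<Delta> y. \<Gamma> \<sqsubseteq> \<Delta> \<Longrightarrow> \<Delta> \<turnstile> N y \<Longrightarrow> \<Delta> \<turnstile> (t \<^bold>= y \<^bold>+ One) \<Longrightarrow> \<Delta> \<turnstile> D"
  shows "\<Gamma> \<turnstile> D"
proof -
  let ?P = "Exists (N (Var 0) \<^bold>\<and> Var 1 \<^bold>= Var 0 \<^bold>+ One)"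
  have "\<Gamma> \<turnstile> subst (t \<triangleright> Var) id (Var 0 \<^bold>= Zero \<^bold>\<or> ?P)"
    using t
  proof (rule N_induct)
    fix \<Delta> x assume "\<Delta> \<turnstile> N x"
    then have "\<Delta> \<turnstile> subst (x \<^bold>+ One \<triangleright> Var) id ?P"
      by (intro Exists_intro[of _ x]) (simp add: forces eq_refl)
    then show "\<Delta> \<turnstile> subst (x \<^bold>+ One \<triangleright> Var) id (Var 0 \<^bold>= Zero \<^bold>\<or> ?P)" by (simp add: disjI2)
  qed (simp add: disjI1 eq_refl)
  then show ?thesis
    unfolding subst.simps(8)
  proof (rule Disj_elim)
    fix \<Delta> :: "fm list"
    assume \<Delta>: "\<Gamma> \<sqsubseteq> \<Delta>" and "\<Delta> \<turnstile> subst (t \<triangleright> Var) id ?P"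
    from this(2) show "\<Delta> \<turnstile> D"
      by (rule Exists_elim) (use \<Delta> in \<open>auto simp: forces intro: succ\<close>)
  qed (simp add: zero)
qed

lemma N_nonneg: "\<Gamma> \<turnstile> N t \<Longrightarrow> \<Gamma> \<turnstile> (Zero \<^bold>\<le> t)"
proof -
  assume "\<Gamma> \<turnstile> N t"
  then have "\<Gamma> \<turnstile> subst (t \<triangleright> Var) id (Zero \<^bold>\<le> Var 0)"
  proof (rule N_induct)
    fix \<Delta> x assume "\<Delta> \<turnstile> subst (x \<triangleright> Var) id (Zero \<^bold>\<le> Var 0)"
    then have "\<Delta> \<turnstile> (Zero \<^bold>\<le> x)" by simp
    from le_cert2[OF this zero_le_one, of "x \<^bold>+ One" Zero]
    show "\<Delta> \<turnstile> subst (x \<^bold>+ One \<triangleright> Var) id (Zero \<^bold>\<le> Var 0)" by simp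
  qed (simp add: eq_imp_le eq_refl)
  then show ?thesis by simp
qed

lemma N_add:
  assumes "\<Gamma> \<turnstile> N s" and t: "\<Gamma> \<turnstile> N t"
  shows "\<Gamma> \<turnstile> N (s \<^bold>+ t)"
proof -
  have "\<Gamma> \<turnstile> subst (t \<triangleright> s \<triangleright> Var) id (N (Var 1 \<^bold>+ Var 0))"
    using t
  proof (rule N_induct)
    show "\<Gamma> \<turnstile> subst (Zero \<triangleright> s \<triangleright> Var) id (N (Var 1 \<^bold>+ Var 0))"
      using N_eq[OF ring_eq assms(1), of "s \<^bold>+ Zero"] by simp
  next
    fix \<Delta> x assume "\<Delta> \<turnstile> subst (x \<triangleright> s \<triangleright> Var) id (N (Var 1 \<^bold>+ Var 0))"
    then show "\<Delta> \<turnstile> subst (x \<^bold>+ One \<triangleright> s \<triangleright> Var) id (N (Var 1 \<^bold>+ Var 0))"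
      using N_eq[OF ring_eq N_succ, of "s \<^bold>+ x" "s \<^bold>+ (x \<^bold>+ One)" \<Delta>] by (simp add: add.assoc)
  qed
  then show ?thesis by simp
qed

text \<open>The axioms give totality of the order only in negated form, so a genuine disjunction has
  to be earned by induction on \<open>a\<close>, with \<open>b\<close> quantified. The strict
  alternative is expressed as b + 1 \<le> a, since the language has no strict order. All decisions
  about indices rest on this.\<close>

lemma N_le_or_gt:
  assumes a: "\<Gamma> \<turnstile> N a" and b: "\<Gamma> \<turnstile> N b"
  shows "\<Gamma> \<turnstile> (a \<^bold>\<le> b \<^bold>\<or> b \<^bold>+ One \<^bold>\<le> a)"
proof -
  let ?P = "Forall (N (Var 0) \<^bold>\<rightarrow> Var 1 \<^bold>\<le> Var 0 \<^bold>\<or> Var 0 \<^bold>+ One \<^bold>\<le> Var 1)"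
  have "\<Gamma> \<turnstile> subst (a \<triangleright> Var) id ?P"
    using a
  proof (rule N_induct)
    show "\<Gamma> \<turnstile> subst (Zero \<triangleright> Var) id ?P"
      by (simp add: forces N_nonneg disjI1)
  next
    fix \<Delta> :: "fm list" and x assume "\<Delta> \<turnstile> subst (x \<triangleright> Var) id ?P"
    then have IH: "\<Theta> \<turnstile> (x \<^bold>\<le> y \<^bold>\<or> y \<^bold>+ One \<^bold>\<le> x)" if "\<Delta> \<sqsubseteq> \<Theta>" "\<Theta> \<turnstile> N y" for \<Theta> y
      using that by (simp add: forces)
    have "\<Theta> \<turnstile> (x \<^bold>+ One \<^bold>\<le> y \<^bold>\<or> y \<^bold>+ One \<^bold>\<le> x \<^bold>+ One)"
      if \<Theta>: "\<Delta> \<sqsubseteq> \<Theta>" and y: "\<Theta> \<turnstile> N y" and x: "\<Theta> \<turnstile> (Zero \<^bold>\<le> x)" for \<Theta> y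
      using y
    proof (rule N_cases)
      fix \<Theta>' assume "\<Theta> \<sqsubseteq> \<Theta>'" "\<Theta>' \<turnstile> (y \<^bold>= Zero)"
      then have "\<Theta>' \<turnstile> (y \<^bold>+ One \<^bold>\<le> x \<^bold>+ One)"
        by (intro le_cert2[OF eq_imp_le weaken[OF x]]) auto
      then show "\<Theta>' \<turnstile> (x \<^bold>+ One \<^bold>\<le> y \<^bold>\<or> y \<^bold>+ One \<^bold>\<le> x \<^bold>+ One)" by (rule disjI2)
    next
      fix \<Theta>' z assume \<Theta>': "\<Theta> \<sqsubseteq> \<Theta>'" and z: "\<Theta>' \<turnstile> N z" "\<Theta>' \<turnstile> (y \<^bold>= z \<^bold>+ One)"
      have "\<Theta>' \<turnstile> (x \<^bold>\<le> z \<^bold>\<or> z \<^bold>+ One \<^bold>\<le> x)" using \<Theta> \<Theta>' z by (intro IH) auto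
      then show "\<Theta>' \<turnstile> (x \<^bold>+ One \<^bold>\<le> y \<^bold>\<or> y \<^bold>+ One \<^bold>\<le> x \<^bold>+ One)"
      proof (rule Disj_elim)
        fix \<Xi> assume \<Xi>: "\<Theta>' \<sqsubseteq> \<Xi>" "\<Xi> \<turnstile> (x \<^bold>\<le> z)"
        show "\<Xi> \<turnstile> (x \<^bold>+ One \<^bold>\<le> y \<^bold>\<or> y \<^bold>+ One \<^bold>\<le> x \<^bold>+ One)"
          by (rule disjI1, rule le_cert2[OF \<Xi>(2) eq_imp_le[OF weaken[OF eq_sym[OF z(2)] \<Xi>(1)]]])
            (simp add: algebra_simps)
      next
        fix \<Xi> assume \<Xi>: "\<Theta>' \<sqsubseteq> \<Xi>" "\<Xi> \<turnstile> (z \<^bold>+ One \<^bold>\<le> x)"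
        show "\<Xi> \<turnstile> (x \<^bold>+ One \<^bold>\<le> y \<^bold>\<or> y \<^bold>+ One \<^bold>\<le> x \<^bold>+ One)"
          by (rule disjI2, rule le_cert2[OF \<Xi>(2) eq_imp_le[OF weaken[OF z(2) \<Xi>(1)]]])
            (simp add: algebra_simps)
      qed
    qed
    moreover assume "\<Delta> \<turnstile> N x"
    ultimately show "\<Delta> \<turnstile> subst (x \<^bold>+ One \<triangleright> Var) id ?P"
      using N_nonneg weaken by (auto simp: forces)
  qed
  then show ?thesis using b by (simp add: forces)
qed

lemma N_le_cases:
  assumes "\<Gamma> \<turnstile> N a" "\<Gamma> \<turnstile> N b"
    and "\<And>\<Delta>. \<Gamma> \<sqsubseteq> \<Delta> \<Longrightarrow> \<Delta> \<turnstile> (a \<^bold>\<le> b) \<Longrightarrow> \<Delta> \<turnstile> D"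
    and "\<And>\<Delta>. \<Gamma> \<sqsubseteq> \<Delta> \<Longrightarrow> \<Delta> \<turnstile> (b \<^bold>+ One \<^bold>\<le> a) \<Longrightarrow> \<Delta> \<turnstile> D"
  shows "\<Gamma> \<turnstile> D"
  using N_le_or_gt[OF assms(1,2)] by (rule Disj_elim) (fact assms(3,4))+

lemma neq_of_less: "\<Gamma> \<turnstile> (a \<^bold>+ One \<^bold>\<le> b) \<Longrightarrow> \<Gamma> \<turnstile> (\<^bold>\<not> a \<^bold>= b)"
  unfolding derivable_Imp
proof (intro allI HOL.impI)
  fix \<Theta> assume "\<Gamma> \<turnstile> (a \<^bold>+ One \<^bold>\<le> b)" and \<Theta>: "\<Gamma> \<sqsubseteq> \<Theta>" "\<Theta> \<turnstile> (a \<^bold>= b)"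
  from le_cert2[OF weaken[OF this(1) \<Theta>(1)] eq_imp_le[OF eq_sym[OF \<Theta>(2)]], of Zero One]
  show "\<Theta> \<turnstile> \<^bold>\<bottom>" by (rule one_le_zero) simp
qed

lemma neq_sym: "\<Gamma> \<turnstile> (\<^bold>\<not> a \<^bold>= b) \<Longrightarrow> \<Gamma> \<turnstile> (\<^bold>\<not> b \<^bold>= a)"
  unfolding derivable_Imp by (blast intro: eq_sym)


section \<open>Markov's principle for constructive reals\<close>

lemma subst_tm_neg_pow2 [simp]: "subst_tm \<sigma> \<tau> (neg_pow2 t) = neg_pow2 (subst_tm \<sigma> \<tau> t)"
  by (simp add: neg_pow2_def)

lemma neg_pow2_zero: "\<Gamma> \<turnstile> (neg_pow2 Zero \<^bold>= One)"
  unfolding neg_pow2_def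
  by (rule eq_trans[OF eq_Pow2 ax[OF pow2_zero]]) (simp add: ring_eq)

text \<open>The axiom \<open>pow2_succ\<close> holds for every term, so it may be read at -(t + 1),
  whose successor is -t.\<close>

lemma neg_pow2_succ: "\<Gamma> \<turnstile> (neg_pow2 t \<^bold>= neg_pow2 (t \<^bold>+ One) \<^bold>+ neg_pow2 (t \<^bold>+ One))"
proof -
  have "\<Gamma> \<turnstile> (Pow2 (Zero \<^bold>- t) \<^bold>= Pow2 ((Zero \<^bold>- (t \<^bold>+ One)) \<^bold>+ One))"
    by (rule eq_Pow2) (simp add: ring_eq algebra_simps)
  then have "\<Gamma> \<turnstile> (Pow2 (Zero \<^bold>- t) \<^bold>= (One \<^bold>+ One) \<^bold>* Pow2 (Zero \<^bold>- (t \<^bold>+ One)))"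
    by (rule eq_trans) (intro ax axiom.intros)
  then show ?thesis
    unfolding neg_pow2_def by (rule eq_trans) (simp add: ring_eq algebra_simps)
qed

lemma neg_pow2_pos:
  assumes "\<Gamma> \<turnstile> N t"
  shows "\<Gamma> \<turnstile> (\<^bold>\<not> neg_pow2 t \<^bold>\<le> Zero)"
proof -
  have "\<Gamma> \<turnstile> subst (t \<triangleright> Var) id (neg_pow2 (Var 0) \<^bold>\<le> Zero \<^bold>\<rightarrow> \<^bold>\<bottom>)"
    using assms
  proof (rule N_induct)
    show "\<Gamma> \<turnstile> subst (Zero \<triangleright> Var) id (neg_pow2 (Var 0) \<^bold>\<le> Zero \<^bold>\<rightarrow> \<^bold>\<bottom>)"
      by (auto simp: forces intro: one_le_zero[OF le_transD[OF eq_imp_le[OF eq_sym[OF neg_pow2_zero]]]])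
  next
    fix \<Delta> x assume *: "\<Delta> \<turnstile> subst (x \<triangleright> Var) id (neg_pow2 (Var 0) \<^bold>\<le> Zero \<^bold>\<rightarrow> \<^bold>\<bottom>)"
    have "\<Theta> \<turnstile> \<^bold>\<bottom>" if "\<Delta> \<sqsubseteq> \<Theta>" and np: "\<Theta> \<turnstile> (neg_pow2 (x \<^bold>+ One) \<^bold>\<le> Zero)" for \<Theta>
    proof -
      have "\<Theta> \<turnstile> (neg_pow2 x \<^bold>\<le> Zero)"
        by (rule le_cert3[OF eq_imp_le[OF neg_pow2_succ[of _ x]] np np]) (simp add: algebra_simps)
      with * that(1) show ?thesis
        by (simp add: forces)
    qed
    then show "\<Delta> \<turnstile> subst (x \<^bold>+ One \<triangleright> Var) id (neg_pow2 (Var 0) \<^bold>\<le> Zero \<^bold>\<rightarrow> \<^bold>\<bottom>)"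
      by (simp add: forces)
  qed
  then show ?thesis by simp
qed

section \<open>Absolute value\<close>

lemma abs_pos: "\<Gamma> \<turnstile> (Zero \<^bold>\<le> t) \<Longrightarrow> \<Gamma> \<turnstile> (Absv t \<^bold>= t)"
  by (blast intro: impE ax abs_nonneg)

lemma abs_neg: "\<Gamma> \<turnstile> (t \<^bold>\<le> Zero) \<Longrightarrow> \<Gamma> \<turnstile> (Absv t \<^bold>= Zero \<^bold>- t)"
  by (blast intro: impE ax abs_nonpos)

lemma abs_leI:
  assumes "\<Gamma> \<turnstile> (t \<^bold>\<le> r)" "\<Gamma> \<turnstile> (Zero \<^bold>- t \<^bold>\<le> r)"
  shows "\<Gamma> \<turnstile> (Absv t \<^bold>\<le> r)"
  by (rule le_cases[of _ Zero t])
    (blast intro: le_transD eq_imp_le abs_pos abs_neg weaken assms)+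

lemma le_abs: "\<Gamma> \<turnstile> (t \<^bold>\<le> Absv t)"
proof (rule le_cases[of _ Zero t])
  fix \<Delta> assume t: "\<Delta> \<turnstile> (t \<^bold>\<le> Zero)"
  show "\<Delta> \<turnstile> (t \<^bold>\<le> Absv t)"
    by (rule le_cert3[OF t t eq_imp_le[OF eq_sym[OF abs_neg[OF t]]]]) (simp add: algebra_simps)
qed (blast intro: eq_imp_le eq_sym abs_pos)

lemma neg_le_abs: "\<Gamma> \<turnstile> (Zero \<^bold>- t \<^bold>\<le> Absv t)"
proof (rule le_cases[of _ t Zero])
  fix \<Delta> assume t: "\<Delta> \<turnstile> (Zero \<^bold>\<le> t)"
  show "\<Delta> \<turnstile> (Zero \<^bold>- t \<^bold>\<le> Absv t)"
    by (rule le_cert3[OF t t eq_imp_le[OF eq_sym[OF abs_pos[OF t]]]]) (simp add: algebra_simps)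
qed (blast intro: eq_imp_le eq_sym abs_neg)

lemma abs_double: "\<Gamma> \<turnstile> (Absv (t \<^bold>+ t) \<^bold>\<le> Absv t \<^bold>+ Absv t)"
proof (rule abs_leI)
  show "\<Gamma> \<turnstile> (t \<^bold>+ t \<^bold>\<le> Absv t \<^bold>+ Absv t)"
    by (rule le_cert2[OF le_abs[of _ t] le_abs[of _ t]]) (simp add: algebra_simps)
  show "\<Gamma> \<turnstile> (Zero \<^bold>- (t \<^bold>+ t) \<^bold>\<le> Absv t \<^bold>+ Absv t)"
    by (rule le_cert2[OF neg_le_abs[of _ t] neg_le_abs[of _ t]]) (simp add: algebra_simps)
qed

lemma double_le_abs: "\<Gamma> \<turnstile> (Absv t \<^bold>+ Absv t \<^bold>\<le> Absv (t \<^bold>+ t))"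
proof (rule le_cases[of _ Zero t])
  fix \<Delta> assume t: "\<Delta> \<turnstile> (Zero \<^bold>\<le> t)"
  note e = eq_imp_le[OF abs_pos[OF t]]
  show "\<Delta> \<turnstile> (Absv t \<^bold>+ Absv t \<^bold>\<le> Absv (t \<^bold>+ t))"
    by (rule le_cert3[OF e e le_abs[of _ "t \<^bold>+ t"]]) (simp add: algebra_simps)
next
  fix \<Delta> assume t: "\<Delta> \<turnstile> (t \<^bold>\<le> Zero)"
  note e = eq_imp_le[OF abs_neg[OF t]]
  show "\<Delta> \<turnstile> (Absv t \<^bold>+ Absv t \<^bold>\<le> Absv (t \<^bold>+ t))"
    by (rule le_cert3[OF e e neg_le_abs[of _ "t \<^bold>+ t"]]) (simp add: algebra_simps)
qed

text \<open>The relation to which Brouwer's thesis is applied: a path from \<open>x\<close> doubles \<open>x\<close> forever within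
  \<open>[-1/2, 1/2]\<close>, so only \<open>x = 0\<close> has a path.\<close>

definition doubling :: fm
  where "doubling = (Var 0 \<^bold>= Var 1 \<^bold>+ Var 1 \<^bold>\<and> Absv (Var 1) \<^bold>+ Absv (Var 1) \<^bold>\<le> One)"

lemma subst_Path [simp]: "subst \<sigma> \<tau> (Path doubling t) = Path doubling (subst_tm \<sigma> \<tau> t)"
  by (simp add: Path_def doubling_def subst.simps up_def lift_tm_def)

lemma derivable_doubling:
  "(\<Gamma> \<turnstile> subst (y \<triangleright> t \<triangleright> \<sigma>) \<tau> doubling) =
    ((\<Gamma> \<turnstile> (y \<^bold>= t \<^bold>+ t)) \<and> (\<Gamma> \<turnstile> (Absv t \<^bold>+ Absv t \<^bold>\<le> One)))"
  by (simp add: doubling_def derivable_Conj)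

lemma op_app_Path:
  "op_app 1 (Exists (doubling \<^bold>\<and> PVar 0 [Var 0])) P =
    Exists (doubling \<^bold>\<and> subst (Var 0 \<triangleright> (\<lambda>i. Var (Suc (Suc i)))) id P)"
  by (auto simp: op_app_def doubling_def inst_def lift_def subst_subst fun_eq_iff
      intro!: arg_cong2[of _ _ _ _ "\<lambda>\<sigma> \<tau>. subst \<sigma> \<tau> P"] split: nat.split)

lemma op_app_Acc:
  "op_app 1 (Forall (doubling \<^bold>\<rightarrow> PVar 0 [Var 0])) P =
    Forall (doubling \<^bold>\<rightarrow> subst (Var 0 \<triangleright> (\<lambda>i. Var (Suc (Suc i)))) id P)"
  by (auto simp: op_app_def doubling_def inst_def lift_def subst_subst fun_eq_iff
      intro!: arg_cong2[of _ _ _ _ "\<lambda>\<sigma> \<tau>. subst \<sigma> \<tau> P"] split: nat.split)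

lemma Nu_pred_Path: "Nu_pred 1 (Exists (doubling \<^bold>\<and> PVar 0 [Var 0])) = Path doubling (Var 0)"
  by (simp add: Nu_pred_def Path_def doubling_def lift_def subst.simps up_def lift_tm_def)

lemma Path_doubling:
  assumes "\<Gamma> \<turnstile> Path doubling t"
  shows "\<Gamma> \<turnstile> Path doubling (t \<^bold>+ t)" and "\<Gamma> \<turnstile> (Absv t \<^bold>+ Absv t \<^bold>\<le> One)"
proof -
  have "\<Gamma> \<turnstile> inst [t] (op_app 1 (Exists (doubling \<^bold>\<and> PVar 0 [Var 0]))
      (Nu_pred 1 (Exists (doubling \<^bold>\<and> PVar 0 [Var 0]))))"
    using assms unfolding Path_def by (intro coclosure) (simp_all add: doubling_def)
  then have ex: "\<Gamma> \<turnstile> subst (t \<triangleright> Var) id (Exists (doubling \<^bold>\<and> Path doubling (Var 0)))"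
    by (simp only: inst_single op_app_Path Nu_pred_Path subst_Path) simp
  show "\<Gamma> \<turnstile> Path doubling (t \<^bold>+ t)"
    using ex
  proof (rule Exists_elim)
    fix \<Delta> y assume "\<Delta> \<turnstile> subst (y \<triangleright> t \<triangleright> Var) id (doubling \<^bold>\<and> Path doubling (Var 0))"
    then have "\<Delta> \<turnstile> (y \<^bold>= t \<^bold>+ t)" "\<Delta> \<turnstile> Path doubling y" by (simp_all add: forces derivable_doubling)
    with eq_subst_env[of \<Delta> y "t \<^bold>+ t" Var id "Path doubling (Var 0)"]
    show "\<Delta> \<turnstile> Path doubling (t \<^bold>+ t)" by simp
  qed
  show "\<Gamma> \<turnstile> (Absv t \<^bold>+ Absv t \<^bold>\<le> One)"
    using ex by (rule Exists_elim) (simp add: forces derivable_doubling)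
qed

text \<open>By induction on n, every x with a path satisfies |x| \<le> 2^(-n): the path continues at
  x + x, and the bound for x + x gives half of it for x. The statement must cover all x, as the step
  changes x. The Archimedean axiom turns these bounds into x = 0.\<close>

lemma Path_zero:
  assumes "\<Gamma> \<turnstile> Path doubling t"
  shows "\<Gamma> \<turnstile> (t \<^bold>= Zero)"
proof -
  let ?P = "Forall (Path doubling (Var 0) \<^bold>\<rightarrow> Absv (Var 0) \<^bold>\<le> neg_pow2 (Var 1))"
  have P: "(\<Delta> \<turnstile> subst (n \<triangleright> Var) id ?P) =
      (\<forall>x. \<forall>\<Theta>. \<Delta> \<sqsubseteq> \<Theta> \<longrightarrow> (\<Theta> \<turnstile> Path doubling x) \<longrightarrow> (\<Theta> \<turnstile> (Absv x \<^bold>\<le> neg_pow2 n)))" for \<Delta> n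
    by (simp add: forces)
  have "\<Delta> \<turnstile> (Absv t \<^bold>\<le> neg_pow2 n)" if \<Delta>: "\<Gamma> \<sqsubseteq> \<Delta>" and n: "\<Delta> \<turnstile> N n" for \<Delta> n
  proof -
    have "\<Delta> \<turnstile> subst (n \<triangleright> Var) id ?P"
      using n
    proof (rule N_induct)
      have "\<Theta> \<turnstile> (Absv x \<^bold>\<le> neg_pow2 Zero)" if "\<Theta> \<turnstile> Path doubling x" for \<Theta> x
      proof -
        have "\<Theta> \<turnstile> (Absv x \<^bold>+ Absv x \<^bold>\<le> One \<^bold>+ One)"
          by (rule le_cert2[OF Path_doubling(2)[OF that] zero_le_one]) simp
        then show ?thesis by (blast intro: le_double le_transD eq_imp_le neg_pow2_zero eq_sym)
      qed
      then show "\<Delta> \<turnstile> subst (Zero \<triangleright> Var) id ?P" unfolding P by blast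
    next
      fix \<Theta> :: "fm list" and x assume IH: "\<Theta> \<turnstile> subst (x \<triangleright> Var) id ?P"
      have "\<Xi> \<turnstile> (Absv y \<^bold>\<le> neg_pow2 (x \<^bold>+ One))" if \<Xi>: "\<Theta> \<sqsubseteq> \<Xi>" "\<Xi> \<turnstile> Path doubling y" for \<Xi> y
      proof -
        have "\<Xi> \<turnstile> (Absv (y \<^bold>+ y) \<^bold>\<le> neg_pow2 x)"
          using IH Path_doubling(1)[OF \<Xi>(2)] \<Xi>(1) unfolding P by blast
        then have "\<Xi> \<turnstile> (Absv y \<^bold>+ Absv y \<^bold>\<le> neg_pow2 x)"
          by (rule le_transD[OF double_le_abs])
        then show ?thesis
          by (blast intro: le_double le_transD eq_imp_le neg_pow2_succ)
      qed
      then show "\<Theta> \<turnstile> subst (x \<^bold>+ One \<triangleright> Var) id ?P" unfolding P by blast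
    qed
    with \<Delta> weaken[OF assms \<Delta>] show ?thesis unfolding P by blast
  qed
  then have "\<Gamma> \<turnstile> Forall (N (Var 0) \<^bold>\<rightarrow> Absv (lift_tm 1 t) \<^bold>\<le> neg_pow2 (Var 0))"
    by (simp add: forces subst_tm_lift_tm)
  then show ?thesis by (blast intro: impE ax archimedean)
qed

text \<open>Brouwer's thesis asks for a relation free of disjunctions and predicate variables.
  Membership in \<open>F\<close> is therefore kept out of \<open>doubling\<close>; it enters only
  the predicate proved by the induction along it.\<close>

lemma Acc_doubling: 
  assumes "\<Gamma> \<turnstile> (\<^bold>\<not> t \<^bold>= Zero)"
  shows "\<Gamma> \<turnstile> Acc doubling t"
proof -
  have "\<Gamma> \<turnstile> (\<^bold>\<not> Path doubling t)"
    unfolding derivable_Imp using Path_zero assms by (meson impE weaken)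
  moreover have "axiom (\<^bold>\<not> Path doubling t \<^bold>\<rightarrow> Acc doubling t)"
    by (rule brouwer_thesis) (simp_all add: doubling_def)
  ultimately show ?thesis by (blast intro: impE ax)
qed

text \<open>Below x there is at most one element, x + x up to equality, so the hypothesis over all
  predecessors shrinks to a single instance guarded by |x| + |x| \<le> 1.\<close>

lemma Acc_induct:
  assumes t: "\<Gamma> \<turnstile> Acc doubling t"
    and step: "\<And>\<Delta> x. \<Gamma> \<sqsubseteq> \<Delta> \<Longrightarrow>
      (\<And>\<Theta>. \<Delta> \<sqsubseteq> \<Theta> \<Longrightarrow> \<Theta> \<turnstile> (Absv x \<^bold>+ Absv x \<^bold>\<le> One) \<Longrightarrow> \<Theta> \<turnstile> subst (x \<^bold>+ x \<triangleright> Var) id P) \<Longrightarrow>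
      \<Delta> \<turnstile> subst (x \<triangleright> Var) id P"
  shows "\<Gamma> \<turnstile> subst (t \<triangleright> Var) id P"
proof -
  let ?A = "Forall (doubling \<^bold>\<rightarrow> PVar 0 [Var 0])"
  have "\<Gamma> \<turnstile> Forall (op_app 1 ?A P \<^bold>\<rightarrow> P)"
  proof (rule forall_intro, unfold subst.simps(9) derivable_Imp, intro allI HOL.impI)
    fix x and \<Delta> :: "fm list" assume \<Delta>: "\<Gamma> \<sqsubseteq> \<Delta>" and hyp: "\<Delta> \<turnstile> subst (x \<triangleright> Var) id (op_app 1 ?A P)"
    show "\<Delta> \<turnstile> subst (x \<triangleright> Var) id P"
      using \<Delta>
    proof (rule step)
      fix \<Theta> assume \<Theta>: "\<Delta> \<sqsubseteq> \<Theta>" "\<Theta> \<turnstile> (Absv x \<^bold>+ Absv x \<^bold>\<le> One)"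
      with hyp[unfolded op_app_Acc] show "\<Theta> \<turnstile> subst (x \<^bold>+ x \<triangleright> Var) id P"
        by (auto simp: forces derivable_doubling eq_refl subst_subst)
    qed
  qed
  then have "\<Gamma> \<turnstile> inst [t] P"
    using t unfolding Acc_def
    by (intro induction[of 1 ?A]) (simp_all add: Forall_open[simplified] doubling_def)
  then show ?thesis by (simp add: inst_single)
qed

section \<open>Apartness, rationals and constructive reals\<close>

lemma subst_apart0 [simp]: "subst \<sigma> \<tau> (apart0 t) = apart0 (subst_tm \<sigma> \<tau> t)"
  by (simp add: apart0_def subst.simps neg_pow2_def up_def subst_tm_lift_tm)
    (simp add: lift_tm_def subst_tm_subst_tm)

lemma apart0_intro: "\<Gamma> \<turnstile> N k \<Longrightarrow> \<Gamma> \<turnstile> (neg_pow2 k \<^bold>\<le> Absv t) \<Longrightarrow> \<Gamma> \<turnstile> apart0 t"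
  unfolding apart0_def
  by (rule Exists_intro'[of _ k]) (simp add: forces subst_tm_lift_tm)

lemma apart0_elim:
  assumes "\<Gamma> \<turnstile> apart0 t"
    and "\<And>\<Delta> k. \<Gamma> \<sqsubseteq> \<Delta> \<Longrightarrow> \<Delta> \<turnstile> N k \<Longrightarrow> \<Delta> \<turnstile> (neg_pow2 k \<^bold>\<le> Absv t) \<Longrightarrow> \<Delta> \<turnstile> D"
  shows "\<Gamma> \<turnstile> D"
  using assms(1) unfolding apart0_def
  by (rule exists_elim) (auto simp: forces subst_tm_lift_tm intro: assms(2))

lemma apart0_neq:
  assumes "\<Gamma> \<turnstile> apart0 t"
  shows "\<Gamma> \<turnstile> (\<^bold>\<not> t \<^bold>= Zero)"
  unfolding derivable_Imp
proof (intro allI HOL.impI)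
  fix \<Delta> assume \<Delta>: "\<Gamma> \<sqsubseteq> \<Delta>" "\<Delta> \<turnstile> (t \<^bold>= Zero)"
  from weaken[OF assms \<Delta>(1)] show "\<Delta> \<turnstile> \<^bold>\<bottom>"
  proof (rule apart0_elim)
    fix \<Theta> k assume \<Theta>: "\<Delta> \<sqsubseteq> \<Theta>" and k: "\<Theta> \<turnstile> N k" "\<Theta> \<turnstile> (neg_pow2 k \<^bold>\<le> Absv t)"
    have t: "\<Theta> \<turnstile> (t \<^bold>= Zero)" using \<Delta> \<Theta> weaken by blast
    have "\<Theta> \<turnstile> (neg_pow2 k \<^bold>\<le> Zero)"
      by (rule le_cert3[OF k(2) eq_imp_le[OF abs_pos[OF eq_imp_le[OF eq_sym[OF t]]]] eq_imp_le[OF t]])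
        (simp add: algebra_simps)
    then show "\<Theta> \<turnstile> \<^bold>\<bottom>" using neg_pow2_pos[OF k(1)] by (blast intro: impE)
  qed
qed

text \<open>From 2^(-k) \<le> |t + t| \<le> |t| + |t| the exponent k + 1 works for t.\<close>

lemma apart0_double:
  assumes "\<Gamma> \<turnstile> apart0 (t \<^bold>+ t)"
  shows "\<Gamma> \<turnstile> apart0 t"
  using assms
proof (rule apart0_elim)
  fix \<Delta> k assume k: "\<Delta> \<turnstile> N k" "\<Delta> \<turnstile> (neg_pow2 k \<^bold>\<le> Absv (t \<^bold>+ t))"
  have "\<Delta> \<turnstile> (neg_pow2 (k \<^bold>+ One) \<^bold>+ neg_pow2 (k \<^bold>+ One) \<^bold>\<le> Absv t \<^bold>+ Absv t)"
    by (rule le_transD[OF le_transD[OF eq_imp_le[OF eq_sym[OF neg_pow2_succ]] k(2)] abs_double])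
  then show "\<Delta> \<turnstile> apart0 t" by (rule apart0_intro[OF N_succ[OF k(1)] le_double])
qed

lemma subst_Q [simp]: "subst \<sigma> \<tau> (Q t) = Q (subst_tm \<sigma> \<tau> t)"
  by (simp add: Q_def subst.simps up_def subst_tm_lift_tm)
    (simp add: lift_tm_def subst_tm_subst_tm numeral_eq_Suc)

lemma subst_C [simp]: "subst \<sigma> \<tau> (C t) = C (subst_tm \<sigma> \<tau> t)"
  by (simp add: C_def subst.simps up_def subst_tm_lift_tm)
    (simp add: lift_tm_def subst_tm_subst_tm)

lemma C_elim:
  assumes "\<Gamma> \<turnstile> C x" and "\<Gamma> \<turnstile> N m"
    and "\<And>\<Delta> q. \<Gamma> \<sqsubseteq> \<Delta> \<Longrightarrow> \<Delta> \<turnstile> Q q \<Longrightarrow> \<Delta> \<turnstile> (Absv (x \<^bold>- q) \<^bold>\<le> neg_pow2 m) \<Longrightarrow> \<Delta> \<turnstile> D"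
  shows "\<Gamma> \<turnstile> D"
proof -
  have "\<Gamma> \<turnstile> subst (m \<triangleright> Var) id (Exists (Q (Var 0) \<^bold>\<and> Absv (lift_tm 2 x \<^bold>- Var 0) \<^bold>\<le> neg_pow2 (Var 1)))"
    using assms(1,2) unfolding C_def by (simp add: forces)
  then show ?thesis
    by (rule Exists_elim) (auto simp: forces subst_tm_lift_tm intro: assms(3))
qed

lemma Q_elim:
  assumes "\<Gamma> \<turnstile> Q q"
    and "\<And>\<Delta> y z u. \<Gamma> \<sqsubseteq> \<Delta> \<Longrightarrow> \<Delta> \<turnstile> N y \<Longrightarrow> \<Delta> \<turnstile> N z \<Longrightarrow> \<Delta> \<turnstile> N u \<Longrightarrow>
      \<Delta> \<turnstile> (q \<^bold>= (y \<^bold>- z) \<^bold>/ (u \<^bold>+ One)) \<Longrightarrow> \<Delta> \<turnstile> D"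
  shows "\<Gamma> \<turnstile> D"
proof -
  let ?A = "N (Var 2) \<^bold>\<and> N (Var 1) \<^bold>\<and> N (Var 0) \<^bold>\<and>
    lift_tm 3 q \<^bold>= (Var 2 \<^bold>- Var 1) \<^bold>/ (Var 0 \<^bold>+ One)"
  from assms(1) show ?thesis
    unfolding Q_def
  proof (rule exists_elim)
    fix \<Delta> y assume \<Delta>: "\<Gamma> \<sqsubseteq> \<Delta>" and 1: "\<Delta> \<turnstile> subst (y \<triangleright> Var) id (Exists (Exists ?A))"
    from 1 show "\<Delta> \<turnstile> D"
    proof (rule Exists_elim)
      fix \<Theta> z assume \<Theta>: "\<Delta> \<sqsubseteq> \<Theta>" and 2: "\<Theta> \<turnstile> subst (z \<triangleright> y \<triangleright> Var) id (Exists ?A)"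
      from 2 show "\<Theta> \<turnstile> D"
      proof (rule Exists_elim)
        fix \<Xi> u assume \<Xi>: "\<Theta> \<sqsubseteq> \<Xi>" and 3: "\<Xi> \<turnstile> subst (u \<triangleright> z \<triangleright> y \<triangleright> Var) id ?A"
        then show "\<Xi> \<turnstile> D"
          using \<Delta> \<Theta>
          by (intro assms(2)[of _ y z u]) (auto simp: forces subst_tm_lift_tm numeral_eq_Suc)
      qed
    qed
  qed
qed

lemma field_rules:
  assumes "\<Gamma> \<turnstile> constructive_field F"
  shows field_zero: "\<Gamma> \<turnstile> PVar F [Zero]" and field_one: "\<Gamma> \<turnstile> PVar F [One]"
    and field_add: "\<Gamma> \<turnstile> PVar F [s] \<Longrightarrow> \<Gamma> \<turnstile> PVar F [t] \<Longrightarrow> \<Gamma> \<turnstile> PVar F [s \<^bold>+ t]"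
    and field_sub: "\<Gamma> \<turnstile> PVar F [s] \<Longrightarrow> \<Gamma> \<turnstile> PVar F [t] \<Longrightarrow> \<Gamma> \<turnstile> PVar F [s \<^bold>- t]"
    and field_mul: "\<Gamma> \<turnstile> PVar F [s] \<Longrightarrow> \<Gamma> \<turnstile> PVar F [t] \<Longrightarrow> \<Gamma> \<turnstile> PVar F [s \<^bold>* t]"
    and field_div: "\<Gamma> \<turnstile> PVar F [s] \<Longrightarrow> \<Gamma> \<turnstile> PVar F [t] \<Longrightarrow> \<Gamma> \<turnstile> apart0 t \<Longrightarrow> \<Gamma> \<turnstile> PVar F [s \<^bold>/ t]"
    and field_C: "\<Gamma> \<turnstile> PVar F [t] \<Longrightarrow> \<Gamma> \<turnstile> C t"
proof -
  from assms have *: "\<Gamma> \<turnstile> is_ring F"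
    "\<Gamma> \<turnstile> Forall (Forall (PVar F [Var 1] \<^bold>\<rightarrow> PVar F [Var 0] \<^bold>\<rightarrow> apart0 (Var 0) \<^bold>\<rightarrow> PVar F [Var 1 \<^bold>/ Var 0]))"
    "\<Gamma> \<turnstile> Forall (PVar F [Var 0] \<^bold>\<rightarrow> C (Var 0))"
    unfolding constructive_field_def is_field_def derivable_Conj by auto
  show "\<Gamma> \<turnstile> PVar F [Zero]" "\<Gamma> \<turnstile> PVar F [One]" using *(1) by (auto simp: is_ring_def forces)
  show "\<Gamma> \<turnstile> PVar F [s \<^bold>+ t]" "\<Gamma> \<turnstile> PVar F [s \<^bold>- t]" "\<Gamma> \<turnstile> PVar F [s \<^bold>* t]"
    if "\<Gamma> \<turnstile> PVar F [s]" "\<Gamma> \<turnstile> PVar F [t]"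
    using *(1) that by (auto simp: is_ring_def forces)
  show "\<Gamma> \<turnstile> PVar F [s \<^bold>/ t]" if "\<Gamma> \<turnstile> PVar F [s]" "\<Gamma> \<turnstile> PVar F [t]" "\<Gamma> \<turnstile> apart0 t"
    using *(2) that by (simp add: forces) blast
  show "\<Gamma> \<turnstile> C t" if "\<Gamma> \<turnstile> PVar F [t]"
    using *(3) that by (auto simp: forces)
qed

text \<open>If e \<le> 0, then (-e)(d - 1) \<ge> 0, and adding e d \<ge> 0 yields e \<ge> 0. This
  removes a denominator without dividing.\<close>

lemma nonneg_cancel:
  assumes d: "\<Gamma> \<turnstile> (One \<^bold>\<le> d)" and e: "\<Gamma> \<turnstile> (Zero \<^bold>\<le> e \<^bold>* d)"
  shows "\<Gamma> \<turnstile> (Zero \<^bold>\<le> e)"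
proof (rule le_cases[of _ Zero e])
  fix \<Delta> assume \<Delta>: "\<Gamma> \<sqsubseteq> \<Delta>" "\<Delta> \<turnstile> (e \<^bold>\<le> Zero)"
  have "\<Delta> \<turnstile> (Zero \<^bold>\<le> Zero \<^bold>- e)" by (rule le_cert1[OF \<Delta>(2)]) simp
  moreover have "\<Delta> \<turnstile> (Zero \<^bold>\<le> d \<^bold>- One)" by (rule le_cert1[OF weaken[OF d \<Delta>(1)]]) simp
  ultimately have "\<Delta> \<turnstile> (Zero \<^bold>\<le> (Zero \<^bold>- e) \<^bold>* (d \<^bold>- One))" by (rule mul_nonneg)
  then show "\<Delta> \<turnstile> (Zero \<^bold>\<le> e)"
    by (rule le_cert2[OF _ weaken[OF e \<Delta>(1)]]) (simp add: algebra_simps)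
qed

text \<open>Multiplying by 4 keeps fractions out of the certificates: the threshold 1/4 for q
  becomes 1 for \<open>four q\<close>. The nested form lets \<open>le_double\<close> cancel the
  factor.\<close>

abbreviation four :: "tm \<Rightarrow> tm"
  where "four t \<equiv> (t \<^bold>+ t) \<^bold>+ (t \<^bold>+ t)"

lemma four_mono: "\<Gamma> \<turnstile> (s \<^bold>\<le> t) \<Longrightarrow> \<Gamma> \<turnstile> (four s \<^bold>\<le> four t)"
  using le_cert2[of \<Gamma> s t s t "t \<^bold>+ t" "s \<^bold>+ s"]
    le_cert2[of \<Gamma> "s \<^bold>+ s" "t \<^bold>+ t" "s \<^bold>+ s" "t \<^bold>+ t" "four t" "four s"]
  by (simp add: algebra_simps)

lemma four_cancel: "\<Gamma> \<turnstile> (four s \<^bold>\<le> four t) \<Longrightarrow> \<Gamma> \<turnstile> (s \<^bold>\<le> t)"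
  using le_double by blast

text \<open>After clearing the denominator u + 1, the sign and size of q are decided by comparing
  the natural numbers 4y and 4z + u, and 4z and 4y + u. Reals in general admit no such decision, and
  this is where approximation by rationals is indispensable.\<close>

lemma rational_trichotomy:
  assumes q: "\<Gamma> \<turnstile> Q q"
    and D1: "\<And>\<Delta>. \<Gamma> \<sqsubseteq> \<Delta> \<Longrightarrow> \<Delta> \<turnstile> (One \<^bold>\<le> four q) \<Longrightarrow> \<Delta> \<turnstile> D"
    and D2: "\<And>\<Delta>. \<Gamma> \<sqsubseteq> \<Delta> \<Longrightarrow> \<Delta> \<turnstile> (One \<^bold>\<le> Zero \<^bold>- four q) \<Longrightarrow> \<Delta> \<turnstile> D"
    and D3: "\<And>\<Delta>. \<Gamma> \<sqsubseteq> \<Delta> \<Longrightarrow> \<Delta> \<turnstile> (four q \<^bold>\<le> One) \<Longrightarrow> \<Delta> \<turnstile> (Zero \<^bold>- four q \<^bold>\<le> One) \<Longrightarrow> \<Delta> \<turnstile> D"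
  shows "\<Gamma> \<turnstile> D"
  using q
proof (rule Q_elim)
  fix \<Delta> y z u
  assume \<Delta>: "\<Gamma> \<sqsubseteq> \<Delta>" and N: "\<Delta> \<turnstile> N y" "\<Delta> \<turnstile> N z" "\<Delta> \<turnstile> N u"
    and "\<Delta> \<turnstile> (q \<^bold>= (y \<^bold>- z) \<^bold>/ (u \<^bold>+ One))"
  let ?d = "u \<^bold>+ One"
  have d: "\<Delta> \<turnstile> (One \<^bold>\<le> ?d)" by (rule le_cert1[OF N_nonneg[OF N(3)]]) simp
  have "\<Delta> \<turnstile> (\<^bold>\<not> ?d \<^bold>= Zero)"
    unfolding derivable_Imp using d weaken one_le_zero le_transD eq_imp_le by meson
  then have "\<Delta> \<turnstile> (((y \<^bold>- z) \<^bold>/ ?d) \<^bold>* ?d \<^bold>= y \<^bold>- z)" by (rule divide_mul)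
  then have q: "\<Delta> \<turnstile> (q \<^bold>* ?d \<^bold>= y \<^bold>- z)"
    using \<open>\<Delta> \<turnstile> (q \<^bold>= _)\<close> by (blast intro: eq_trans eq_mul eq_refl)
  have four: "\<Delta> \<turnstile> N (four t)" if "\<Delta> \<turnstile> N t" for t
    using that by (intro N_add)
  have q1: "\<Delta> \<turnstile> (four y \<^bold>- four z \<^bold>\<le> four q \<^bold>* ?d)" "\<Delta> \<turnstile> (four q \<^bold>* ?d \<^bold>\<le> four y \<^bold>- four z)"
    by (rule le_cert1[OF four_mono[OF eq_imp_le[OF eq_sym[OF q]]]], simp add: algebra_simps)
      (rule le_cert1[OF four_mono[OF eq_imp_le[OF q]]], simp add: algebra_simps)
  show "\<Delta> \<turnstile> D"
  proof (rule N_le_cases[of _ "four y" "four z \<^bold>+ u"])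
    show "\<Delta> \<turnstile> N (four y)" "\<Delta> \<turnstile> N (four z \<^bold>+ u)" using N four N_add by blast+
  next
    fix \<Theta> assume \<Theta>: "\<Delta> \<sqsubseteq> \<Theta>" "\<Theta> \<turnstile> (four z \<^bold>+ u \<^bold>+ One \<^bold>\<le> four y)"
    have "\<Theta> \<turnstile> (Zero \<^bold>\<le> (four q \<^bold>- One) \<^bold>* ?d)"
      by (rule le_cert2[OF \<Theta>(2) weaken[OF q1(1) \<Theta>(1)]]) (simp add: algebra_simps)
    then have "\<Theta> \<turnstile> (Zero \<^bold>\<le> four q \<^bold>- One)" by (rule nonneg_cancel[OF weaken[OF d \<Theta>(1)]])
    then have "\<Theta> \<turnstile> (One \<^bold>\<le> four q)" by (rule le_cert1) simp
    then show "\<Theta> \<turnstile> D" using \<Delta> \<Theta>(1) by (intro D1) auto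
  next
    fix \<Theta> assume \<Theta>: "\<Delta> \<sqsubseteq> \<Theta>" "\<Theta> \<turnstile> (four y \<^bold>\<le> four z \<^bold>+ u)"
    show "\<Theta> \<turnstile> D"
    proof (rule N_le_cases[of _ "four z" "four y \<^bold>+ u"])
      show "\<Theta> \<turnstile> N (four z)" "\<Theta> \<turnstile> N (four y \<^bold>+ u)" using N four N_add weaken \<Theta>(1) by blast+
    next
      fix \<Xi> assume \<Xi>: "\<Theta> \<sqsubseteq> \<Xi>" "\<Xi> \<turnstile> (four y \<^bold>+ u \<^bold>+ One \<^bold>\<le> four z)"
      have \<Delta>\<Xi>: "\<Delta> \<sqsubseteq> \<Xi>" using \<Theta>(1) \<Xi>(1) by auto
      have "\<Xi> \<turnstile> (Zero \<^bold>\<le> (Zero \<^bold>- four q \<^bold>- One) \<^bold>* ?d)"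
        by (rule le_cert2[OF \<Xi>(2) weaken[OF q1(2) \<Delta>\<Xi>]]) (simp add: algebra_simps)
      then have "\<Xi> \<turnstile> (Zero \<^bold>\<le> Zero \<^bold>- four q \<^bold>- One)" by (rule nonneg_cancel[OF weaken[OF d \<Delta>\<Xi>]])
      then have "\<Xi> \<turnstile> (One \<^bold>\<le> Zero \<^bold>- four q)" by (rule le_cert1) simp
      then show "\<Xi> \<turnstile> D" using \<Delta> \<Delta>\<Xi> by (intro D2) auto
    next
      fix \<Xi> assume \<Xi>: "\<Theta> \<sqsubseteq> \<Xi>" "\<Xi> \<turnstile> (four z \<^bold>\<le> four y \<^bold>+ u)"
      have \<Delta>\<Xi>: "\<Delta> \<sqsubseteq> \<Xi>" using \<Theta>(1) \<Xi>(1) by auto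
      note d' = weaken[OF d \<Delta>\<Xi>]
      have "\<Xi> \<turnstile> (Zero \<^bold>\<le> (One \<^bold>- four q) \<^bold>* ?d)"
        by (rule le_cert3[OF weaken[OF \<Theta>(2) \<Xi>(1)] weaken[OF q1(2) \<Delta>\<Xi>] zero_le_one])
          (simp add: algebra_simps)
      then have "\<Xi> \<turnstile> (Zero \<^bold>\<le> One \<^bold>- four q)" by (rule nonneg_cancel[OF d'])
      then have 1: "\<Xi> \<turnstile> (four q \<^bold>\<le> One)" by (rule le_cert1) simp
      have "\<Xi> \<turnstile> (Zero \<^bold>\<le> (One \<^bold>+ four q) \<^bold>* ?d)"
        by (rule le_cert3[OF \<Xi>(2) weaken[OF q1(1) \<Delta>\<Xi>] zero_le_one])
          (simp add: algebra_simps)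
      then have "\<Xi> \<turnstile> (Zero \<^bold>\<le> One \<^bold>+ four q)" by (rule nonneg_cancel[OF d'])
      then have "\<Xi> \<turnstile> (Zero \<^bold>- four q \<^bold>\<le> One)" by (rule le_cert1) simp
      with 1 show "\<Xi> \<turnstile> D" using \<Delta> \<Delta>\<Xi> by (intro D3) auto
    qed
  qed
qed

text \<open>Induction along doubling: a rational approximation of x either shows x to be apart from
  0 or shows |x| \<le> 1/2, in which case x + x stays within reach of the induction and apartness
  passes back to x. \<open>F\<close> serves twice, as the source of approximations and as a set
  closed under doubling.\<close>

lemma markov:
  assumes F: "\<Gamma> \<turnstile> constructive_field F" and x: "\<Gamma> \<turnstile> PVar F [x]" and neq: "\<Gamma> \<turnstile> (\<^bold>\<not> x \<^bold>= Zero)"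
  shows "\<Gamma> \<turnstile> apart0 x"
proof -
  let ?P = "PVar F [Var 0] \<^bold>\<rightarrow> apart0 (Var 0)"
  have "\<Gamma> \<turnstile> subst (x \<triangleright> Var) id ?P"
    using Acc_doubling[OF neq]
  proof (rule Acc_induct)
    fix \<Delta> :: "fm list" and x
    assume \<Delta>: "\<Gamma> \<sqsubseteq> \<Delta>" and IH: "\<And>\<Theta>. \<Delta> \<sqsubseteq> \<Theta> \<Longrightarrow> \<Theta> \<turnstile> (Absv x \<^bold>+ Absv x \<^bold>\<le> One) \<Longrightarrow>
      \<Theta> \<turnstile> subst (x \<^bold>+ x \<triangleright> Var) id ?P"
    have "\<Theta> \<turnstile> apart0 x" if \<Theta>: "\<Delta> \<sqsubseteq> \<Theta>" and x: "\<Theta> \<turnstile> PVar F [x]" for \<Theta>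
    proof -
      have F': "\<Theta> \<turnstile> constructive_field F" using F weaken \<Delta> \<Theta> by blast
      \<comment> \<open>The precision 2^(-3) = 1/8 fits the threshold 1/4 for q: if |q| \<ge> 1/4,
        then |x| \<ge> 1/8, and otherwise |x| \<le> 1/4 + 1/8, which is below 1/2.\<close>
      have three: "\<Xi> \<turnstile> N (Zero \<^bold>+ One \<^bold>+ One \<^bold>+ One)" for \<Xi> by (intro N_succ N_zero)
      let ?p = "neg_pow2 (Zero \<^bold>+ One \<^bold>+ One \<^bold>+ One)"
      have p: "\<Xi> \<turnstile> (One \<^bold>= four ?p \<^bold>+ four ?p)" for \<Xi>
      proof -
        have "\<Xi> \<turnstile> (One \<^bold>= neg_pow2 (Zero \<^bold>+ One) \<^bold>+ neg_pow2 (Zero \<^bold>+ One))"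
          by (rule eq_trans[OF eq_sym[OF neg_pow2_zero] neg_pow2_succ])
        moreover have "\<Xi> \<turnstile> (neg_pow2 (Zero \<^bold>+ One) \<^bold>= four ?p)"
          by (rule eq_trans[OF neg_pow2_succ eq_add[OF neg_pow2_succ neg_pow2_succ]])
        ultimately show ?thesis by (blast intro: eq_trans eq_add)
      qed
      from field_C[OF F' x] three show ?thesis
      proof (rule C_elim)
        fix \<Xi> q assume \<Xi>: "\<Theta> \<sqsubseteq> \<Xi>" and q: "\<Xi> \<turnstile> Q q" and le: "\<Xi> \<turnstile> (Absv (x \<^bold>- q) \<^bold>\<le> ?p)"
        have 1: "\<Xi> \<turnstile> (four (x \<^bold>- q) \<^bold>\<le> four ?p)"
          by (rule four_mono[OF le_transD[OF le_abs le]])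
        have 2: "\<Xi> \<turnstile> (four (Zero \<^bold>- (x \<^bold>- q)) \<^bold>\<le> four ?p)"
          by (rule four_mono[OF le_transD[OF neg_le_abs le]])
        from q show "\<Xi> \<turnstile> apart0 x"
        proof (rule rational_trichotomy)
          fix \<Omega> assume \<Omega>: "\<Xi> \<sqsubseteq> \<Omega>" "\<Omega> \<turnstile> (One \<^bold>\<le> four q)"
          have "\<Omega> \<turnstile> (four ?p \<^bold>\<le> four x)"
            by (rule le_cert3[OF \<Omega>(2) weaken[OF 2 \<Omega>(1)] eq_imp_le[OF eq_sym[OF p]]])
              (simp add: algebra_simps)
          then show "\<Omega> \<turnstile> apart0 x"
            by (rule apart0_intro[OF three le_transD[OF four_cancel le_abs]])
        next
          fix \<Omega> assume \<Omega>: "\<Xi> \<sqsubseteq> \<Omega>" "\<Omega> \<turnstile> (One \<^bold>\<le> Zero \<^bold>- four q)"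
          have "\<Omega> \<turnstile> (four ?p \<^bold>\<le> four (Zero \<^bold>- x))"
            by (rule le_cert3[OF \<Omega>(2) weaken[OF 1 \<Omega>(1)] eq_imp_le[OF eq_sym[OF p]]])
              (simp add: algebra_simps)
          then show "\<Omega> \<turnstile> apart0 x"
            by (rule apart0_intro[OF three le_transD[OF four_cancel neg_le_abs]])
        next
          fix \<Omega> assume \<Omega>: "\<Xi> \<sqsubseteq> \<Omega>" "\<Omega> \<turnstile> (four q \<^bold>\<le> One)" "\<Omega> \<turnstile> (Zero \<^bold>- four q \<^bold>\<le> One)"
          have sub: "\<Theta> \<sqsubseteq> \<Omega>" "\<Delta> \<sqsubseteq> \<Omega>" using \<Theta> \<Xi> \<Omega>(1) by auto
          have "\<Omega> \<turnstile> (Zero \<^bold>\<le> four ?p)"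
            by (rule le_double, rule le_cert2[OF zero_le_one eq_imp_le[OF p]]) simp
          then have p1: "\<Omega> \<turnstile> (four ?p \<^bold>\<le> One)"
            by (rule le_cert2[OF _ eq_imp_le[OF eq_sym[OF p]]]) (simp add: algebra_simps)
          have "\<Omega> \<turnstile> (four x \<^bold>\<le> One \<^bold>+ One)"
            by (rule le_cert3[OF \<Omega>(2) weaken[OF 1 \<Omega>(1)] p1]) (simp add: algebra_simps)
          then have 3: "\<Omega> \<turnstile> (x \<^bold>+ x \<^bold>\<le> One)" by (rule le_double)
          have "\<Omega> \<turnstile> ((Zero \<^bold>- (x \<^bold>+ x)) \<^bold>+ (Zero \<^bold>- (x \<^bold>+ x)) \<^bold>\<le> One \<^bold>+ One)"
            by (rule le_cert3[OF \<Omega>(3) weaken[OF 2 \<Omega>(1)] p1]) (simp add: algebra_simps)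
          then have 4: "\<Omega> \<turnstile> (Zero \<^bold>- (x \<^bold>+ x) \<^bold>\<le> One)" by (rule le_double)
          have "\<Omega> \<turnstile> (Absv x \<^bold>+ Absv x \<^bold>\<le> One)"
            by (rule le_transD[OF double_le_abs abs_leI[OF 3 4]])
          then have "\<Omega> \<turnstile> subst (x \<^bold>+ x \<triangleright> Var) id ?P" by (rule IH[OF sub(2)])
          moreover have "\<Omega> \<turnstile> PVar F [x \<^bold>+ x]"
            using F' x sub(1) by (blast intro: field_add weaken)
          ultimately have "\<Omega> \<turnstile> apart0 (x \<^bold>+ x)" by (auto simp: forces)
          then show "\<Omega> \<turnstile> apart0 x" by (rule apart0_double)
        qed
      qed
    qed
    then show "\<Delta> \<turnstile> subst (x \<triangleright> Var) id ?P" by (simp add: forces)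
  qed
  then show ?thesis using x by (auto simp: forces)
qed

section \<open>Finite sums\<close>

abbreviation ap :: "tm \<Rightarrow> tm \<Rightarrow> tm"
  where "ap f i \<equiv> subst_tm (i \<triangleright> Var) (\<lambda>a. a) f"

text \<open>In a summand \<open>Var 0\<close> is the summation index and must stay fixed; only the
  variables from \<open>Var 1\<close> on are weakened by \<open>k\<close>.\<close>

definition lift_summand :: "nat \<Rightarrow> tm \<Rightarrow> tm"
  where "lift_summand k f = subst_tm (up (Suc 0) (\<lambda>i. Var (i + k))) id f"

lemma up_simps [simp]:
  "up (Suc 0) \<sigma> 0 = Var 0" "up (Suc 0) \<sigma> (Suc i) = lift_tm (Suc 0) (\<sigma> i)"
  "up (Suc 0) \<sigma> (numeral m) = lift_tm (Suc 0) (\<sigma> (pred_numeral m))"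
  by (simp_all add: up_def numeral_eq_Suc)

lemma up_Var_simps [simp]: "up (Suc 0) Var = Var" "up (Suc 0) (\<lambda>i. Var i) = Var"
  by (simp_all add: up_Var)

lemma subst_tm_up_up [simp]:
  "subst_tm (up (Suc 0) \<sigma>) \<tau> (subst_tm (up (Suc 0) \<sigma>') \<tau>' f) =
    subst_tm (up (Suc 0) (\<lambda>i. subst_tm \<sigma> \<tau> (\<sigma>' i))) (\<lambda>a. \<tau> (\<tau>' a)) f"
  by (simp add: subst_tm_subst_tm up_subst_tm)

lemmas up_subst_tm_1 [simp] = up_subst_tm[of "Suc 0"]

lemma subst_tm_lift_summand [simp]:
  "subst_tm (up (Suc 0) \<sigma>) \<tau> (lift_summand k f) = subst_tm (up (Suc 0) (\<lambda>i. \<sigma> (i + k))) \<tau> f"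
  by (simp add: lift_summand_def)

lemma subst_sum_is [simp]:
  "subst \<sigma> \<tau> (sum_is f n s) =
    sum_is (subst_tm (up (Suc 0) \<sigma>) \<tau> f) (subst_tm \<sigma> \<tau> n) (subst_tm \<sigma> \<tau> s)"
  by (auto simp: sum_is_def subst.simps up_def lift_tm_def subst_tm_subst_tm numeral_eq_Suc
      intro!: subst_tm_cong split: nat.split)

definition sum_op :: "tm \<Rightarrow> fm"
  where "sum_op f = ((Var 0 \<^bold>= Zero \<^bold>\<and> Var 1 \<^bold>= Zero) \<^bold>\<or>
          Exists (Exists (PVar 0 [Var 1, Var 0] \<^bold>\<and> Var 2 \<^bold>= Var 1 \<^bold>+ One \<^bold>\<and>
            Var 3 \<^bold>= Var 0 \<^bold>+ subst_tm (case_nat (Var 2) (\<lambda>i. Var (i + 4))) id f)))"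

lemma sum_is_op: "sum_is f n s = Mu 2 (sum_op f) [n, s]"
  by (simp add: sum_is_def sum_op_def)

lemma strictly_pos_sum_op: "strictly_pos 0 2 (sum_op f)"
  by (simp add: sum_op_def)

lemma op_app_sum:
  "op_app 2 (sum_op f) P = ((Var 0 \<^bold>= Zero \<^bold>\<and> Var 1 \<^bold>= Zero) \<^bold>\<or>
          Exists (Exists (subst (Var 1 \<triangleright> Var 0 \<triangleright> (\<lambda>i. Var (i + 4))) id P \<^bold>\<and> Var 2 \<^bold>= Var 1 \<^bold>+ One \<^bold>\<and>
            Var 3 \<^bold>= Var 0 \<^bold>+ subst_tm (case_nat (Var 2) (\<lambda>i. Var (i + 4))) id f)))"
  by (auto simp: op_app_def sum_op_def inst_def lift_def subst_subst fun_eq_iff numeral_eq_Suc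
      intro!: arg_cong2[of _ _ _ _ "\<lambda>\<sigma> \<tau>. subst \<sigma> \<tau> P"] split: nat.split)

lemma Mu_pred_sum: "Mu_pred 2 (sum_op f) = sum_is (lift_summand 2 f) (Var 0) (Var 1)"
proof -
  have "lift 2 2 (sum_op f) = sum_op (lift_summand 2 f)"
    by (auto simp: lift_def sum_op_def lift_summand_def subst.simps up_def lift_tm_def subst_tm_subst_tm
        numeral_eq_Suc intro!: subst_tm_cong split: nat.split)
  moreover have "map Var [0..<2] = [Var 0, Var 1]" by (simp add: upt_rec)
  ultimately show ?thesis by (simp add: Mu_pred_def sum_is_op)
qed

lemma sum_eq: "\<Gamma> \<turnstile> sum_is f n s \<Longrightarrow> \<Gamma> \<turnstile> (n \<^bold>= n') \<Longrightarrow> \<Gamma> \<turnstile> (s \<^bold>= s') \<Longrightarrow> \<Gamma> \<turnstile> sum_is f n' s'"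
  using eq_env[of \<Gamma> "n \<triangleright> s \<triangleright> Var" "n' \<triangleright> s' \<triangleright> Var" id "sum_is (lift_summand 2 f) (Var 0) (Var 1)"]
  by (simp add: eq_refl split: nat.split)

lemma inst_pair: "inst [s, t] A = subst (s \<triangleright> t \<triangleright> Var) id A"
  unfolding inst_def by (rule arg_cong[of _ _ "\<lambda>\<sigma>. subst \<sigma> id A"]) (auto split: nat.split)

lemma sum_zero: "\<Gamma> \<turnstile> sum_is f Zero Zero"
  unfolding sum_is_op
  by (rule closure) (simp_all add: strictly_pos_sum_op op_app_sum inst_pair disjI1 derivable_Conj eq_refl)

lemma sum_succ:
  assumes "\<Gamma> \<turnstile> sum_is f m s"
  shows "\<Gamma> \<turnstile> sum_is f (m \<^bold>+ One) (s \<^bold>+ ap f (m \<^bold>+ One))"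
proof -
  have "\<Gamma> \<turnstile> inst [m \<^bold>+ One, s \<^bold>+ ap f (m \<^bold>+ One)] (op_app 2 (sum_op f) (Mu_pred 2 (sum_op f)))"
    unfolding op_app_sum Mu_pred_sum inst_pair subst.simps(8)
    apply (rule disjI2)
    apply (rule Exists_intro[of _ m])
    apply (rule Exists_intro[of _ s])
    using assms by (simp add: forces eq_refl subst_tm_subst_tm numeral_eq_Suc)
  then show ?thesis
    unfolding sum_is_op by (intro closure) (simp_all add: strictly_pos_sum_op)
qed

lemma Forall_open2: "\<Gamma> \<turnstile> Forall (Forall A) \<Longrightarrow> map (lift 0 2) \<Gamma> \<turnstile> A"
proof -
  assume "\<Gamma> \<turnstile> Forall (Forall A)"
  then have "map (lift 0 1) (map (lift 0 1) \<Gamma>) \<turnstile> A" by (intro Forall_open)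
  also have "map (lift 0 1) (map (lift 0 1) \<Gamma>) = map (lift 0 2) \<Gamma>"
    by (simp add: lift_def subst_subst)
  finally show ?thesis .
qed

text \<open>The fixed-point rule produces fresh m, t tied to the previous values by equations. These
  are eliminated by \<open>eq\<close>, so that the step can speak of the terms m + 1 and t + f(m +
  1) directly.\<close>

lemma sum_induct:
  assumes sum: "\<Gamma> \<turnstile> sum_is f n s"
    and zero: "\<Gamma> \<turnstile> subst (Zero \<triangleright> Zero \<triangleright> Var) id P"
    and succ: "\<And>\<Delta> m t. \<Gamma> \<sqsubseteq> \<Delta> \<Longrightarrow> \<Delta> \<turnstile> subst (m \<triangleright> t \<triangleright> Var) id P \<Longrightarrow>
      \<Delta> \<turnstile> subst (m \<^bold>+ One \<triangleright> t \<^bold>+ ap f (m \<^bold>+ One) \<triangleright> Var) id P"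
  shows "\<Gamma> \<turnstile> subst (n \<triangleright> s \<triangleright> Var) id P"
proof -
  have eq: "\<Delta> \<turnstile> subst (m \<triangleright> t \<triangleright> Var) id P"
    if "\<Delta> \<turnstile> subst (m' \<triangleright> t' \<triangleright> Var) id P" "\<Delta> \<turnstile> (m \<^bold>= m')" "\<Delta> \<turnstile> (t \<^bold>= t')" for \<Delta> m t m' t'
    using that(1) by (rule eq_env[rotated]) (use that in \<open>auto simp: eq_refl eq_sym split: nat.split\<close>)
  let ?A = "sum_op f"
  have "\<Gamma> \<turnstile> Forall (Forall (op_app 2 ?A P \<^bold>\<rightarrow> P))"
    unfolding derivable_Forall derivable_subst_Forall subst.simps(9) derivable_Imp
  proof (intro allI HOL.impI)
    fix t m and \<Delta> :: "fm list"
    assume \<Delta>: "\<Gamma> \<sqsubseteq> \<Delta>" and hyp: "\<Delta> \<turnstile> subst (m \<triangleright> t \<triangleright> Var) id (op_app 2 ?A P)"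
    from hyp show "\<Delta> \<turnstile> subst (m \<triangleright> t \<triangleright> Var) id P"
      unfolding op_app_sum subst.simps(8)
    proof (rule Disj_elim)
      fix \<Theta> assume \<Theta>: "\<Delta> \<sqsubseteq> \<Theta>" "\<Theta> \<turnstile> subst (m \<triangleright> t \<triangleright> Var) id (Var 0 \<^bold>= Zero \<^bold>\<and> Var 1 \<^bold>= Zero)"
      have "\<Theta> \<turnstile> subst (Zero \<triangleright> Zero \<triangleright> Var) id P" using zero weaken \<Delta> \<Theta>(1) by blast
      then show "\<Theta> \<turnstile> subst (m \<triangleright> t \<triangleright> Var) id P"
        by (rule eq) (use \<Theta>(2) in \<open>simp_all add: forces\<close>)
    next
      let ?B = "subst (Var 1 \<triangleright> Var 0 \<triangleright> (\<lambda>i. Var (i + 4))) id P \<^bold>\<and> Var 2 \<^bold>= Var 1 \<^bold>+ One \<^bold>\<and>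
            Var 3 \<^bold>= Var 0 \<^bold>+ subst_tm (case_nat (Var 2) (\<lambda>i. Var (i + 4))) id f"
      fix \<Theta> assume \<Theta>: "\<Delta> \<sqsubseteq> \<Theta>" and ex: "\<Theta> \<turnstile> subst (m \<triangleright> t \<triangleright> Var) id (Exists (Exists ?B))"
      from ex show "\<Theta> \<turnstile> subst (m \<triangleright> t \<triangleright> Var) id P"
      proof (rule Exists_elim)
        fix \<Xi> m' assume \<Xi>: "\<Theta> \<sqsubseteq> \<Xi>" and ex: "\<Xi> \<turnstile> subst (m' \<triangleright> m \<triangleright> t \<triangleright> Var) id (Exists ?B)"
        from ex show "\<Xi> \<turnstile> subst (m \<triangleright> t \<triangleright> Var) id P"
        proof (rule Exists_elim)
          fix \<Omega> t' assume \<Omega>: "\<Xi> \<sqsubseteq> \<Omega>" and "\<Omega> \<turnstile> subst (t' \<triangleright> m' \<triangleright> m \<triangleright> t \<triangleright> Var) id ?B"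
          then have *: "\<Omega> \<turnstile> subst (m' \<triangleright> t' \<triangleright> Var) id P" "\<Omega> \<turnstile> (m \<^bold>= m' \<^bold>+ One)"
            "\<Omega> \<turnstile> (t \<^bold>= t' \<^bold>+ ap f m)"
            by (simp_all add: forces subst_subst subst_tm_subst_tm numeral_eq_Suc)
          have "\<Omega> \<turnstile> (ap f m \<^bold>= ap f (m' \<^bold>+ One))"
            by (rule eq_env_tm) (use * in \<open>auto simp: eq_refl split: nat.split\<close>)
          with * have "\<Omega> \<turnstile> (t \<^bold>= t' \<^bold>+ ap f (m' \<^bold>+ One))"
            by (blast intro: eq_trans eq_add eq_refl)
          moreover have "\<Omega> \<turnstile> subst (m' \<^bold>+ One \<triangleright> t' \<^bold>+ ap f (m' \<^bold>+ One) \<triangleright> Var) id P"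
            using *(1) \<Delta> \<Theta> \<Xi> \<Omega> by (intro succ) auto
          ultimately show "\<Omega> \<turnstile> subst (m \<triangleright> t \<triangleright> Var) id P" using *(2) by (blast intro: eq)
        qed
      qed
    qed
  qed
  then have "\<Gamma> \<turnstile> inst [n, s] P"
    using sum unfolding sum_is_op
    by (intro induction[of 2 ?A]) (simp_all add: Forall_open2 strictly_pos_sum_op)
  then show ?thesis by (simp only: inst_pair)
qed

text \<open>Inversion is proved by induction on a predicate that carries \<open>?C\<close> along:
  the step receives only that predicate at the predecessor, but must deliver both \<open>N m\<close>
  and the sum up to m.\<close>

lemma sum_cases:
  assumes sum: "\<Gamma> \<turnstile> sum_is f n s"
    and zero: "\<And>\<Delta>. \<Gamma> \<sqsubseteq> \<Delta> \<Longrightarrow> \<Delta> \<turnstile> (n \<^bold>= Zero) \<Longrightarrow> \<Delta> \<turnstile> (s \<^bold>= Zero) \<Longrightarrow> \<Delta> \<turnstile> D"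
    and succ: "\<And>\<Delta> m t. \<Gamma> \<sqsubseteq> \<Delta> \<Longrightarrow> \<Delta> \<turnstile> N m \<Longrightarrow> \<Delta> \<turnstile> sum_is f m t \<Longrightarrow> \<Delta> \<turnstile> (n \<^bold>= m \<^bold>+ One) \<Longrightarrow>
      \<Delta> \<turnstile> (s \<^bold>= t \<^bold>+ ap f (m \<^bold>+ One)) \<Longrightarrow> \<Delta> \<turnstile> D"
  shows "\<Gamma> \<turnstile> D"
proof -
  let ?B = "N (Var 1) \<^bold>\<and> sum_is (lift_summand 4 f) (Var 1) (Var 0) \<^bold>\<and> Var 2 \<^bold>= Var 1 \<^bold>+ One \<^bold>\<and>
    Var 3 \<^bold>= Var 0 \<^bold>+ subst_tm (Var 1 \<^bold>+ One \<triangleright> (\<lambda>i. Var (i + 4))) id f"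
  let ?C = "N (Var 0) \<^bold>\<and> sum_is (lift_summand 2 f) (Var 0) (Var 1)"
  let ?P = "?C \<^bold>\<and> ((Var 0 \<^bold>= Zero \<^bold>\<and> Var 1 \<^bold>= Zero) \<^bold>\<or> Exists (Exists ?B))"
  have "\<Gamma> \<turnstile> subst (n \<triangleright> s \<triangleright> Var) id ?P"
    using sum
  proof (rule sum_induct)
    show "\<Gamma> \<turnstile> subst (Zero \<triangleright> Zero \<triangleright> Var) id ?P"
      by (simp add: derivable_Conj N_zero sum_zero eq_refl disjI1 numeral_eq_Suc)
  next
    fix \<Delta> m t assume "\<Delta> \<turnstile> subst (m \<triangleright> t \<triangleright> Var) id ?P"
    then have m: "\<Delta> \<turnstile> N m" "\<Delta> \<turnstile> sum_is f m t" by (simp_all add: derivable_Conj numeral_eq_Suc)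
    let ?\<sigma> = "m \<^bold>+ One \<triangleright> t \<^bold>+ ap f (m \<^bold>+ One) \<triangleright> Var"
    have "\<Delta> \<turnstile> subst ?\<sigma> id (Exists (Exists ?B))"
      apply (rule Exists_intro[of _ m])
      apply (rule Exists_intro[of _ t])
      using m by (simp add: forces eq_refl subst_tm_subst_tm numeral_eq_Suc)
    then have "\<Delta> \<turnstile> subst ?\<sigma> id ((Var 0 \<^bold>= Zero \<^bold>\<and> Var 1 \<^bold>= Zero) \<^bold>\<or> Exists (Exists ?B))"
      unfolding subst.simps(8) by (rule disjI2)
    moreover have "\<Delta> \<turnstile> subst ?\<sigma> id ?C"
      using m sum_succ[OF m(2)] by (simp add: derivable_Conj N_succ numeral_eq_Suc)
    ultimately show "\<Delta> \<turnstile> subst ?\<sigma> id ?P" unfolding subst.simps(7) derivable_Conj by blast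
  qed
  then have "\<Gamma> \<turnstile> subst (n \<triangleright> s \<triangleright> Var) id ((Var 0 \<^bold>= Zero \<^bold>\<and> Var 1 \<^bold>= Zero) \<^bold>\<or> Exists (Exists ?B))"
    unfolding subst.simps(7) derivable_Conj by blast
  then show ?thesis
    unfolding subst.simps(8)
  proof (rule Disj_elim)
    fix \<Theta> assume "\<Gamma> \<sqsubseteq> \<Theta>" "\<Theta> \<turnstile> subst (n \<triangleright> s \<triangleright> Var) id (Var 0 \<^bold>= Zero \<^bold>\<and> Var 1 \<^bold>= Zero)"
    then show "\<Theta> \<turnstile> D" by (intro zero) (simp_all add: derivable_Conj)
  next
    fix \<Theta> assume \<Theta>: "\<Gamma> \<sqsubseteq> \<Theta>" and ex: "\<Theta> \<turnstile> subst (n \<triangleright> s \<triangleright> Var) id (Exists (Exists ?B))"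
    from ex show "\<Theta> \<turnstile> D"
    proof (rule Exists_elim)
      fix \<Xi> m' assume \<Xi>: "\<Theta> \<sqsubseteq> \<Xi>" and ex: "\<Xi> \<turnstile> subst (m' \<triangleright> n \<triangleright> s \<triangleright> Var) id (Exists ?B)"
      from ex show "\<Xi> \<turnstile> D"
      proof (rule Exists_elim)
        fix \<Omega> t' assume \<Omega>: "\<Xi> \<sqsubseteq> \<Omega>" and "\<Omega> \<turnstile> subst (t' \<triangleright> m' \<triangleright> n \<triangleright> s \<triangleright> Var) id ?B"
        then show "\<Omega> \<turnstile> D"
          using \<Theta> \<Xi> by (intro succ[of _ m' t']) (auto simp: derivable_Conj subst_tm_subst_tm numeral_eq_Suc)
      qed
    qed
  qed
qed

lemma sum_zero_inv:
  assumes "\<Gamma> \<turnstile> sum_is f Zero s"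
  shows "\<Gamma> \<turnstile> (s \<^bold>= Zero)"
  using assms
proof (rule sum_cases)
  fix \<Delta> m t assume "\<Delta> \<turnstile> N m" and m: "\<Delta> \<turnstile> (Zero \<^bold>= m \<^bold>+ One)"
  from le_cert2[OF N_nonneg[OF this(1)] eq_imp_le[OF eq_sym[OF m]], of Zero One]
  show "\<Delta> \<turnstile> (s \<^bold>= Zero)" by (rule one_le_zero) simp
qed

lemma sum_succ_inv:
  assumes "\<Gamma> \<turnstile> sum_is f (m \<^bold>+ One) s" and m: "\<Gamma> \<turnstile> N m"
    and D: "\<And>\<Delta> t. \<Gamma> \<sqsubseteq> \<Delta> \<Longrightarrow> \<Delta> \<turnstile> sum_is f m t \<Longrightarrow> \<Delta> \<turnstile> (s \<^bold>= t \<^bold>+ ap f (m \<^bold>+ One)) \<Longrightarrow> \<Delta> \<turnstile> D"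
  shows "\<Gamma> \<turnstile> D"
  using assms(1)
proof (rule sum_cases)
  fix \<Delta> assume \<Delta>: "\<Gamma> \<sqsubseteq> \<Delta>" and eq: "\<Delta> \<turnstile> (m \<^bold>+ One \<^bold>= Zero)"
  from le_cert2[OF N_nonneg[OF weaken[OF m \<Delta>]] eq_imp_le[OF eq], of Zero One]
  show "\<Delta> \<turnstile> D" by (rule one_le_zero) simp
next
  fix \<Delta> m' t assume \<Delta>: "\<Gamma> \<sqsubseteq> \<Delta>" "\<Delta> \<turnstile> sum_is f m' t" "\<Delta> \<turnstile> (s \<^bold>= t \<^bold>+ ap f (m' \<^bold>+ One))"
    and eq: "\<Delta> \<turnstile> (m \<^bold>+ One \<^bold>= m' \<^bold>+ One)"
  have m': "\<Delta> \<turnstile> (m' \<^bold>= m)" by (rule eq_cert1[OF eq, of _ _ "- 1"]) (simp add: algebra_simps)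
  have "\<Delta> \<turnstile> (ap f (m' \<^bold>+ One) \<^bold>= ap f (m \<^bold>+ One))"
    by (rule eq_env_tm) (use m' in \<open>auto simp: eq_refl eq_add split: nat.split\<close>)
  then show "\<Delta> \<turnstile> D"
    using \<Delta> m' by (intro D[of _ t]) (blast intro: sum_eq eq_refl eq_trans eq_add)+
qed

section \<open>Indices and the algebra of finite sums\<close>

lemma subst_index [simp]: "subst \<sigma> \<tau> (index n t) = index (subst_tm \<sigma> \<tau> n) (subst_tm \<sigma> \<tau> t)"
  by (simp add: index_def)

lemma derivable_index: "(\<Gamma> \<turnstile> index n t) = ((\<Gamma> \<turnstile> N t) \<and> (\<Gamma> \<turnstile> (One \<^bold>\<le> t)) \<and> (\<Gamma> \<turnstile> (t \<^bold>\<le> n)))"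
  by (simp add: index_def derivable_Conj)

lemma index_succ: "\<Gamma> \<turnstile> N m \<Longrightarrow> \<Gamma> \<turnstile> (m \<^bold>+ One \<^bold>\<le> n) \<Longrightarrow> \<Gamma> \<turnstile> index n (m \<^bold>+ One)"
  by (simp add: derivable_index N_succ) (rule le_cert1[OF N_nonneg[of _ m]], auto)

lemma le_succ_le: "\<Gamma> \<turnstile> (m \<^bold>+ One \<^bold>\<le> n) \<Longrightarrow> \<Gamma> \<turnstile> (m \<^bold>\<le> n)"
  by (rule le_cert2[OF _ zero_le_one]) (auto simp: algebra_simps)

lemma ap_eq: "\<Gamma> \<turnstile> (i \<^bold>= j) \<Longrightarrow> \<Gamma> \<turnstile> (ap f i \<^bold>= ap f j)"
  by (rule eq_env_tm) (simp add: eq_refl split: nat.split)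

text \<open>A single linearity statement covers congruence (c = 0), cancellation (c = -1), scaling
  and linear combinations of vectors. The induction carries the bound m \<le> n, because the
  summands are related only at indices up to n.\<close>

lemma sum_linear:
  assumes n: "\<Gamma> \<turnstile> N n"
    and h: "\<And>\<Delta> i. \<Gamma> \<sqsubseteq> \<Delta> \<Longrightarrow> \<Delta> \<turnstile> index n i \<Longrightarrow> \<Delta> \<turnstile> (ap h i \<^bold>= ap g i \<^bold>+ c \<^bold>* ap f i)"
    and g: "\<Gamma> \<turnstile> sum_is g n a" and f: "\<Gamma> \<turnstile> sum_is f n b"
  shows "\<Gamma> \<turnstile> sum_is h n (a \<^bold>+ c \<^bold>* b)"
proof -
  let ?P = "Forall (Forall (Var 2 \<^bold>\<le> Var 3 \<^bold>\<and> sum_is (lift_summand 5 g) (Var 2) (Var 1) \<^bold>\<and>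
    sum_is (lift_summand 5 f) (Var 2) (Var 0) \<^bold>\<rightarrow> sum_is (lift_summand 5 h) (Var 2) (Var 1 \<^bold>+ Var 4 \<^bold>* Var 0)))"
  have P: "(\<Delta> \<turnstile> subst (m \<triangleright> n \<triangleright> c \<triangleright> Var) id ?P) = (\<forall>a b \<Theta>. \<Delta> \<sqsubseteq> \<Theta> \<longrightarrow> (\<Theta> \<turnstile> (m \<^bold>\<le> n)) \<and>
    (\<Theta> \<turnstile> sum_is g m a) \<and> (\<Theta> \<turnstile> sum_is f m b) \<longrightarrow> (\<Theta> \<turnstile> sum_is h m (a \<^bold>+ c \<^bold>* b)))" for \<Delta> m
    by (simp add: forces numeral_eq_Suc)
  have "\<Gamma> \<turnstile> subst (n \<triangleright> n \<triangleright> c \<triangleright> Var) id ?P"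
    using n
  proof (rule N_induct)
    show "\<Gamma> \<turnstile> subst (Zero \<triangleright> n \<triangleright> c \<triangleright> Var) id ?P"
      unfolding P
    proof (intro allI HOL.impI, elim conjE)
      fix a b \<Theta> assume "\<Theta> \<turnstile> sum_is g Zero a" "\<Theta> \<turnstile> sum_is f Zero b"
      then have a: "\<Theta> \<turnstile> (a \<^bold>= Zero)" and b: "\<Theta> \<turnstile> (b \<^bold>= Zero)" by (auto intro: sum_zero_inv)
      have "\<Theta> \<turnstile> (Zero \<^bold>= a \<^bold>+ c \<^bold>* b)"
        by (rule eq_cert2[OF a b, of _ _ "- 1" "- rt c"]) (simp add: algebra_simps)
      then show "\<Theta> \<turnstile> sum_is h Zero (a \<^bold>+ c \<^bold>* b)" by (blast intro: sum_eq sum_zero eq_refl)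
    qed
  next
    fix \<Delta> m assume \<Delta>: "\<Gamma> \<sqsubseteq> \<Delta>" and m: "\<Delta> \<turnstile> N m" and IH: "\<Delta> \<turnstile> subst (m \<triangleright> n \<triangleright> c \<triangleright> Var) id ?P"
    show "\<Delta> \<turnstile> subst (m \<^bold>+ One \<triangleright> n \<triangleright> c \<triangleright> Var) id ?P"
      unfolding P
    proof (intro allI HOL.impI, elim conjE)
      fix a b \<Theta> assume \<Theta>: "\<Delta> \<sqsubseteq> \<Theta>" and le: "\<Theta> \<turnstile> (m \<^bold>+ One \<^bold>\<le> n)"
        and a: "\<Theta> \<turnstile> sum_is g (m \<^bold>+ One) a" and b: "\<Theta> \<turnstile> sum_is f (m \<^bold>+ One) b"
      have m\<Theta>: "\<Theta> \<turnstile> N m" using m \<Theta> weaken by blast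
      from a m\<Theta> show "\<Theta> \<turnstile> sum_is h (m \<^bold>+ One) (a \<^bold>+ c \<^bold>* b)"
      proof (rule sum_succ_inv)
        fix \<Xi> a' assume \<Xi>: "\<Theta> \<sqsubseteq> \<Xi>" and a': "\<Xi> \<turnstile> sum_is g m a'" "\<Xi> \<turnstile> (a \<^bold>= a' \<^bold>+ ap g (m \<^bold>+ One))"
        from weaken[OF b \<Xi>] weaken[OF m\<Theta> \<Xi>] show "\<Xi> \<turnstile> sum_is h (m \<^bold>+ One) (a \<^bold>+ c \<^bold>* b)"
        proof (rule sum_succ_inv)
          fix \<Omega> b' assume \<Omega>: "\<Xi> \<sqsubseteq> \<Omega>" and b': "\<Omega> \<turnstile> sum_is f m b'" "\<Omega> \<turnstile> (b \<^bold>= b' \<^bold>+ ap f (m \<^bold>+ One))"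
          note a'' = a'[THEN weaken, OF \<Omega>]
          have sub: "\<Delta> \<sqsubseteq> \<Omega>" "\<Gamma> \<sqsubseteq> \<Omega>" "\<Theta> \<sqsubseteq> \<Omega>" using \<Delta> \<Theta> \<Xi> \<Omega> by auto
          note le' = weaken[OF le sub(3)]
          have "\<Omega> \<turnstile> sum_is h m (a' \<^bold>+ c \<^bold>* b')"
            using IH sub a''(1) b'(1) le_succ_le[OF le'] unfolding P by blast
          then have "\<Omega> \<turnstile> sum_is h (m \<^bold>+ One) (a' \<^bold>+ c \<^bold>* b' \<^bold>+ ap h (m \<^bold>+ One))"
            by (rule sum_succ)
          moreover have "\<Omega> \<turnstile> (ap h (m \<^bold>+ One) \<^bold>= ap g (m \<^bold>+ One) \<^bold>+ c \<^bold>* ap f (m \<^bold>+ One))"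
            using sub le' by (intro h index_succ weaken[OF m])
          then have "\<Omega> \<turnstile> (a' \<^bold>+ c \<^bold>* b' \<^bold>+ ap h (m \<^bold>+ One) \<^bold>= a \<^bold>+ c \<^bold>* b)"
            by (rule eq_cert3[OF _ a''(2) b'(2), where k=1 and k'="- 1" and k''="- rt c"]) (simp add: algebra_simps)
          ultimately show "\<Omega> \<turnstile> sum_is h (m \<^bold>+ One) (a \<^bold>+ c \<^bold>* b)" by (blast intro: sum_eq eq_refl)
        qed
      qed
    qed
  qed
  moreover have "\<Gamma> \<turnstile> (n \<^bold>\<le> n)" by (rule eq_imp_le[OF eq_refl])
  ultimately show ?thesis using f g unfolding P by blast
qed

lemma sum_cong:
  assumes n: "\<Gamma> \<turnstile> N n"
    and h: "\<And>\<Delta> i. \<Gamma> \<sqsubseteq> \<Delta> \<Longrightarrow> \<Delta> \<turnstile> index n i \<Longrightarrow> \<Delta> \<turnstile> (ap h i \<^bold>= ap g i)"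
    and g: "\<Gamma> \<turnstile> sum_is g n a"
  shows "\<Gamma> \<turnstile> sum_is h n a"
proof -
  have "\<Gamma> \<turnstile> sum_is h n (a \<^bold>+ Zero \<^bold>* a)"
    by (rule sum_linear[OF n _ g g]) (rule eq_cert1[OF h, where k=1], auto)
  then show ?thesis by (rule sum_eq) (auto intro: eq_refl ring_eq)
qed

text \<open>With sums given by a relation, uniqueness is what allows two computations of a value to
  be compared.\<close>

lemma sum_unique:
  assumes n: "\<Gamma> \<turnstile> N n" and a: "\<Gamma> \<turnstile> sum_is f n a" and b: "\<Gamma> \<turnstile> sum_is f n b"
  shows "\<Gamma> \<turnstile> (a \<^bold>= b)"
proof -
  let ?P = "Forall (Forall (sum_is (lift_summand 3 f) (Var 2) (Var 1) \<^bold>\<and> sum_is (lift_summand 3 f) (Var 2) (Var 0) \<^bold>\<rightarrow> Var 1 \<^bold>= Var 0))"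
  have P: "(\<Delta> \<turnstile> subst (m \<triangleright> Var) id ?P) = (\<forall>a b \<Theta>. \<Delta> \<sqsubseteq> \<Theta> \<longrightarrow>
    (\<Theta> \<turnstile> sum_is f m a) \<and> (\<Theta> \<turnstile> sum_is f m b) \<longrightarrow> (\<Theta> \<turnstile> (a \<^bold>= b)))" for \<Delta> m
    by (simp add: forces numeral_eq_Suc)
  have "\<Gamma> \<turnstile> subst (n \<triangleright> Var) id ?P"
    using n
  proof (rule N_induct)
    show "\<Gamma> \<turnstile> subst (Zero \<triangleright> Var) id ?P"
      unfolding P by (blast intro: sum_zero_inv eq_trans eq_sym)
  next
    fix \<Delta> m assume m: "\<Delta> \<turnstile> N m" and IH: "\<Delta> \<turnstile> subst (m \<triangleright> Var) id ?P"
    show "\<Delta> \<turnstile> subst (m \<^bold>+ One \<triangleright> Var) id ?P"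
      unfolding P
    proof (intro allI HOL.impI, elim conjE)
      fix a b \<Theta> assume \<Theta>: "\<Delta> \<sqsubseteq> \<Theta>" 
        and a: "\<Theta> \<turnstile> sum_is f (m \<^bold>+ One) a" and b: "\<Theta> \<turnstile> sum_is f (m \<^bold>+ One) b"
      have m\<Theta>: "\<Theta> \<turnstile> N m" using m \<Theta> weaken by blast
      from a m\<Theta> show "\<Theta> \<turnstile> (a \<^bold>= b)"
      proof (rule sum_succ_inv)
        fix \<Xi> a' assume \<Xi>: "\<Theta> \<sqsubseteq> \<Xi>" and a': "\<Xi> \<turnstile> sum_is f m a'" "\<Xi> \<turnstile> (a \<^bold>= a' \<^bold>+ ap f (m \<^bold>+ One))"
        from weaken[OF b \<Xi>] weaken[OF m\<Theta> \<Xi>] show "\<Xi> \<turnstile> (a \<^bold>= b)"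
        proof (rule sum_succ_inv)
          fix \<Omega> b' assume \<Omega>: "\<Xi> \<sqsubseteq> \<Omega>" and b': "\<Omega> \<turnstile> sum_is f m b'" "\<Omega> \<turnstile> (b \<^bold>= b' \<^bold>+ ap f (m \<^bold>+ One))"
          note a'' = a'[THEN weaken, OF \<Omega>]
          have sub: "\<Delta> \<sqsubseteq> \<Omega>" using \<Theta> \<Xi> \<Omega> by auto
          have "\<Omega> \<turnstile> (a' \<^bold>= b')" using IH sub a''(1) b'(1) unfolding P by blast
          then show "\<Omega> \<turnstile> (a \<^bold>= b)"
            by (rule eq_cert3[OF _ a''(2) b'(2), where k=1 and k'=1 and k''="- 1"]) (simp add: algebra_simps)
        qed
      qed
    qed
  qed
  then show ?thesis using a b unfolding P by blast
qed

text \<open>Closure of the field under addition gives the existence of the sum and its membership in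
  \<open>F\<close> together, by induction on the number of summands.\<close>

lemma sum_exists:
  assumes F: "\<Gamma> \<turnstile> constructive_field F" and n: "\<Gamma> \<turnstile> N n"
    and f: "\<And>\<Delta> i. \<Gamma> \<sqsubseteq> \<Delta> \<Longrightarrow> \<Delta> \<turnstile> index n i \<Longrightarrow> \<Delta> \<turnstile> PVar F [ap f i]"
    and D: "\<And>\<Delta> s. \<Gamma> \<sqsubseteq> \<Delta> \<Longrightarrow> \<Delta> \<turnstile> PVar F [s] \<Longrightarrow> \<Delta> \<turnstile> sum_is f n s \<Longrightarrow> \<Delta> \<turnstile> D"
  shows "\<Gamma> \<turnstile> D"
proof -
  let ?P = "Var 0 \<^bold>\<le> Var 1 \<^bold>\<rightarrow> Exists (PVar F [Var 0] \<^bold>\<and> sum_is (lift_summand 3 f) (Var 1) (Var 0))"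
  have "\<Gamma> \<turnstile> subst (n \<triangleright> n \<triangleright> Var) id ?P"
    using n
  proof (rule N_induct)
    have "\<Delta> \<turnstile> subst (Zero \<triangleright> n \<triangleright> Var) id (Exists (PVar F [Var 0] \<^bold>\<and> sum_is (lift_summand 3 f) (Var 1) (Var 0)))"
      if "\<Gamma> \<sqsubseteq> \<Delta>" for \<Delta>
      using that by (intro Exists_intro[of _ Zero])
        (simp add: forces numeral_eq_Suc sum_zero field_zero[OF weaken[OF F]])
    then show "\<Gamma> \<turnstile> subst (Zero \<triangleright> n \<triangleright> Var) id ?P" by (simp add: forces)
  next
    fix \<Delta> m assume \<Delta>: "\<Gamma> \<sqsubseteq> \<Delta>" and m: "\<Delta> \<turnstile> N m" and IH: "\<Delta> \<turnstile> subst (m \<triangleright> n \<triangleright> Var) id ?P"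
    have "\<Theta> \<turnstile> subst (m \<^bold>+ One \<triangleright> n \<triangleright> Var) id (Exists (PVar F [Var 0] \<^bold>\<and> sum_is (lift_summand 3 f) (Var 1) (Var 0)))"
      if \<Theta>: "\<Delta> \<sqsubseteq> \<Theta>" and le: "\<Theta> \<turnstile> (m \<^bold>+ One \<^bold>\<le> n)" for \<Theta>
    proof -
      have "\<Theta> \<turnstile> subst (m \<triangleright> n \<triangleright> Var) id (Exists (PVar F [Var 0] \<^bold>\<and> sum_is (lift_summand 3 f) (Var 1) (Var 0)))"
        using IH \<Theta> le_succ_le[OF le] by (simp add: forces)
      then show ?thesis
      proof (rule Exists_elim)
        fix \<Xi> s assume \<Xi>: "\<Theta> \<sqsubseteq> \<Xi>"
          and "\<Xi> \<turnstile> subst (s \<triangleright> m \<triangleright> n \<triangleright> Var) id (PVar F [Var 0] \<^bold>\<and> sum_is (lift_summand 3 f) (Var 1) (Var 0))"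
        then have s: "\<Xi> \<turnstile> PVar F [s]" "\<Xi> \<turnstile> sum_is f m s"
          by (simp_all add: forces numeral_eq_Suc)
        have sub: "\<Delta> \<sqsubseteq> \<Xi>" "\<Gamma> \<sqsubseteq> \<Xi>" using \<Delta> \<Theta> \<Xi> by auto
        have "\<Xi> \<turnstile> PVar F [ap f (m \<^bold>+ One)]"
          using sub m le \<Xi> by (intro f index_succ) (auto intro: weaken)
        with s F sub have "\<Xi> \<turnstile> PVar F [s \<^bold>+ ap f (m \<^bold>+ One)]" by (blast intro: field_add weaken)
        with sum_succ[OF s(2)] show "\<Xi> \<turnstile> subst (m \<^bold>+ One \<triangleright> n \<triangleright> Var) id
            (Exists (PVar F [Var 0] \<^bold>\<and> sum_is (lift_summand 3 f) (Var 1) (Var 0)))"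
          by (intro Exists_intro[of _ "s \<^bold>+ ap f (m \<^bold>+ One)"]) (simp add: forces numeral_eq_Suc)
      qed
    qed
    then show "\<Delta> \<turnstile> subst (m \<^bold>+ One \<triangleright> n \<triangleright> Var) id ?P" by (simp add: forces)
  qed
  then have "\<Gamma> \<turnstile> subst (n \<triangleright> n \<triangleright> Var) id (Exists (PVar F [Var 0] \<^bold>\<and> sum_is (lift_summand 3 f) (Var 1) (Var 0)))"
    using eq_imp_le[OF eq_refl] by (simp add: forces)
  then show ?thesis
    by (rule Exists_elim) (auto simp: forces numeral_eq_Suc intro: D)
qed

text \<open>The partial sum up to m is 0 while m < j, written m + 1 \<le> j, and equals f(j) once j
  \<le> m. Both phases are carried through one induction; the change of phase is decidable because j
  and m are natural numbers.\<close>

lemma sum_single: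
  assumes n: "\<Gamma> \<turnstile> N n" and j: "\<Gamma> \<turnstile> index n j"
    and f: "\<And>\<Delta> i. \<Gamma> \<sqsubseteq> \<Delta> \<Longrightarrow> \<Delta> \<turnstile> index n i \<Longrightarrow> \<Delta> \<turnstile> (\<^bold>\<not> i \<^bold>= j) \<Longrightarrow> \<Delta> \<turnstile> (ap f i \<^bold>= Zero)"
    and s: "\<Gamma> \<turnstile> sum_is f n s"
  shows "\<Gamma> \<turnstile> (s \<^bold>= ap f j)"
proof -
  let ?P = "Forall (Var 1 \<^bold>\<le> Var 2 \<^bold>\<and> sum_is (lift_summand 4 f) (Var 1) (Var 0) \<^bold>\<rightarrow>
    (Var 1 \<^bold>+ One \<^bold>\<le> Var 3 \<^bold>\<rightarrow> Var 0 \<^bold>= Zero) \<^bold>\<and>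
    (Var 3 \<^bold>\<le> Var 1 \<^bold>\<rightarrow> Var 0 \<^bold>= subst_tm (Var 3 \<triangleright> (\<lambda>i. Var (i + 4))) id f))"
  have P: "(\<Delta> \<turnstile> subst (m \<triangleright> n \<triangleright> j \<triangleright> Var) id ?P) = (\<forall>a \<Theta>. \<Delta> \<sqsubseteq> \<Theta> \<longrightarrow> (\<Theta> \<turnstile> (m \<^bold>\<le> n)) \<and>
    (\<Theta> \<turnstile> sum_is f m a) \<longrightarrow> (\<Theta> \<turnstile> (m \<^bold>+ One \<^bold>\<le> j \<^bold>\<rightarrow> a \<^bold>= Zero)) \<and> (\<Theta> \<turnstile> (j \<^bold>\<le> m \<^bold>\<rightarrow> a \<^bold>= ap f j)))" for \<Delta> m
    by (simp add: derivable_subst_Forall derivable_Conj derivable_Imp subst_tm_subst_tm numeral_eq_Suc)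
  have "\<Gamma> \<turnstile> subst (n \<triangleright> n \<triangleright> j \<triangleright> Var) id ?P"
    using n
  proof (rule N_induct)
    show "\<Gamma> \<turnstile> subst (Zero \<triangleright> n \<triangleright> j \<triangleright> Var) id ?P"
      unfolding P
    proof (intro allI HOL.impI, elim conjE)
      fix a \<Theta> assume \<Theta>: "\<Gamma> \<sqsubseteq> \<Theta>" "\<Theta> \<turnstile> sum_is f Zero a"
      then have "\<Theta> \<turnstile> (Zero \<^bold>+ One \<^bold>\<le> j \<^bold>\<rightarrow> a \<^bold>= Zero)"
        unfolding derivable_Imp by (blast intro: sum_zero_inv weaken)
      moreover have "\<Theta> \<turnstile> (j \<^bold>\<le> Zero \<^bold>\<rightarrow> a \<^bold>= ap f j)"
        unfolding derivable_Imp
      proof (intro allI HOL.impI)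
        fix \<Xi> assume \<Xi>: "\<Theta> \<sqsubseteq> \<Xi>" "\<Xi> \<turnstile> (j \<^bold>\<le> Zero)"
        have "\<Xi> \<turnstile> (One \<^bold>\<le> j)" using j weaken \<Theta>(1) \<Xi>(1) unfolding derivable_index by blast
        from le_transD[OF this \<Xi>(2)] show "\<Xi> \<turnstile> (a \<^bold>= ap f j)" by (rule one_le_zero)
      qed
      ultimately show "(\<Theta> \<turnstile> (Zero \<^bold>+ One \<^bold>\<le> j \<^bold>\<rightarrow> a \<^bold>= Zero)) \<and> (\<Theta> \<turnstile> (j \<^bold>\<le> Zero \<^bold>\<rightarrow> a \<^bold>= ap f j))" ..
    qed
  next
    fix \<Delta> m assume \<Delta>: "\<Gamma> \<sqsubseteq> \<Delta>" and m: "\<Delta> \<turnstile> N m" and IH: "\<Delta> \<turnstile> subst (m \<triangleright> n \<triangleright> j \<triangleright> Var) id ?P"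
    \<comment> \<open>Peels off the summand m + 1, leaving a' + f(m + 1) to be evaluated from the
      two phases at m.\<close>
    have step: "\<Omega> \<turnstile> (a \<^bold>= r)" if \<Omega>: "\<Delta> \<sqsubseteq> \<Omega>" and le: "\<Omega> \<turnstile> (m \<^bold>+ One \<^bold>\<le> n)"
      and a: "\<Omega> \<turnstile> sum_is f (m \<^bold>+ One) a"
      and r: "\<And>\<Xi> a'. \<Omega> \<sqsubseteq> \<Xi> \<Longrightarrow> \<Xi> \<turnstile> (m \<^bold>+ One \<^bold>\<le> j \<^bold>\<rightarrow> a' \<^bold>= Zero) \<Longrightarrow>
        \<Xi> \<turnstile> (j \<^bold>\<le> m \<^bold>\<rightarrow> a' \<^bold>= ap f j) \<Longrightarrow> \<Xi> \<turnstile> (a' \<^bold>+ ap f (m \<^bold>+ One) \<^bold>= r)" for \<Omega> a r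
      using a weaken[OF m \<Omega>]
    proof (rule sum_succ_inv)
      fix \<Xi> a' assume \<Xi>: "\<Omega> \<sqsubseteq> \<Xi>" and a': "\<Xi> \<turnstile> sum_is f m a'" "\<Xi> \<turnstile> (a \<^bold>= a' \<^bold>+ ap f (m \<^bold>+ One))"
      have "(\<Xi> \<turnstile> (m \<^bold>+ One \<^bold>\<le> j \<^bold>\<rightarrow> a' \<^bold>= Zero)) \<and> (\<Xi> \<turnstile> (j \<^bold>\<le> m \<^bold>\<rightarrow> a' \<^bold>= ap f j))"
        using IH a'(1) le_succ_le[OF weaken[OF le \<Xi>]] \<Omega> \<Xi> unfolding P by blast
      then have "\<Xi> \<turnstile> (a' \<^bold>+ ap f (m \<^bold>+ One) \<^bold>= r)" using r \<Xi> by blast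
      with a'(2) show "\<Xi> \<turnstile> (a \<^bold>= r)" by (rule eq_trans)
    qed
    show "\<Delta> \<turnstile> subst (m \<^bold>+ One \<triangleright> n \<triangleright> j \<triangleright> Var) id ?P"
      unfolding P
    proof (intro allI HOL.impI, elim conjE)
      fix a \<Theta> assume \<Theta>: "\<Delta> \<sqsubseteq> \<Theta>" "\<Theta> \<turnstile> (m \<^bold>+ One \<^bold>\<le> n)" "\<Theta> \<turnstile> sum_is f (m \<^bold>+ One) a"
      have idx: "\<Theta> \<turnstile> index n (m \<^bold>+ One)" by (rule index_succ[OF weaken[OF m \<Theta>(1)] \<Theta>(2)])
      have "\<Theta> \<turnstile> ((m \<^bold>+ One) \<^bold>+ One \<^bold>\<le> j \<^bold>\<rightarrow> a \<^bold>= Zero)"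
        unfolding derivable_Imp
      proof (intro allI HOL.impI)
        fix \<Omega> assume \<Omega>: "\<Theta> \<sqsubseteq> \<Omega>" "\<Omega> \<turnstile> ((m \<^bold>+ One) \<^bold>+ One \<^bold>\<le> j)"
        have "\<Delta> \<sqsubseteq> \<Omega>" using \<Theta> \<Omega> by auto
        from this weaken[OF \<Theta>(2) \<Omega>(1)] weaken[OF \<Theta>(3) \<Omega>(1)] show "\<Omega> \<turnstile> (a \<^bold>= Zero)"
        proof (rule step)
          fix \<Xi> a' assume \<Xi>: "\<Omega> \<sqsubseteq> \<Xi>" and a': "\<Xi> \<turnstile> (m \<^bold>+ One \<^bold>\<le> j \<^bold>\<rightarrow> a' \<^bold>= Zero)"
          have j: "\<Xi> \<turnstile> ((m \<^bold>+ One) \<^bold>+ One \<^bold>\<le> j)" by (rule weaken[OF \<Omega>(2) \<Xi>])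
          have f0: "\<Xi> \<turnstile> (ap f (m \<^bold>+ One) \<^bold>= Zero)"
            using \<Delta> \<Theta>(1) \<Omega>(1) \<Xi> j by (intro f neq_of_less weaken[OF idx]) auto
          show "\<Xi> \<turnstile> (a' \<^bold>+ ap f (m \<^bold>+ One) \<^bold>= Zero)"
            by (rule eq_cert2[OF impE[OF a' le_succ_le[OF j]] f0, where k=1 and k'=1]) (simp add: algebra_simps)
        qed
      qed
      moreover have "\<Theta> \<turnstile> (j \<^bold>\<le> m \<^bold>+ One \<^bold>\<rightarrow> a \<^bold>= ap f j)"
        unfolding derivable_Imp
      proof (intro allI HOL.impI)
        fix \<Omega> assume \<Omega>: "\<Theta> \<sqsubseteq> \<Omega>" "\<Omega> \<turnstile> (j \<^bold>\<le> m \<^bold>+ One)"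
        have "\<Delta> \<sqsubseteq> \<Omega>" using \<Theta> \<Omega> by auto
        from this weaken[OF \<Theta>(2) \<Omega>(1)] weaken[OF \<Theta>(3) \<Omega>(1)] show "\<Omega> \<turnstile> (a \<^bold>= ap f j)"
        proof (rule step)
          fix \<Xi> a' assume \<Xi>: "\<Omega> \<sqsubseteq> \<Xi>" and a': "\<Xi> \<turnstile> (m \<^bold>+ One \<^bold>\<le> j \<^bold>\<rightarrow> a' \<^bold>= Zero)"
            "\<Xi> \<turnstile> (j \<^bold>\<le> m \<^bold>\<rightarrow> a' \<^bold>= ap f j)"
          have sub: "\<Gamma> \<sqsubseteq> \<Xi>" "\<Delta> \<sqsubseteq> \<Xi>" "\<Theta> \<sqsubseteq> \<Xi>" using \<Delta> \<Theta>(1) \<Omega>(1) \<Xi> by auto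
          have "\<Xi> \<turnstile> N j" using j weaken sub unfolding derivable_index by blast
          from this weaken[OF m sub(2)] show "\<Xi> \<turnstile> (a' \<^bold>+ ap f (m \<^bold>+ One) \<^bold>= ap f j)"
          proof (rule N_le_cases)
            fix \<Psi> assume \<Psi>: "\<Xi> \<sqsubseteq> \<Psi>" and le: "\<Psi> \<turnstile> (j \<^bold>\<le> m)"
            have "\<Psi> \<turnstile> (j \<^bold>+ One \<^bold>\<le> m \<^bold>+ One)" by (rule le_cert1[OF le]) simp
            then have "\<Psi> \<turnstile> (\<^bold>\<not> m \<^bold>+ One \<^bold>= j)" by (rule neq_sym[OF neq_of_less])
            moreover have "\<Psi> \<turnstile> index n (m \<^bold>+ One)" using sub \<Psi> weaken[OF idx] by blast
            ultimately have f0: "\<Psi> \<turnstile> (ap f (m \<^bold>+ One) \<^bold>= Zero)"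
              using sub \<Psi> by (intro f) auto
            show "\<Psi> \<turnstile> (a' \<^bold>+ ap f (m \<^bold>+ One) \<^bold>= ap f j)"
              by (rule eq_cert2[OF impE[OF weaken[OF a'(2) \<Psi>] le] f0, where k=1 and k'=1])
                (simp add: algebra_simps)
          next
            fix \<Psi> assume \<Psi>: "\<Xi> \<sqsubseteq> \<Psi>" and le: "\<Psi> \<turnstile> (m \<^bold>+ One \<^bold>\<le> j)"
            have "\<Omega> \<sqsubseteq> \<Psi>" using \<Xi> \<Psi> by auto
            have "\<Psi> \<turnstile> (m \<^bold>+ One \<^bold>= j)" by (rule le_antisymD[OF le weaken[OF \<Omega>(2) \<open>\<Omega> \<sqsubseteq> \<Psi>\<close>]])
            then have "\<Psi> \<turnstile> (ap f (m \<^bold>+ One) \<^bold>= ap f j)" by (rule ap_eq)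
            then show "\<Psi> \<turnstile> (a' \<^bold>+ ap f (m \<^bold>+ One) \<^bold>= ap f j)"
              by (rule eq_cert2[OF impE[OF weaken[OF a'(1) \<Psi>] le], where k=1 and k'=1])
                (simp add: algebra_simps)
          qed
        qed
      qed
      ultimately show "(\<Theta> \<turnstile> ((m \<^bold>+ One) \<^bold>+ One \<^bold>\<le> j \<^bold>\<rightarrow> a \<^bold>= Zero)) \<and>
        (\<Theta> \<turnstile> (j \<^bold>\<le> m \<^bold>+ One \<^bold>\<rightarrow> a \<^bold>= ap f j))" ..
    qed
  qed
  then have "\<Gamma> \<turnstile> (j \<^bold>\<le> n \<^bold>\<rightarrow> s \<^bold>= ap f j)"
    using s eq_imp_le[OF eq_refl] unfolding P by blast
  then show ?thesis using j unfolding derivable_index by (blast intro: impE)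
qed

text \<open>Non-negativity of the partial sums belongs to the induction: when i is the last index,
  it is what remains after removing f(i).\<close>

lemma sum_nonneg_term_le:
  assumes n: "\<Gamma> \<turnstile> N n"
    and f: "\<And>\<Delta> i. \<Gamma> \<sqsubseteq> \<Delta> \<Longrightarrow> \<Delta> \<turnstile> (Zero \<^bold>\<le> ap f i)"
    and s: "\<Gamma> \<turnstile> sum_is f n s" and i: "\<Gamma> \<turnstile> index n i"
  shows "\<Gamma> \<turnstile> (ap f i \<^bold>\<le> s)"
proof -
  let ?P = "Forall (sum_is (lift_summand 2 f) (Var 1) (Var 0) \<^bold>\<rightarrow>
    Zero \<^bold>\<le> Var 0 \<^bold>\<and> Forall (index (Var 2) (Var 0) \<^bold>\<rightarrow> subst_tm (Var 0 \<triangleright> (\<lambda>i. Var (i + 3))) id f \<^bold>\<le> Var 1))"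
  have P: "(\<Delta> \<turnstile> subst (m \<triangleright> Var) id ?P) = (\<forall>a \<Theta>. \<Delta> \<sqsubseteq> \<Theta> \<longrightarrow> (\<Theta> \<turnstile> sum_is f m a) \<longrightarrow>
    (\<Theta> \<turnstile> (Zero \<^bold>\<le> a)) \<and> (\<forall>i \<Xi>. \<Theta> \<sqsubseteq> \<Xi> \<longrightarrow> (\<Xi> \<turnstile> index m i) \<longrightarrow> (\<Xi> \<turnstile> (ap f i \<^bold>\<le> a))))" for \<Delta> m
    by (simp add: forces subst_tm_subst_tm numeral_eq_Suc)
  have "\<Gamma> \<turnstile> subst (n \<triangleright> Var) id ?P"
    using n
  proof (rule N_induct)
    show "\<Gamma> \<turnstile> subst (Zero \<triangleright> Var) id ?P"
      unfolding P derivable_index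
      by (blast intro: sum_zero_inv eq_imp_le eq_sym one_le_zero[OF le_transD])
  next
    fix \<Delta> m assume \<Delta>: "\<Gamma> \<sqsubseteq> \<Delta>" and m: "\<Delta> \<turnstile> N m" and IH: "\<Delta> \<turnstile> subst (m \<triangleright> Var) id ?P"
    have "(\<Theta> \<turnstile> (Zero \<^bold>\<le> a))" "\<And>i \<Xi>. \<Theta> \<sqsubseteq> \<Xi> \<Longrightarrow> \<Xi> \<turnstile> index (m \<^bold>+ One) i \<Longrightarrow> \<Xi> \<turnstile> (ap f i \<^bold>\<le> a)"
      if \<Theta>: "\<Delta> \<sqsubseteq> \<Theta>" and a: "\<Theta> \<turnstile> sum_is f (m \<^bold>+ One) a" for \<Theta> a
    proof -
      have sub: "\<Gamma> \<sqsubseteq> \<Theta>" using \<Delta> \<Theta> by auto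
      show "\<Theta> \<turnstile> (Zero \<^bold>\<le> a)"
        using a weaken[OF m \<Theta>]
      proof (rule sum_succ_inv)
        fix \<Xi> a' assume \<Xi>: "\<Theta> \<sqsubseteq> \<Xi>" and a': "\<Xi> \<turnstile> sum_is f m a'" "\<Xi> \<turnstile> (a \<^bold>= a' \<^bold>+ ap f (m \<^bold>+ One))"
        have 1: "\<Xi> \<turnstile> (Zero \<^bold>\<le> a')" using IH a'(1) \<Theta> \<Xi> unfolding P by blast
        have 2: "\<Xi> \<turnstile> (Zero \<^bold>\<le> ap f (m \<^bold>+ One))" using sub \<Xi> by (intro f) auto
        show "\<Xi> \<turnstile> (Zero \<^bold>\<le> a)"
          by (rule le_cert3[OF 1 2 eq_imp_le[OF eq_sym[OF a'(2)]]]) (simp add: algebra_simps)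
      qed
      fix i \<Psi> assume \<Psi>: "\<Theta> \<sqsubseteq> \<Psi>" and i: "\<Psi> \<turnstile> index (m \<^bold>+ One) i"
      have sub': "\<Delta> \<sqsubseteq> \<Psi>" "\<Gamma> \<sqsubseteq> \<Psi>" using sub \<Theta> \<Psi> by auto
      show "\<Psi> \<turnstile> (ap f i \<^bold>\<le> a)"
        using weaken[OF a \<Psi>] weaken[OF m sub'(1)]
      proof (rule sum_succ_inv)
        fix \<Xi> a' assume \<Xi>: "\<Psi> \<sqsubseteq> \<Xi>" and a': "\<Xi> \<turnstile> sum_is f m a'" "\<Xi> \<turnstile> (a \<^bold>= a' \<^bold>+ ap f (m \<^bold>+ One))"
        have \<Delta>\<Xi>: "\<Delta> \<sqsubseteq> \<Xi>" using sub' \<Xi> by auto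
        have i': "\<Xi> \<turnstile> N i" "\<Xi> \<turnstile> (One \<^bold>\<le> i)" "\<Xi> \<turnstile> (i \<^bold>\<le> m \<^bold>+ One)"
          using weaken[OF i \<Xi>] by (simp_all add: derivable_index)
        from i'(1) weaken[OF m \<Delta>\<Xi>] show "\<Xi> \<turnstile> (ap f i \<^bold>\<le> a)"
        proof (rule N_le_cases)
          fix \<Omega> assume \<Omega>: "\<Xi> \<sqsubseteq> \<Omega>" and le: "\<Omega> \<turnstile> (i \<^bold>\<le> m)"
          have "\<Omega> \<turnstile> index m i" using le i' weaken \<Omega> by (simp add: derivable_index)
          then have 1: "\<Omega> \<turnstile> (ap f i \<^bold>\<le> a')" using IH weaken[OF a'(1) \<Omega>] \<Delta>\<Xi> \<Omega> unfolding P by blast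
          have 2: "\<Omega> \<turnstile> (Zero \<^bold>\<le> ap f (m \<^bold>+ One))" using sub' \<Xi> \<Omega> by (intro f) auto
          show "\<Omega> \<turnstile> (ap f i \<^bold>\<le> a)"
            by (rule le_cert3[OF 1 2 eq_imp_le[OF eq_sym[OF weaken[OF a'(2) \<Omega>]]]]) (simp add: algebra_simps)
        next
          fix \<Omega> assume \<Omega>: "\<Xi> \<sqsubseteq> \<Omega>" and le: "\<Omega> \<turnstile> (m \<^bold>+ One \<^bold>\<le> i)"
          have "\<Omega> \<turnstile> (i \<^bold>= m \<^bold>+ One)" by (rule le_antisymD[OF weaken[OF i'(3) \<Omega>] le])
          then have 1: "\<Omega> \<turnstile> (ap f i \<^bold>= ap f (m \<^bold>+ One))" by (rule ap_eq)
          have 2: "\<Omega> \<turnstile> (Zero \<^bold>\<le> a')" using IH weaken[OF a'(1) \<Omega>] \<Delta>\<Xi> \<Omega> unfolding P by blast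
          show "\<Omega> \<turnstile> (ap f i \<^bold>\<le> a)"
            by (rule le_cert3[OF eq_imp_le[OF 1] 2 eq_imp_le[OF eq_sym[OF weaken[OF a'(2) \<Omega>]]]])
              (simp add: algebra_simps)
        qed
      qed
    qed
    then show "\<Delta> \<turnstile> subst (m \<^bold>+ One \<triangleright> Var) id ?P" unfolding P by blast
  qed
  then show ?thesis using s i unfolding P by blast
qed

section \<open>Finite choice\<close>

text \<open>Line \<open>s\<close> is a row for true \<open>c\<close> and a column otherwise. One
  choice principle then serves both for vectors, which are first columns, and for the rows of the
  inverse.\<close>

definition line_entry :: "bool \<Rightarrow> nat \<Rightarrow> tm \<Rightarrow> tm \<Rightarrow> tm"
  where "line_entry c b s t = (if c then Entry b s t else Entry b t s)"

lemma subst_tm_line_entry [simp]: "subst_tm \<sigma> \<tau> (line_entry c b s t) = line_entry c (\<tau> b) (subst_tm \<sigma> \<tau> s) (subst_tm \<sigma> \<tau> t)"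
  by (simp add: line_entry_def)

lemma eq_line_entry: "\<Gamma> \<turnstile> (s \<^bold>= s') \<Longrightarrow> \<Gamma> \<turnstile> (t \<^bold>= t') \<Longrightarrow> \<Gamma> \<turnstile> (line_entry c b s t \<^bold>= line_entry c b s' t')"
  by (simp add: line_entry_def eq_Entry)

lemma update_Entry:
  assumes "\<And>\<Delta> b. \<Gamma> \<sqsubseteq> \<Delta> \<Longrightarrow> \<Delta> \<turnstile> (Entry b s t \<^bold>= r) \<Longrightarrow>
    (\<And>\<Theta> x y. \<Delta> \<sqsubseteq> \<Theta> \<Longrightarrow> \<Theta> \<turnstile> (\<^bold>\<not> (x \<^bold>= s \<^bold>\<and> y \<^bold>= t)) \<Longrightarrow> \<Theta> \<turnstile> (Entry b x y \<^bold>= Entry a x y)) \<Longrightarrow> \<Delta> \<turnstile> D"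
  shows "\<Gamma> \<turnstile> D"
proof (rule existsM_elim[OF ax[OF update_ex[of s t r a]]])
  fix \<Delta> b
  let ?A = "(Entry 0 (liftM_tm s) (liftM_tm t) \<^bold>= liftM_tm r \<^bold>\<and>
     Forall (Forall (\<^bold>\<not> (Var 1 \<^bold>= lift_tm 2 (liftM_tm s) \<^bold>\<and> Var 0 \<^bold>= lift_tm 2 (liftM_tm t)) \<^bold>\<rightarrow>
       Entry 0 (Var 1) (Var 0) \<^bold>= Entry (Suc a) (Var 1) (Var 0))))"
  assume \<Delta>: "\<Gamma> \<sqsubseteq> \<Delta>" and A: "\<Delta> \<turnstile> subst Var (b \<triangleright> id) ?A"
  then have "\<Delta> \<turnstile> (Entry b s t \<^bold>= r)"
    by (simp add: derivable_Conj subst_tm_liftM_tm)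
  moreover have "\<Theta> \<turnstile> (Entry b x y \<^bold>= Entry a x y)"
    if "\<Delta> \<sqsubseteq> \<Theta>" "\<Theta> \<turnstile> (\<^bold>\<not> (x \<^bold>= s \<^bold>\<and> y \<^bold>= t))" for \<Theta> x y
  proof -
    have "\<Delta> \<turnstile> (\<^bold>\<not> (x \<^bold>= s \<^bold>\<and> y \<^bold>= t) \<^bold>\<rightarrow> Entry b x y \<^bold>= Entry a x y)"
      using A by (simp add: derivable_Conj derivable_subst_Forall subst_tm_lift_tm subst_tm_liftM_tm)
    with that show ?thesis by (blast intro: impE weaken)
  qed
  ultimately show "\<Delta> \<turnstile> D" using \<Delta> assms by blast
qed

text \<open>The frame condition is offered as soon as one coordinate is known to differ. Other lines
  qualify by their number, other entries of the same line by their position.\<close>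

lemma update_line_entry:
  assumes "\<And>\<Delta> b. \<Gamma> \<sqsubseteq> \<Delta> \<Longrightarrow> \<Delta> \<turnstile> (line_entry c b s t \<^bold>= r) \<Longrightarrow>
    (\<And>\<Theta> x y. \<Delta> \<sqsubseteq> \<Theta> \<Longrightarrow> (\<Theta> \<turnstile> (\<^bold>\<not> x \<^bold>= s)) \<or> (\<Theta> \<turnstile> (\<^bold>\<not> y \<^bold>= t)) \<Longrightarrow> \<Theta> \<turnstile> (line_entry c b x y \<^bold>= line_entry c a x y)) \<Longrightarrow> \<Delta> \<turnstile> D"
  shows "\<Gamma> \<turnstile> D"
proof (cases c)
  case True
  show ?thesis
  proof (rule update_Entry)
    fix \<Delta> b assume *: "\<Gamma> \<sqsubseteq> \<Delta>" "\<Delta> \<turnstile> (Entry b s t \<^bold>= r)"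
      "\<And>\<Theta> x y. \<Delta> \<sqsubseteq> \<Theta> \<Longrightarrow> \<Theta> \<turnstile> (\<^bold>\<not> (x \<^bold>= s \<^bold>\<and> y \<^bold>= t)) \<Longrightarrow> \<Theta> \<turnstile> (Entry b x y \<^bold>= Entry a x y)"
    have "\<Theta> \<turnstile> (\<^bold>\<not> (x \<^bold>= s \<^bold>\<and> y \<^bold>= t))" if "(\<Theta> \<turnstile> (\<^bold>\<not> x \<^bold>= s)) \<or> (\<Theta> \<turnstile> (\<^bold>\<not> y \<^bold>= t))" for \<Theta> x y
      using that unfolding derivable_Imp derivable_Conj by blast
    with * True show "\<Delta> \<turnstile> D" by (intro assms) (auto simp: line_entry_def)
  qed
next
  case False
  show ?thesis
  proof (rule update_Entry)
    fix \<Delta> b assume *: "\<Gamma> \<sqsubseteq> \<Delta>" "\<Delta> \<turnstile> (Entry b t s \<^bold>= r)"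
      "\<And>\<Theta> x y. \<Delta> \<sqsubseteq> \<Theta> \<Longrightarrow> \<Theta> \<turnstile> (\<^bold>\<not> (x \<^bold>= t \<^bold>\<and> y \<^bold>= s)) \<Longrightarrow> \<Theta> \<turnstile> (Entry b x y \<^bold>= Entry a x y)"
    have "\<Theta> \<turnstile> (\<^bold>\<not> (y \<^bold>= t \<^bold>\<and> x \<^bold>= s))" if "(\<Theta> \<turnstile> (\<^bold>\<not> x \<^bold>= s)) \<or> (\<Theta> \<turnstile> (\<^bold>\<not> y \<^bold>= t))" for \<Theta> x y
      using that unfolding derivable_Imp derivable_Conj by blast
    with * False show "\<Delta> \<turnstile> D" by (intro assms) (auto simp: line_entry_def)
  qed
qed

lemma N_eq_cases:
  assumes a: "\<Gamma> \<turnstile> N a" and b: "\<Gamma> \<turnstile> N b"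
    and 1: "\<And>\<Delta>. \<Gamma> \<sqsubseteq> \<Delta> \<Longrightarrow> \<Delta> \<turnstile> (a \<^bold>= b) \<Longrightarrow> \<Delta> \<turnstile> D"
    and 2: "\<And>\<Delta>. \<Gamma> \<sqsubseteq> \<Delta> \<Longrightarrow> \<Delta> \<turnstile> (\<^bold>\<not> a \<^bold>= b) \<Longrightarrow> \<Delta> \<turnstile> D"
  shows "\<Gamma> \<turnstile> D"
  using a b
proof (rule N_le_cases)
  fix \<Delta> assume \<Delta>: "\<Gamma> \<sqsubseteq> \<Delta>" "\<Delta> \<turnstile> (a \<^bold>\<le> b)"
  from weaken[OF b \<Delta>(1)] weaken[OF a \<Delta>(1)] show "\<Delta> \<turnstile> D"
  proof (rule N_le_cases)
    fix \<Theta> assume \<Theta>: "\<Delta> \<sqsubseteq> \<Theta>" "\<Theta> \<turnstile> (b \<^bold>\<le> a)"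
    from \<Delta>(1) \<Theta>(1) le_antisymD[OF weaken[OF \<Delta>(2) \<Theta>(1)] \<Theta>(2)] show "\<Theta> \<turnstile> D" by (intro 1) auto
  next
    fix \<Theta> assume "\<Delta> \<sqsubseteq> \<Theta>" "\<Theta> \<turnstile> (a \<^bold>+ One \<^bold>\<le> b)"
    then show "\<Theta> \<turnstile> D" using \<Delta>(1) by (intro 2 neq_of_less) auto
  qed
next
  fix \<Delta> assume \<Delta>: "\<Gamma> \<sqsubseteq> \<Delta>" "\<Delta> \<turnstile> (b \<^bold>+ One \<^bold>\<le> a)"
  show "\<Delta> \<turnstile> D" by (rule 2[OF \<Delta>(1) neq_sym[OF neq_of_less[OF \<Delta>(2)]]])
qed

lemma index_neq: "\<Gamma> \<turnstile> index m i \<Longrightarrow> \<Gamma> \<turnstile> (\<^bold>\<not> i \<^bold>= m \<^bold>+ One)"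
  unfolding derivable_index by (rule neq_of_less, rule le_cert1[of _ i m]) (auto simp: algebra_simps)

lemma index_succ_cases:
  assumes i: "\<Gamma> \<turnstile> index (m \<^bold>+ One) i" and m: "\<Gamma> \<turnstile> N m"
    and "\<And>\<Delta>. \<Gamma> \<sqsubseteq> \<Delta> \<Longrightarrow> \<Delta> \<turnstile> index m i \<Longrightarrow> \<Delta> \<turnstile> D"
    and "\<And>\<Delta>. \<Gamma> \<sqsubseteq> \<Delta> \<Longrightarrow> \<Delta> \<turnstile> (m \<^bold>+ One \<^bold>= i) \<Longrightarrow> \<Delta> \<turnstile> D"
  shows "\<Gamma> \<turnstile> D"
proof (rule N_le_cases[of _ i m])
  show "\<Gamma> \<turnstile> N i" using i by (simp add: derivable_index)
next
  fix \<Delta> assume "\<Gamma> \<sqsubseteq> \<Delta>" "\<Delta> \<turnstile> (i \<^bold>\<le> m)"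
  then show "\<Delta> \<turnstile> D" using i weaken by (intro assms(3)) (auto simp: derivable_index)
next
  fix \<Delta> assume "\<Gamma> \<sqsubseteq> \<Delta>" "\<Delta> \<turnstile> (m \<^bold>+ One \<^bold>\<le> i)"
  then show "\<Delta> \<turnstile> D" using i weaken by (intro assms(4) le_antisymD) (auto simp: derivable_index)
qed (rule m)

lemma index_zero: "\<Gamma> \<turnstile> index Zero i \<Longrightarrow> \<Gamma> \<turnstile> A"
  unfolding derivable_index by (rule one_le_zero) (blast intro: le_transD)

lemma le_self: "\<Gamma> \<turnstile> (t \<^bold>\<le> t)"
  by (intro ax le_refl)

text \<open>The only axiom for arrays changes a single entry, so line \<open>k\<close> is filled
  from 1 to n by induction, using decidability of the index equality at every update. The second
  premise of \<open>D\<close> says that the other lines are still those of \<open>a\<close>; this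
  permits a matrix to be written line by line.\<close>

lemma finite_choice:
  assumes n: "\<Gamma> \<turnstile> N n"
    and ex: "\<And>\<Delta> i. \<Gamma> \<sqsubseteq> \<Delta> \<Longrightarrow> \<Delta> \<turnstile> index n i \<Longrightarrow> \<Delta> \<turnstile> subst (i \<triangleright> \<sigma>) \<tau> (Exists A)"
    and D: "\<And>\<Delta> b. \<Gamma> \<sqsubseteq> \<Delta> \<Longrightarrow>
      (\<And>\<Theta> i. \<Delta> \<sqsubseteq> \<Theta> \<Longrightarrow> \<Theta> \<turnstile> index n i \<Longrightarrow> \<Theta> \<turnstile> subst (line_entry c b k i \<triangleright> i \<triangleright> \<sigma>) \<tau> A) \<Longrightarrow>
      (\<And>\<Theta> r j. \<Delta> \<sqsubseteq> \<Theta> \<Longrightarrow> \<Theta> \<turnstile> (\<^bold>\<not> r \<^bold>= k) \<Longrightarrow> \<Theta> \<turnstile> (line_entry c b r j \<^bold>= line_entry c a r j)) \<Longrightarrow> \<Delta> \<turnstile> D"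
  shows "\<Gamma> \<turnstile> D"
proof -
  let ?B = "Forall (index (Var 1) (Var 0) \<^bold>\<rightarrow>
      subst (line_entry c 0 (Var 3) (Var 0) \<triangleright> Var 0 \<triangleright> (\<lambda>i. Var (i + 4))) (\<lambda>a. a + 2) A) \<^bold>\<and>
    Forall (Forall ((\<^bold>\<not> Var 1 \<^bold>= Var 4) \<^bold>\<rightarrow> line_entry c 0 (Var 1) (Var 0) \<^bold>= line_entry c 1 (Var 1) (Var 0)))"
  have B: "(\<Delta> \<turnstile> subst (m \<triangleright> n \<triangleright> k \<triangleright> \<sigma>) (b \<triangleright> a \<triangleright> \<tau>) ?B) =
    ((\<forall>i \<Theta>. \<Delta> \<sqsubseteq> \<Theta> \<longrightarrow> (\<Theta> \<turnstile> index m i) \<longrightarrow> (\<Theta> \<turnstile> subst (line_entry c b k i \<triangleright> i \<triangleright> \<sigma>) \<tau> A)) \<and>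
     (\<forall>r j \<Theta>. \<Delta> \<sqsubseteq> \<Theta> \<longrightarrow> (\<Theta> \<turnstile> (\<^bold>\<not> r \<^bold>= k)) \<longrightarrow> (\<Theta> \<turnstile> (line_entry c b r j \<^bold>= line_entry c a r j))))" for \<Delta> m b
    unfolding subst.simps(7) derivable_Conj derivable_subst_Forall subst.simps(9)
      derivable_Imp[where A="subst _ _ _"]
    by (simp add: subst_subst numeral_eq_Suc) (simp add: derivable_Imp[where B="_ \<^bold>= _"])
  \<comment> \<open>The guard m \<le> n keeps each new position within the range where
    \<open>ex\<close> applies.\<close>
  let ?P = "Var 0 \<^bold>\<le> Var 1 \<^bold>\<rightarrow> ExistsM ?B"
  have "\<Gamma> \<turnstile> subst (n \<triangleright> n \<triangleright> k \<triangleright> \<sigma>) (a \<triangleright> \<tau>) ?P"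
    using n
  proof (rule N_induct)
    have "\<Delta> \<turnstile> subst (Zero \<triangleright> n \<triangleright> k \<triangleright> \<sigma>) (a \<triangleright> \<tau>) (ExistsM ?B)" for \<Delta>
      by (rule ExistsM_intro[of _ _ a]) (unfold B, blast intro: index_zero eq_refl)
    then show "\<Gamma> \<turnstile> subst (Zero \<triangleright> n \<triangleright> k \<triangleright> \<sigma>) (a \<triangleright> \<tau>) ?P"
      unfolding subst.simps(9) derivable_Imp by blast
  next
    fix \<Delta> m assume \<Delta>: "\<Gamma> \<sqsubseteq> \<Delta>" and m: "\<Delta> \<turnstile> N m" and IH: "\<Delta> \<turnstile> subst (m \<triangleright> n \<triangleright> k \<triangleright> \<sigma>) (a \<triangleright> \<tau>) ?P"
    let ?G = "subst (m \<^bold>+ One \<triangleright> n \<triangleright> k \<triangleright> \<sigma>) (a \<triangleright> \<tau>) (ExistsM ?B)"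
    have "\<Theta> \<turnstile> ?G" if \<Theta>: "\<Delta> \<sqsubseteq> \<Theta>" and le: "\<Theta> \<turnstile> (m \<^bold>+ One \<^bold>\<le> n)" for \<Theta>
    proof -
      have "\<Theta> \<turnstile> subst (m \<triangleright> n \<triangleright> k \<triangleright> \<sigma>) (a \<triangleright> \<tau>) (Var 0 \<^bold>\<le> Var 1)"
        using le_succ_le[OF le] by simp
      then have "\<Theta> \<turnstile> subst (m \<triangleright> n \<triangleright> k \<triangleright> \<sigma>) (a \<triangleright> \<tau>) (ExistsM ?B)"
        using IH \<Theta> unfolding subst.simps(9) derivable_Imp by blast
      then show ?thesis
      proof (rule ExistsM_elim)
        fix \<Xi> b assume \<Xi>: "\<Theta> \<sqsubseteq> \<Xi>" and b: "\<Xi> \<turnstile> subst (m \<triangleright> n \<triangleright> k \<triangleright> \<sigma>) (b \<triangleright> a \<triangleright> \<tau>) ?B"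
        have idx: "\<Xi> \<turnstile> index n (m \<^bold>+ One)" using m le \<Theta> \<Xi> weaken by (blast intro: index_succ)
        have "\<Xi> \<turnstile> subst (m \<^bold>+ One \<triangleright> \<sigma>) \<tau> (Exists A)" using \<Delta> \<Theta> \<Xi> idx by (intro ex) auto
        then show "\<Xi> \<turnstile> ?G"
        proof (rule Exists_elim)
          fix \<Omega> x assume \<Omega>: "\<Xi> \<sqsubseteq> \<Omega>" and x: "\<Omega> \<turnstile> subst (x \<triangleright> m \<^bold>+ One \<triangleright> \<sigma>) \<tau> A"
          show "\<Omega> \<turnstile> ?G"
          proof (rule update_line_entry[where c=c and s=k and t="m \<^bold>+ One" and r=x and a=b])
            fix \<Psi> b'
            assume \<Psi>: "\<Omega> \<sqsubseteq> \<Psi>" and b': "\<Psi> \<turnstile> (line_entry c b' k (m \<^bold>+ One) \<^bold>= x)"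
              "\<And>\<Theta> x y. \<Psi> \<sqsubseteq> \<Theta> \<Longrightarrow> (\<Theta> \<turnstile> (\<^bold>\<not> x \<^bold>= k)) \<or> (\<Theta> \<turnstile> (\<^bold>\<not> y \<^bold>= m \<^bold>+ One)) \<Longrightarrow>
                \<Theta> \<turnstile> (line_entry c b' x y \<^bold>= line_entry c b x y)"
            have \<Xi>\<Psi>: "\<Xi> \<sqsubseteq> \<Psi>" using \<Omega> \<Psi> by auto
            have "\<Phi> \<turnstile> subst (line_entry c b' k i \<triangleright> i \<triangleright> \<sigma>) \<tau> A"
              if \<Phi>: "\<Psi> \<sqsubseteq> \<Phi>" and i: "\<Phi> \<turnstile> index (m \<^bold>+ One) i" for i \<Phi>
            proof -
              have "\<Delta> \<sqsubseteq> \<Phi>" using \<Theta> \<Xi> \<Xi>\<Psi> \<Phi> by auto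
              from i weaken[OF m this] show ?thesis
              proof (rule index_succ_cases)
                fix \<Phi>' assume \<Phi>': "\<Phi> \<sqsubseteq> \<Phi>'" and i: "\<Phi>' \<turnstile> index m i"
                have "\<Xi> \<sqsubseteq> \<Phi>'" "\<Psi> \<sqsubseteq> \<Phi>'" using \<Xi>\<Psi> \<Phi> \<Phi>' by auto
                have "\<Phi>' \<turnstile> subst (line_entry c b k i \<triangleright> i \<triangleright> \<sigma>) \<tau> A"
                  using b i \<open>\<Xi> \<sqsubseteq> \<Phi>'\<close> unfolding B by blast
                with eq_sym[OF b'(2)[OF \<open>\<Psi> \<sqsubseteq> \<Phi>'\<close> HOL.disjI2[OF index_neq[OF i]]]]
                show "\<Phi>' \<turnstile> subst (line_entry c b' k i \<triangleright> i \<triangleright> \<sigma>) \<tau> A" by (rule eq_subst_env)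
              next
                fix \<Phi>' assume \<Phi>': "\<Phi> \<sqsubseteq> \<Phi>'" and i: "\<Phi>' \<turnstile> (m \<^bold>+ One \<^bold>= i)"
                have "\<Omega> \<sqsubseteq> \<Phi>'" "\<Psi> \<sqsubseteq> \<Phi>'" using \<Psi> \<Phi> \<Phi>' by auto
                then have *: "\<Phi>' \<turnstile> (x \<^bold>= line_entry c b' k i)" "\<Phi>' \<turnstile> subst (x \<triangleright> m \<^bold>+ One \<triangleright> \<sigma>) \<tau> A"
                  using eq_trans[OF eq_sym[OF weaken[OF b'(1)]] eq_line_entry[OF eq_refl i]] weaken[OF x]
                  by auto
                show "\<Phi>' \<turnstile> subst (line_entry c b' k i \<triangleright> i \<triangleright> \<sigma>) \<tau> A"
                  by (rule eq_env[OF _ *(2)]) (use *(1) i in \<open>auto simp: eq_refl split: nat.split\<close>)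
              qed
            qed
            moreover have "\<Phi> \<turnstile> (line_entry c b' r j \<^bold>= line_entry c a r j)"
              if "\<Psi> \<sqsubseteq> \<Phi>" "\<Phi> \<turnstile> (\<^bold>\<not> r \<^bold>= k)" for r j \<Phi>
            proof -
              have "\<Phi> \<turnstile> (line_entry c b' r j \<^bold>= line_entry c b r j)" using that b'(2) by blast
              moreover have "\<Phi> \<turnstile> (line_entry c b r j \<^bold>= line_entry c a r j)"
                using that b \<Xi>\<Psi> unfolding B by blast
              ultimately show ?thesis by (rule eq_trans)
            qed
            ultimately have "\<Psi> \<turnstile> subst (m \<^bold>+ One \<triangleright> n \<triangleright> k \<triangleright> \<sigma>) (b' \<triangleright> a \<triangleright> \<tau>) ?B"
              unfolding B by blast
            then show "\<Psi> \<turnstile> ?G" by (rule ExistsM_intro)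
          qed
        qed
      qed
    qed
    then show "\<Delta> \<turnstile> subst (m \<^bold>+ One \<triangleright> n \<triangleright> k \<triangleright> \<sigma>) (a \<triangleright> \<tau>) ?P"
      unfolding subst.simps(9) derivable_Imp by simp
  qed
  moreover have "\<Gamma> \<turnstile> subst (n \<triangleright> n \<triangleright> k \<triangleright> \<sigma>) (a \<triangleright> \<tau>) (Var 0 \<^bold>\<le> Var 1)" by (simp add: le_self)
  ultimately have "\<Gamma> \<turnstile> subst (n \<triangleright> n \<triangleright> k \<triangleright> \<sigma>) (a \<triangleright> \<tau>) (ExistsM ?B)"
    unfolding subst.simps(9) by (rule impE)
  then show ?thesis
  proof (rule ExistsM_elim)
    fix \<Delta> b assume \<Delta>: "\<Gamma> \<sqsubseteq> \<Delta>" and b: "\<Delta> \<turnstile> subst (n \<triangleright> n \<triangleright> k \<triangleright> \<sigma>) (b \<triangleright> a \<triangleright> \<tau>) ?B"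
    from b[unfolded B] show "\<Delta> \<turnstile> D" by (intro D[OF \<Delta>, of b]) blast+
  qed
qed

section \<open>Products with the matrix and its transpose\<close>

lemma vector_choice:
  assumes n: "\<Gamma> \<turnstile> N n"
    and ex: "\<And>\<Delta> i. \<Gamma> \<sqsubseteq> \<Delta> \<Longrightarrow> \<Delta> \<turnstile> index n i \<Longrightarrow> \<Delta> \<turnstile> subst (i \<triangleright> \<sigma>) \<tau> (Exists A)"
    and D: "\<And>\<Delta> b. \<Gamma> \<sqsubseteq> \<Delta> \<Longrightarrow>
      (\<And>\<Theta> i. \<Delta> \<sqsubseteq> \<Theta> \<Longrightarrow> \<Theta> \<turnstile> index n i \<Longrightarrow> \<Theta> \<turnstile> subst (Entry b i One \<triangleright> i \<triangleright> \<sigma>) \<tau> A) \<Longrightarrow> \<Delta> \<turnstile> D"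
  shows "\<Gamma> \<turnstile> D"
\<comment> \<open>A vector is column 1 of its array; \<open>a=0\<close> is an arbitrary array to
  start from.\<close>
proof (rule finite_choice[OF n ex, where c=False and k=One and a=0])
  fix \<Delta> b assume \<Delta>: "\<Gamma> \<sqsubseteq> \<Delta>"
    and b: "\<And>\<Theta> i. \<Delta> \<sqsubseteq> \<Theta> \<Longrightarrow> \<Theta> \<turnstile> index n i \<Longrightarrow> \<Theta> \<turnstile> subst (line_entry False b One i \<triangleright> i \<triangleright> \<sigma>) \<tau> A"
  show "\<Delta> \<turnstile> D" by (rule D[OF \<Delta>, of b]) (use b in \<open>simp add: line_entry_def\<close>)
qed

definition vector_in :: "nat \<Rightarrow> tm \<Rightarrow> nat \<Rightarrow> fm"
  where "vector_in F n v = Forall (index (lift_tm 1 n) (Var 0) \<^bold>\<rightarrow> PVar F [Entry v (Var 0) One])"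

definition mult_vec :: "tm \<Rightarrow> nat \<Rightarrow> nat \<Rightarrow> nat \<Rightarrow> fm"
  where "mult_vec n A v w = Forall (index (lift_tm 1 n) (Var 0) \<^bold>\<rightarrow>
    sum_is (Entry v (Var 0) One \<^bold>* Entry A (Var 1) (Var 0)) (lift_tm 1 n) (Entry w (Var 0) One))"

definition transpose_mult_vec :: "tm \<Rightarrow> nat \<Rightarrow> nat \<Rightarrow> nat \<Rightarrow> fm"
  where "transpose_mult_vec n A w q = Forall (index (lift_tm 1 n) (Var 0) \<^bold>\<rightarrow>
    sum_is (Entry w (Var 0) One \<^bold>* Entry A (Var 0) (Var 1)) (lift_tm 1 n) (Entry q (Var 0) One))"

text \<open>The vector \<open>q\<close> is the Gram matrix A^T A applied to \<open>v\<close>. The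
  intermediate \<open>w\<close> is retained because its squares control the pivot and its multiple
  becomes a row of the inverse; membership in \<open>F\<close> is retained for Markov's principle
  and for division.\<close>

definition gram :: "nat \<Rightarrow> tm \<Rightarrow> nat \<Rightarrow> nat \<Rightarrow> nat \<Rightarrow> nat \<Rightarrow> fm"
  where "gram F n A v w q = (vector_in F n v \<^bold>\<and> vector_in F n w \<^bold>\<and> vector_in F n q \<^bold>\<and>
    mult_vec n A v w \<^bold>\<and> transpose_mult_vec n A w q)"

lemma lift_tm_Var [simp]: "lift_tm k (Var i) = Var (i + k)"
  by (simp add: lift_tm_def)

lemma subst_tm_lift_1 [simp]: "subst_tm (up (Suc 0) \<sigma>) \<tau> (lift_tm (Suc 0) t) = lift_tm (Suc 0) (subst_tm \<sigma> \<tau> t)"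
  by (simp add: subst_tm_lift_tm) (simp add: lift_tm_def subst_tm_subst_tm)

lemma subst_tm_lift_scons [simp]: "subst_tm (t \<triangleright> \<sigma>) \<tau> (lift_tm (Suc 0) s) = subst_tm \<sigma> \<tau> s"
  by (simp add: subst_tm_lift_tm)

lemma subst_vector_in [simp]: "subst \<sigma> \<tau> (vector_in F n v) = vector_in F (subst_tm \<sigma> \<tau> n) (\<tau> v)"
  by (simp add: vector_in_def subst.simps)

lemma subst_mult_vec [simp]:
  "subst \<sigma> \<tau> (mult_vec n A v w) = mult_vec (subst_tm \<sigma> \<tau> n) (\<tau> A) (\<tau> v) (\<tau> w)"
  by (simp add: mult_vec_def subst.simps)

lemma subst_transpose_mult_vec [simp]:
  "subst \<sigma> \<tau> (transpose_mult_vec n A v w) = transpose_mult_vec (subst_tm \<sigma> \<tau> n) (\<tau> A) (\<tau> v) (\<tau> w)"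
  by (simp add: transpose_mult_vec_def subst.simps)

lemma subst_gram [simp]:
  "subst \<sigma> \<tau> (gram F n A v w q) = gram F (subst_tm \<sigma> \<tau> n) (\<tau> A) (\<tau> v) (\<tau> w) (\<tau> q)"
  by (simp add: gram_def)

lemma derivable_vector_in:
  "(\<Gamma> \<turnstile> vector_in F n v) =
    (\<forall>i \<Delta>. \<Gamma> \<sqsubseteq> \<Delta> \<longrightarrow> (\<Delta> \<turnstile> index n i) \<longrightarrow> (\<Delta> \<turnstile> PVar F [Entry v i One]))"
  by (simp add: vector_in_def forces)

lemma derivable_mult_vec:
  "(\<Gamma> \<turnstile> mult_vec n A v w) = (\<forall>i \<Delta>. \<Gamma> \<sqsubseteq> \<Delta> \<longrightarrow> (\<Delta> \<turnstile> index n i) \<longrightarrow>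
    (\<Delta> \<turnstile> sum_is (Entry v (Var 0) One \<^bold>* Entry A (lift_tm 1 i) (Var 0)) n (Entry w i One)))"
  by (simp add: mult_vec_def forces)

lemma derivable_transpose_mult_vec:
  "(\<Gamma> \<turnstile> transpose_mult_vec n A w q) = (\<forall>l \<Delta>. \<Gamma> \<sqsubseteq> \<Delta> \<longrightarrow> (\<Delta> \<turnstile> index n l) \<longrightarrow>
    (\<Delta> \<turnstile> sum_is (Entry w (Var 0) One \<^bold>* Entry A (Var 0) (lift_tm 1 l)) n (Entry q l One)))"
  by (simp add: transpose_mult_vec_def forces)

lemma gramD:
  assumes "\<Gamma> \<turnstile> gram F n A v w q" and "\<Gamma> \<sqsubseteq> \<Delta>" and "\<Delta> \<turnstile> index n i"
  shows "\<Delta> \<turnstile> PVar F [Entry v i One]" and "\<Delta> \<turnstile> PVar F [Entry w i One]" and "\<Delta> \<turnstile> PVar F [Entry q i One]"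
    and "\<Delta> \<turnstile> sum_is (Entry v (Var 0) One \<^bold>* Entry A (lift_tm 1 i) (Var 0)) n (Entry w i One)"
    and "\<Delta> \<turnstile> sum_is (Entry w (Var 0) One \<^bold>* Entry A (Var 0) (lift_tm 1 i)) n (Entry q i One)"
  using assms unfolding gram_def derivable_Conj derivable_vector_in derivable_mult_vec
    derivable_transpose_mult_vec by blast+

lemma subst_entries_in [simp]: "subst \<sigma> \<tau> (entries_in F n A) = entries_in F (subst_tm \<sigma> \<tau> n) (\<tau> A)"
  by (simp add: entries_in_def subst.simps subst_tm_lift_tm up_def)
    (simp add: lift_tm_def subst_tm_subst_tm)

lemma derivable_entries_in:
  "(\<Gamma> \<turnstile> entries_in F n A) = (\<forall>i j \<Delta>. \<Gamma> \<sqsubseteq> \<Delta> \<longrightarrow> (\<Delta> \<turnstile> index n i) \<longrightarrow> (\<Delta> \<turnstile> index n j) \<longrightarrow>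
    (\<Delta> \<turnstile> PVar F [Entry A i j]))"
  by (simp add: entries_in_def forces subst_tm_lift_tm) (meson order_refl subset_trans weaken)

text \<open>Equality is stable, so t may be assumed nonzero, and then t times t = 0 is divided by
  t.\<close>

lemma square_zero:
  assumes "\<Gamma> \<turnstile> (t \<^bold>* t \<^bold>\<le> Zero)"
  shows "\<Gamma> \<turnstile> (t \<^bold>= Zero)"
proof (rule eq_classical[of _ "t \<^bold>= Zero"])
  fix \<Delta> assume \<Delta>: "\<Gamma> \<sqsubseteq> \<Delta>" "\<Delta> \<turnstile> (\<^bold>\<not> t \<^bold>= Zero)"
  have t: "\<Delta> \<turnstile> (t \<^bold>* t \<^bold>= Zero)"
    by (rule le_antisymD[OF weaken[OF assms \<Delta>(1)] square_nonneg])
  have d: "\<Delta> \<turnstile> ((One \<^bold>/ t) \<^bold>* t \<^bold>= One)" by (rule divide_mul[OF \<Delta>(2)])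
  show "\<Delta> \<turnstile> (t \<^bold>= Zero)"
    by (rule eq_cert2[OF d t, where k="- rt t" and k'="rt (One \<^bold>/ t)"]) (simp add: algebra_simps)
qed

text \<open>The sum has some value s, since the terms equal 0 and 0 lies in \<open>F\<close>.
  Termwise h = h + (-1) h, so linearity also gives it the value s - s.\<close>

lemma sum_zero_terms:
  assumes F: "\<Gamma> \<turnstile> constructive_field F" and n: "\<Gamma> \<turnstile> N n"
    and h: "\<And>\<Delta> i. \<Gamma> \<sqsubseteq> \<Delta> \<Longrightarrow> \<Delta> \<turnstile> index n i \<Longrightarrow> \<Delta> \<turnstile> (ap h i \<^bold>= Zero)"
  shows "\<Gamma> \<turnstile> sum_is h n Zero"
proof (rule sum_exists[OF F n, where f=h])
  fix \<Delta> i assume \<Delta>: "\<Gamma> \<sqsubseteq> \<Delta>" "\<Delta> \<turnstile> index n i"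
  show "\<Delta> \<turnstile> PVar F [ap h i]"
    by (rule eq_PVar[OF eq_sym[OF h[OF \<Delta>]] field_zero[OF weaken[OF F \<Delta>(1)]]])
next
  fix \<Delta> s assume \<Delta>: "\<Gamma> \<sqsubseteq> \<Delta>" and s: "\<Delta> \<turnstile> sum_is h n s"
  have "\<Delta> \<turnstile> sum_is h n (s \<^bold>+ (Zero \<^bold>- One) \<^bold>* s)"
    using weaken[OF n \<Delta>] _ s s
  proof (rule sum_linear)
    fix \<Theta> i assume \<Theta>: "\<Delta> \<sqsubseteq> \<Theta>" "\<Theta> \<turnstile> index n i"
    then have "\<Theta> \<turnstile> (ap h i \<^bold>= Zero)" using \<Delta> by (intro h) auto
    then show "\<Theta> \<turnstile> (ap h i \<^bold>= ap h i \<^bold>+ (Zero \<^bold>- One) \<^bold>* ap h i)"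
      by (rule eq_cert1[where k=1]) (simp add: algebra_simps)
  qed
  then show "\<Delta> \<turnstile> sum_is h n Zero"
    by (rule sum_eq[OF _ eq_refl ring_eq]) (simp add: algebra_simps)
qed

text \<open>The hypotheses are fixed for one base context and transported by weakening, since every
  elimination of an existential moves the argument to a larger context.\<close>

locale field_matrix =
  fixes \<Gamma>\<^sub>0 :: "fm list" and F :: nat and n :: tm and A :: nat
  assumes field: "\<Gamma>\<^sub>0 \<turnstile> constructive_field F"
    and nat: "\<Gamma>\<^sub>0 \<turnstile> N n"
    and entries: "\<Gamma>\<^sub>0 \<turnstile> entries_in F n A"
begin

lemma field_ext: "\<Gamma>\<^sub>0 \<sqsubseteq> \<Gamma> \<Longrightarrow> \<Gamma> \<turnstile> constructive_field F"
  by (rule weaken[OF field])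

lemma nat_ext: "\<Gamma>\<^sub>0 \<sqsubseteq> \<Gamma> \<Longrightarrow> \<Gamma> \<turnstile> N n"
  by (rule weaken[OF nat])

lemma entry: "\<Gamma>\<^sub>0 \<sqsubseteq> \<Gamma> \<Longrightarrow> \<Gamma> \<turnstile> index n i \<Longrightarrow> \<Gamma> \<turnstile> index n j \<Longrightarrow> \<Gamma> \<turnstile> PVar F [Entry A i j]"
  using entries unfolding derivable_entries_in by blast

text \<open>Each entry of a matrix-vector product is a sum, hence an existence statement; collecting
  these values into an array takes one choice for \<open>w\<close> and another for
  \<open>q\<close>.\<close>

lemma gram_exists:
  assumes G: "\<Gamma>\<^sub>0 \<sqsubseteq> \<Gamma>" and v: "\<Gamma> \<turnstile> vector_in F n v"
    and D: "\<And>\<Delta> w q. \<Gamma> \<sqsubseteq> \<Delta> \<Longrightarrow> \<Delta> \<turnstile> gram F n A v w q \<Longrightarrow> \<Delta> \<turnstile> D"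
  shows "\<Gamma> \<turnstile> D"
proof -
  let ?A = "PVar F [Var 0] \<^bold>\<and> sum_is (Entry 0 (Var 0) One \<^bold>* Entry 1 (Var 2) (Var 0)) (Var 2) (Var 0)"
  let ?B = "PVar F [Var 0] \<^bold>\<and> sum_is (Entry 0 (Var 0) One \<^bold>* Entry 1 (Var 0) (Var 2)) (Var 2) (Var 0)"
  have v': "\<Delta> \<turnstile> PVar F [Entry v i One]" if "\<Gamma> \<sqsubseteq> \<Delta>" "\<Delta> \<turnstile> index n i" for \<Delta> i
    using that v unfolding derivable_vector_in by blast
  show ?thesis
    using nat_ext[OF G]
  proof (rule vector_choice)
    fix \<Delta> i assume \<Delta>: "\<Gamma> \<sqsubseteq> \<Delta>" and i: "\<Delta> \<turnstile> index n i"
    have G': "\<Gamma>\<^sub>0 \<sqsubseteq> \<Delta>" using G \<Delta> by auto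
    show "\<Delta> \<turnstile> subst (i \<triangleright> n \<triangleright> Var) (v \<triangleright> A \<triangleright> id) (Exists ?A)"
      using field_ext[OF G'] nat_ext[OF G']
    proof (rule sum_exists)
      fix \<Theta> j assume "\<Delta> \<sqsubseteq> \<Theta>" "\<Theta> \<turnstile> index n j"
      then show "\<Theta> \<turnstile> PVar F [ap (Entry v (Var 0) One \<^bold>* Entry A (lift_tm 1 i) (Var 0)) j]"
        using G' \<Delta> i by (simp, intro field_mul field_ext v' entry) (auto intro: weaken)
    next
      fix \<Theta> s assume "\<Theta> \<turnstile> PVar F [s]"
        "\<Theta> \<turnstile> sum_is (Entry v (Var 0) One \<^bold>* Entry A (lift_tm 1 i) (Var 0)) n s"
      then show "\<Theta> \<turnstile> subst (i \<triangleright> n \<triangleright> Var) (v \<triangleright> A \<triangleright> id) (Exists ?A)"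
        by (intro Exists_intro[of _ s]) (simp add: derivable_Conj)
    qed
  next
    fix \<Delta> w assume \<Delta>: "\<Gamma> \<sqsubseteq> \<Delta>" and w: "\<And>\<Theta> i. \<Delta> \<sqsubseteq> \<Theta> \<Longrightarrow> \<Theta> \<turnstile> index n i \<Longrightarrow>
      \<Theta> \<turnstile> subst (Entry w i One \<triangleright> i \<triangleright> n \<triangleright> Var) (v \<triangleright> A \<triangleright> id) ?A"
    have w1: "\<Theta> \<turnstile> PVar F [Entry w i One]"
      and w2: "\<Theta> \<turnstile> sum_is (Entry v (Var 0) One \<^bold>* Entry A (lift_tm 1 i) (Var 0)) n (Entry w i One)"
      if "\<Delta> \<sqsubseteq> \<Theta>" "\<Theta> \<turnstile> index n i" for \<Theta> i
      using w[OF that] by (simp_all add: derivable_Conj)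
    have G': "\<Gamma>\<^sub>0 \<sqsubseteq> \<Delta>" using G \<Delta> by auto
    show "\<Delta> \<turnstile> D"
      using nat_ext[OF G']
    proof (rule vector_choice)
      fix \<Theta> l assume \<Theta>: "\<Delta> \<sqsubseteq> \<Theta>" and l: "\<Theta> \<turnstile> index n l"
      have G'': "\<Gamma>\<^sub>0 \<sqsubseteq> \<Theta>" using G' \<Theta> by auto
      show "\<Theta> \<turnstile> subst (l \<triangleright> n \<triangleright> Var) (w \<triangleright> A \<triangleright> id) (Exists ?B)"
        using field_ext[OF G''] nat_ext[OF G'']
      proof (rule sum_exists)
        fix \<Xi> j assume "\<Theta> \<sqsubseteq> \<Xi>" "\<Xi> \<turnstile> index n j"
        then show "\<Xi> \<turnstile> PVar F [ap (Entry w (Var 0) One \<^bold>* Entry A (Var 0) (lift_tm 1 l)) j]"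
          using G'' \<Theta> l by (simp, intro field_mul field_ext w1 entry) (auto intro: weaken)
      next
        fix \<Xi> s assume "\<Xi> \<turnstile> PVar F [s]"
          "\<Xi> \<turnstile> sum_is (Entry w (Var 0) One \<^bold>* Entry A (Var 0) (lift_tm 1 l)) n s"
        then show "\<Xi> \<turnstile> subst (l \<triangleright> n \<triangleright> Var) (w \<triangleright> A \<triangleright> id) (Exists ?B)"
          by (intro Exists_intro[of _ s]) (simp add: derivable_Conj)
      qed
    next
      fix \<Theta> q assume \<Theta>: "\<Delta> \<sqsubseteq> \<Theta>" and q: "\<And>\<Xi> l. \<Theta> \<sqsubseteq> \<Xi> \<Longrightarrow> \<Xi> \<turnstile> index n l \<Longrightarrow>
        \<Xi> \<turnstile> subst (Entry q l One \<triangleright> l \<triangleright> n \<triangleright> Var) (w \<triangleright> A \<triangleright> id) ?B"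
      have q1: "\<Xi> \<turnstile> PVar F [Entry q l One]"
        and q2: "\<Xi> \<turnstile> sum_is (Entry w (Var 0) One \<^bold>* Entry A (Var 0) (lift_tm 1 l)) n (Entry q l One)"
        if "\<Theta> \<sqsubseteq> \<Xi>" "\<Xi> \<turnstile> index n l" for \<Xi> l
        using q[OF that] by (simp_all add: derivable_Conj)
      have "\<Theta> \<turnstile> gram F n A v w q"
        unfolding gram_def derivable_Conj derivable_vector_in derivable_mult_vec derivable_transpose_mult_vec
        using \<Delta> \<Theta> by (blast intro: v' w1 w2 q1 q2)
      then show "\<Theta> \<turnstile> D" using \<Delta> \<Theta> by (intro D) auto
    qed
  qed
qed

lemma vector_comb_exists:
  assumes G: "\<Gamma>\<^sub>0 \<sqsubseteq> \<Gamma>" and t: "\<Gamma> \<turnstile> PVar F [t]"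
    and a: "\<Gamma> \<turnstile> vector_in F n a" and b: "\<Gamma> \<turnstile> vector_in F n b"
    and D: "\<And>\<Delta> u. \<Gamma> \<sqsubseteq> \<Delta> \<Longrightarrow> \<Delta> \<turnstile> vector_in F n u \<Longrightarrow>
      (\<And>\<Theta> i. \<Delta> \<sqsubseteq> \<Theta> \<Longrightarrow> \<Theta> \<turnstile> index n i \<Longrightarrow>
        \<Theta> \<turnstile> (Entry u i One \<^bold>= Entry a i One \<^bold>- t \<^bold>* Entry b i One)) \<Longrightarrow> \<Delta> \<turnstile> D"
  shows "\<Gamma> \<turnstile> D"
proof -
  let ?A = "PVar F [Var 0] \<^bold>\<and> Var 0 \<^bold>= Entry 0 (Var 1) One \<^bold>- Var 2 \<^bold>* Entry 1 (Var 1) One"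
  show ?thesis
    using nat_ext[OF G]
  proof (rule vector_choice)
    fix \<Delta> i assume \<Delta>: "\<Gamma> \<sqsubseteq> \<Delta>" and i: "\<Delta> \<turnstile> index n i"
    have "\<Delta> \<turnstile> PVar F [Entry a i One]" "\<Delta> \<turnstile> PVar F [Entry b i One]"
      using a b \<Delta> i unfolding derivable_vector_in by blast+
    then have "\<Delta> \<turnstile> PVar F [Entry a i One \<^bold>- t \<^bold>* Entry b i One]"
      using G \<Delta> t by (intro field_sub field_mul field_ext) (auto intro: weaken)
    then show "\<Delta> \<turnstile> subst (i \<triangleright> t \<triangleright> Var) (a \<triangleright> b \<triangleright> id) (Exists ?A)"
      by (intro Exists_intro[of _ "Entry a i One \<^bold>- t \<^bold>* Entry b i One"]) (simp add: derivable_Conj eq_refl)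
  next
    fix \<Delta> u assume \<Delta>: "\<Gamma> \<sqsubseteq> \<Delta>" and u: "\<And>\<Theta> i. \<Delta> \<sqsubseteq> \<Theta> \<Longrightarrow> \<Theta> \<turnstile> index n i \<Longrightarrow>
      \<Theta> \<turnstile> subst (Entry u i One \<triangleright> i \<triangleright> t \<triangleright> Var) (a \<triangleright> b \<triangleright> id) ?A"
    show "\<Delta> \<turnstile> D"
      using u by (intro D[OF \<Delta>, of u]) (simp_all add: derivable_vector_in derivable_Conj)
  qed
qed

text \<open>The entries may be defined by cases because equality of the natural numbers i and k is
  decidable.\<close>

lemma unit_vector_exists:
  assumes G: "\<Gamma>\<^sub>0 \<sqsubseteq> \<Gamma>" and k: "\<Gamma> \<turnstile> N k"
    and D: "\<And>\<Delta> e. \<Gamma> \<sqsubseteq> \<Delta> \<Longrightarrow> \<Delta> \<turnstile> vector_in F n e \<Longrightarrow>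
      (\<And>\<Theta> i. \<Delta> \<sqsubseteq> \<Theta> \<Longrightarrow> \<Theta> \<turnstile> index n i \<Longrightarrow> \<Theta> \<turnstile> (i \<^bold>= k) \<Longrightarrow> \<Theta> \<turnstile> (Entry e i One \<^bold>= One)) \<Longrightarrow>
      (\<And>\<Theta> i. \<Delta> \<sqsubseteq> \<Theta> \<Longrightarrow> \<Theta> \<turnstile> index n i \<Longrightarrow> \<Theta> \<turnstile> (\<^bold>\<not> i \<^bold>= k) \<Longrightarrow> \<Theta> \<turnstile> (Entry e i One \<^bold>= Zero)) \<Longrightarrow> \<Delta> \<turnstile> D"
  shows "\<Gamma> \<turnstile> D"
proof -
  let ?A = "PVar F [Var 0] \<^bold>\<and> (Var 1 \<^bold>= Var 2 \<^bold>\<rightarrow> Var 0 \<^bold>= One) \<^bold>\<and> ((\<^bold>\<not> Var 1 \<^bold>= Var 2) \<^bold>\<rightarrow> Var 0 \<^bold>= Zero)"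
  show ?thesis
    using nat_ext[OF G]
  proof (rule vector_choice)
    fix \<Delta> i assume \<Delta>: "\<Gamma> \<sqsubseteq> \<Delta>" and i: "\<Delta> \<turnstile> index n i"
    have G': "\<Gamma>\<^sub>0 \<sqsubseteq> \<Delta>" using G \<Delta> by auto
    have "\<Delta> \<turnstile> N i" using i by (simp add: derivable_index)
    from this weaken[OF k \<Delta>] show "\<Delta> \<turnstile> subst (i \<triangleright> k \<triangleright> Var) id (Exists ?A)"
    proof (rule N_eq_cases)
      fix \<Theta> assume \<Theta>: "\<Delta> \<sqsubseteq> \<Theta>" "\<Theta> \<turnstile> (i \<^bold>= k)"
      then have "\<Theta> \<turnstile> ((\<^bold>\<not> i \<^bold>= k) \<^bold>\<rightarrow> One \<^bold>= Zero)"
        unfolding derivable_Imp by (blast intro: botE weaken)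
      moreover have "\<Theta> \<turnstile> (i \<^bold>= k \<^bold>\<rightarrow> One \<^bold>= One)" unfolding derivable_Imp by (blast intro: eq_refl)
      ultimately show "\<Theta> \<turnstile> subst (i \<triangleright> k \<triangleright> Var) id (Exists ?A)"
        using G' \<Theta>(1) by (intro Exists_intro[of _ One]) (auto simp: derivable_Conj intro: field_one field_ext)
    next
      fix \<Theta> assume \<Theta>: "\<Delta> \<sqsubseteq> \<Theta>" "\<Theta> \<turnstile> (\<^bold>\<not> i \<^bold>= k)"
      then have "\<Theta> \<turnstile> (i \<^bold>= k \<^bold>\<rightarrow> Zero \<^bold>= One)"
        unfolding derivable_Imp by (blast intro: botE weaken)
      moreover have "\<Theta> \<turnstile> ((\<^bold>\<not> i \<^bold>= k) \<^bold>\<rightarrow> Zero \<^bold>= Zero)"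
        unfolding derivable_Imp[where B="_ \<^bold>= _"] by (blast intro: eq_refl)
      ultimately show "\<Theta> \<turnstile> subst (i \<triangleright> k \<triangleright> Var) id (Exists ?A)"
        using G' \<Theta>(1) by (intro Exists_intro[of _ Zero]) (auto simp: derivable_Conj intro: field_zero field_ext)
    qed
  next
    fix \<Delta> e assume \<Delta>: "\<Gamma> \<sqsubseteq> \<Delta>" and e: "\<And>\<Theta> i. \<Delta> \<sqsubseteq> \<Theta> \<Longrightarrow> \<Theta> \<turnstile> index n i \<Longrightarrow>
      \<Theta> \<turnstile> subst (Entry e i One \<triangleright> i \<triangleright> k \<triangleright> Var) id ?A"
    have e': "\<Theta> \<turnstile> PVar F [Entry e i One]" "\<Theta> \<turnstile> (i \<^bold>= k \<^bold>\<rightarrow> Entry e i One \<^bold>= One)"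
      "\<Theta> \<turnstile> ((\<^bold>\<not> i \<^bold>= k) \<^bold>\<rightarrow> Entry e i One \<^bold>= Zero)" if "\<Delta> \<sqsubseteq> \<Theta>" "\<Theta> \<turnstile> index n i" for \<Theta> i
      using e[OF that] by (simp_all add: derivable_Conj)
    show "\<Delta> \<turnstile> D"
    proof (rule D[OF \<Delta>, of e])
      show "\<Delta> \<turnstile> vector_in F n e" unfolding derivable_vector_in using e'(1) by blast
      show "\<Theta> \<turnstile> (Entry e i One \<^bold>= One)" if "\<Delta> \<sqsubseteq> \<Theta>" "\<Theta> \<turnstile> index n i" "\<Theta> \<turnstile> (i \<^bold>= k)" for \<Theta> i
        by (rule impE[OF e'(2)[OF that(1,2)] that(3)])
      show "\<Theta> \<turnstile> (Entry e i One \<^bold>= Zero)" if "\<Delta> \<sqsubseteq> \<Theta>" "\<Theta> \<turnstile> index n i" "\<Theta> \<turnstile> (\<^bold>\<not> i \<^bold>= k)" for \<Theta> i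
        by (rule impE[OF e'(3)[OF that(1,2)] that(3)])
    qed
  qed
qed

text \<open>Since \<open>w\<close> and \<open>q\<close> depend linearly on \<open>v\<close>,
  subtracting a multiple of one vector from another performs the same operation on their images.
  This is the row operation of the elimination.\<close>

lemma gram_comb:
  assumes G: "\<Gamma>\<^sub>0 \<sqsubseteq> \<Gamma>" and t: "\<Gamma> \<turnstile> PVar F [t]"
    and g: "\<Gamma> \<turnstile> gram F n A v w q" and g': "\<Gamma> \<turnstile> gram F n A v' w' q'"
    and D: "\<And>\<Delta> v'' w'' q''. \<Gamma> \<sqsubseteq> \<Delta> \<Longrightarrow> \<Delta> \<turnstile> gram F n A v'' w'' q'' \<Longrightarrow>
      (\<And>\<Theta> i. \<Delta> \<sqsubseteq> \<Theta> \<Longrightarrow> \<Theta> \<turnstile> index n i \<Longrightarrow>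
        \<Theta> \<turnstile> (Entry v'' i One \<^bold>= Entry v i One \<^bold>- t \<^bold>* Entry v' i One)) \<Longrightarrow>
      (\<And>\<Theta> i. \<Delta> \<sqsubseteq> \<Theta> \<Longrightarrow> \<Theta> \<turnstile> index n i \<Longrightarrow>
        \<Theta> \<turnstile> (Entry q'' i One \<^bold>= Entry q i One \<^bold>- t \<^bold>* Entry q' i One)) \<Longrightarrow> \<Delta> \<turnstile> D"
  shows "\<Gamma> \<turnstile> D"
proof -
  have vec: "\<Delta> \<turnstile> vector_in F n v" "\<Delta> \<turnstile> vector_in F n w" "\<Delta> \<turnstile> vector_in F n q"
    "\<Delta> \<turnstile> vector_in F n v'" "\<Delta> \<turnstile> vector_in F n w'" "\<Delta> \<turnstile> vector_in F n q'" if "\<Gamma> \<sqsubseteq> \<Delta>" for \<Delta>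
    using g g' weaken that unfolding gram_def derivable_Conj by blast+
  show ?thesis
  proof (rule vector_comb_exists[OF G t vec(1,4)])
    fix \<Delta> v'' assume \<Delta>: "\<Gamma> \<sqsubseteq> \<Delta>" and v'': "\<Delta> \<turnstile> vector_in F n v''" 
      "\<And>\<Theta> i. \<Delta> \<sqsubseteq> \<Theta> \<Longrightarrow> \<Theta> \<turnstile> index n i \<Longrightarrow>
        \<Theta> \<turnstile> (Entry v'' i One \<^bold>= Entry v i One \<^bold>- t \<^bold>* Entry v' i One)"
    have G1: "\<Gamma>\<^sub>0 \<sqsubseteq> \<Delta>" using G \<Delta> by auto
    show "\<Delta> \<turnstile> D"
    proof (rule vector_comb_exists[OF G1 weaken[OF t \<Delta>] vec(2,5)])
      fix \<Theta> w'' assume \<Theta>: "\<Delta> \<sqsubseteq> \<Theta>" and w'': "\<Theta> \<turnstile> vector_in F n w''"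
        "\<And>\<Xi> i. \<Theta> \<sqsubseteq> \<Xi> \<Longrightarrow> \<Xi> \<turnstile> index n i \<Longrightarrow>
          \<Xi> \<turnstile> (Entry w'' i One \<^bold>= Entry w i One \<^bold>- t \<^bold>* Entry w' i One)"
      have G2: "\<Gamma>\<^sub>0 \<sqsubseteq> \<Theta>" "\<Gamma> \<sqsubseteq> \<Theta>" using G1 \<Delta> \<Theta> by auto
      show "\<Theta> \<turnstile> D"
      proof (rule vector_comb_exists[OF G2(1) weaken[OF t G2(2)] vec(3,6)])
        fix \<Xi> q'' assume \<Xi>: "\<Theta> \<sqsubseteq> \<Xi>" and q'': "\<Xi> \<turnstile> vector_in F n q''"
          "\<And>\<Omega> i. \<Xi> \<sqsubseteq> \<Omega> \<Longrightarrow> \<Omega> \<turnstile> index n i \<Longrightarrow>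
            \<Omega> \<turnstile> (Entry q'' i One \<^bold>= Entry q i One \<^bold>- t \<^bold>* Entry q' i One)"
        have "\<Omega> \<turnstile> sum_is (Entry v'' (Var 0) One \<^bold>* Entry A (lift_tm 1 i) (Var 0)) n (Entry w'' i One)"
          if \<Omega>: "\<Xi> \<sqsubseteq> \<Omega>" and i: "\<Omega> \<turnstile> index n i" for \<Omega> i
        proof -
          have sub: "\<Gamma>\<^sub>0 \<sqsubseteq> \<Omega>" "\<Gamma> \<sqsubseteq> \<Omega>" "\<Delta> \<sqsubseteq> \<Omega>" "\<Theta> \<sqsubseteq> \<Omega>" using G \<Delta> \<Theta> \<Xi> \<Omega> by auto
          have "\<Omega> \<turnstile> sum_is (Entry v'' (Var 0) One \<^bold>* Entry A (lift_tm 1 i) (Var 0)) n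
              (Entry w i One \<^bold>+ (Zero \<^bold>- t) \<^bold>* Entry w' i One)"
            using nat_ext[OF sub(1)] _ gramD(4)[OF g sub(2) i] gramD(4)[OF g' sub(2) i]
          proof (rule sum_linear)
            fix \<Psi> j assume \<Psi>: "\<Omega> \<sqsubseteq> \<Psi>" "\<Psi> \<turnstile> index n j"
            then have "\<Psi> \<turnstile> (Entry v'' j One \<^bold>= Entry v j One \<^bold>- t \<^bold>* Entry v' j One)"
              using sub by (intro v'') auto
            then show "\<Psi> \<turnstile> (ap (Entry v'' (Var 0) One \<^bold>* Entry A (lift_tm 1 i) (Var 0)) j \<^bold>=
                ap (Entry v (Var 0) One \<^bold>* Entry A (lift_tm 1 i) (Var 0)) j \<^bold>+
                (Zero \<^bold>- t) \<^bold>* ap (Entry v' (Var 0) One \<^bold>* Entry A (lift_tm 1 i) (Var 0)) j)"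
              by (rule eq_cert1[where k="rt (Entry A i j)"]) (simp add: algebra_simps)
          qed
          then show ?thesis
            by (rule sum_eq[OF _ eq_refl], intro eq_cert1[OF w''(2)[OF sub(4) i], where k="- 1"])
              (simp add: algebra_simps)
        qed
        moreover have "\<Omega> \<turnstile> sum_is (Entry w'' (Var 0) One \<^bold>* Entry A (Var 0) (lift_tm 1 i)) n (Entry q'' i One)"
          if \<Omega>: "\<Xi> \<sqsubseteq> \<Omega>" and i: "\<Omega> \<turnstile> index n i" for \<Omega> i
        proof -
          have sub: "\<Gamma>\<^sub>0 \<sqsubseteq> \<Omega>" "\<Gamma> \<sqsubseteq> \<Omega>" "\<Theta> \<sqsubseteq> \<Omega>" using G \<Delta> \<Theta> \<Xi> \<Omega> by auto
          have "\<Omega> \<turnstile> sum_is (Entry w'' (Var 0) One \<^bold>* Entry A (Var 0) (lift_tm 1 i)) n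
              (Entry q i One \<^bold>+ (Zero \<^bold>- t) \<^bold>* Entry q' i One)"
            using nat_ext[OF sub(1)] _ gramD(5)[OF g sub(2) i] gramD(5)[OF g' sub(2) i]
          proof (rule sum_linear)
            fix \<Psi> j assume \<Psi>: "\<Omega> \<sqsubseteq> \<Psi>" "\<Psi> \<turnstile> index n j"
            then have "\<Psi> \<turnstile> (Entry w'' j One \<^bold>= Entry w j One \<^bold>- t \<^bold>* Entry w' j One)"
              using sub by (intro w'') auto
            then show "\<Psi> \<turnstile> (ap (Entry w'' (Var 0) One \<^bold>* Entry A (Var 0) (lift_tm 1 i)) j \<^bold>=
                ap (Entry w (Var 0) One \<^bold>* Entry A (Var 0) (lift_tm 1 i)) j \<^bold>+
                (Zero \<^bold>- t) \<^bold>* ap (Entry w' (Var 0) One \<^bold>* Entry A (Var 0) (lift_tm 1 i)) j)"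
              by (rule eq_cert1[where k="rt (Entry A j i)"]) (simp add: algebra_simps)
          qed
          then show ?thesis
            by (rule sum_eq[OF _ eq_refl], intro eq_cert1[OF q''(2)[OF \<Omega> i], where k="- 1"])
              (simp add: algebra_simps)
        qed
        moreover have "\<Xi> \<turnstile> vector_in F n v''" "\<Xi> \<turnstile> vector_in F n w''"
          using v''(1) w''(1) \<Theta> \<Xi> by (meson weaken subset_trans)+
        ultimately have "\<Xi> \<turnstile> gram F n A v'' w'' q''"
          using q''(1)
          unfolding gram_def derivable_Conj derivable_mult_vec derivable_transpose_mult_vec by blast
        then show "\<Xi> \<turnstile> D"
          using \<Delta> \<Theta> \<Xi> by (intro D[of _ v'' w'' q'']) (auto intro!: v'' q'')
      qed (use vec G2 in auto)
    qed (use vec \<Delta> in auto)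
  qed (use vec in auto)
qed

text \<open>\<open>v \<bullet> (A\<^sup>T A v) = |A v|\<^sup>2\<close>, by induction on the number of columns taken into account: the vector
  \<open>u\<close> is the partial matrix-vector product.\<close>

lemma gram_quadratic_form:
  assumes G: "\<Gamma>\<^sub>0 \<sqsubseteq> \<Gamma>" and g: "\<Gamma> \<turnstile> gram F n A v w q"
    and z: "\<Gamma> \<turnstile> sum_is (Entry v (Var 0) One \<^bold>* Entry q (Var 0) One) n z"
  shows "\<Gamma> \<turnstile> sum_is (Entry w (Var 0) One \<^bold>* Entry w (Var 0) One) n z"
proof -
  \<comment> \<open>Here \<open>Entry 0\<close> to \<open>Entry 4\<close> refer to u, v, w, q and A.
    The invariant says that u is the product of A with v restricted to the first m columns, and that
    w . u is the partial sum z of v . q up to m. It replaces the interchange of a double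
    sum.\<close>
  let ?B = "Forall (index (Var 3) (Var 0) \<^bold>\<rightarrow>
      sum_is (Entry 1 (Var 0) One \<^bold>* Entry 4 (Var 1) (Var 0)) (Var 2) (Entry 0 (Var 0) One)) \<^bold>\<and>
    sum_is (Entry 2 (Var 0) One \<^bold>* Entry 0 (Var 0) One) (Var 2) (Var 0)"
  let ?C = "sum_is (Entry 0 (Var 0) One \<^bold>* Entry 2 (Var 0) One) (Var 1) (Var 0) \<^bold>\<and> ExistsM ?B"
  let ?\<tau> = "v \<triangleright> w \<triangleright> q \<triangleright> A \<triangleright> id"
  let ?P = "Var 0 \<^bold>\<le> Var 1 \<^bold>\<rightarrow> Exists ?C"
  have B: "(\<Delta> \<turnstile> subst (z \<triangleright> m \<triangleright> n \<triangleright> Var) (u \<triangleright> ?\<tau>) ?B) =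
    ((\<forall>i \<Theta>. \<Delta> \<sqsubseteq> \<Theta> \<longrightarrow> (\<Theta> \<turnstile> index n i) \<longrightarrow>
      (\<Theta> \<turnstile> sum_is (Entry v (Var 0) One \<^bold>* Entry A (lift_tm 1 i) (Var 0)) m (Entry u i One))) \<and>
     (\<Delta> \<turnstile> sum_is (Entry w (Var 0) One \<^bold>* Entry u (Var 0) One) n z))" for \<Delta> m u z
    unfolding subst.simps(7) derivable_Conj derivable_subst_Forall by (simp add: derivable_Imp numeral_eq_Suc)
  have v: "\<Delta> \<turnstile> PVar F [Entry v i One]" and w: "\<Delta> \<turnstile> PVar F [Entry w i One]"
    and q: "\<Delta> \<turnstile> PVar F [Entry q i One]" if "\<Gamma> \<sqsubseteq> \<Delta>" "\<Delta> \<turnstile> index n i" for \<Delta> i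
    using gramD[OF g that] by auto
  have "\<Gamma> \<turnstile> subst (n \<triangleright> n \<triangleright> Var) ?\<tau> ?P"
    using nat_ext[OF G]
  proof (rule N_induct)
    have "\<Delta> \<turnstile> subst (Zero \<triangleright> n \<triangleright> Var) ?\<tau> (Exists ?C)" if \<Delta>: "\<Gamma> \<sqsubseteq> \<Delta>" for \<Delta>
    proof -
      have G': "\<Gamma>\<^sub>0 \<sqsubseteq> \<Delta>" using G \<Delta> by auto
      have ex: "\<Theta> \<turnstile> subst (i \<triangleright> Var) id (Exists (Var 0 \<^bold>= Zero))" for \<Theta> i
        by (rule Exists_intro[of _ Zero]) (simp add: eq_refl)
      show ?thesis
        using nat_ext[OF G'] ex
      proof (rule vector_choice)
        fix \<Theta> u assume \<Theta>: "\<Delta> \<sqsubseteq> \<Theta>" and "\<And>\<Xi> i. \<Theta> \<sqsubseteq> \<Xi> \<Longrightarrow> \<Xi> \<turnstile> index n i \<Longrightarrow>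
          \<Xi> \<turnstile> subst (Entry u i One \<triangleright> i \<triangleright> Var) id (Var 0 \<^bold>= Zero)"
        then have u: "\<Xi> \<turnstile> (Entry u i One \<^bold>= Zero)" if "\<Theta> \<sqsubseteq> \<Xi>" "\<Xi> \<turnstile> index n i" for \<Xi> i
          using that by auto
        have G'': "\<Gamma>\<^sub>0 \<sqsubseteq> \<Theta>" using G' \<Theta> by auto
        have "\<Theta> \<turnstile> sum_is (Entry w (Var 0) One \<^bold>* Entry u (Var 0) One) n Zero"
          using field_ext[OF G''] nat_ext[OF G'']
        proof (rule sum_zero_terms)
          fix \<Xi> i assume \<Xi>: "\<Theta> \<sqsubseteq> \<Xi>" "\<Xi> \<turnstile> index n i"
          from u[OF this] show "\<Xi> \<turnstile> (ap (Entry w (Var 0) One \<^bold>* Entry u (Var 0) One) i \<^bold>= Zero)"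
            by (rule eq_cert1[where k="rt (Entry w i One)"]) (simp add: algebra_simps)
        qed
        moreover have "\<Xi> \<turnstile> sum_is (Entry v (Var 0) One \<^bold>* Entry A (lift_tm 1 i) (Var 0)) Zero (Entry u i One)"
          if "\<Theta> \<sqsubseteq> \<Xi>" "\<Xi> \<turnstile> index n i" for \<Xi> i
          using sum_zero eq_refl eq_sym[OF u[OF that]] by (rule sum_eq)
        ultimately have "\<Theta> \<turnstile> subst (Zero \<triangleright> Zero \<triangleright> n \<triangleright> Var) (u \<triangleright> ?\<tau>) ?B"
          unfolding B by blast
        then have "\<Theta> \<turnstile> subst (Zero \<triangleright> Zero \<triangleright> n \<triangleright> Var) ?\<tau> (ExistsM ?B)" by (rule ExistsM_intro)
        then have "\<Theta> \<turnstile> subst (Zero \<triangleright> Zero \<triangleright> n \<triangleright> Var) ?\<tau> ?C"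
          unfolding subst.simps(7) derivable_Conj by (simp add: sum_zero)
        then show "\<Theta> \<turnstile> subst (Zero \<triangleright> n \<triangleright> Var) ?\<tau> (Exists ?C)" by (rule Exists_intro)
      qed
    qed
    then show "\<Gamma> \<turnstile> subst (Zero \<triangleright> n \<triangleright> Var) ?\<tau> ?P"
      unfolding subst.simps(9) derivable_Imp by blast
  next
    fix \<Delta> m assume \<Delta>: "\<Gamma> \<sqsubseteq> \<Delta>" and m: "\<Delta> \<turnstile> N m" and IH: "\<Delta> \<turnstile> subst (m \<triangleright> n \<triangleright> Var) ?\<tau> ?P"
    let ?m = "m \<^bold>+ One"
    have "\<Theta> \<turnstile> subst (?m \<triangleright> n \<triangleright> Var) ?\<tau> (Exists ?C)"
      if \<Theta>: "\<Delta> \<sqsubseteq> \<Theta>" and le: "\<Theta> \<turnstile> (?m \<^bold>\<le> n)" for \<Theta>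
    proof -
      have "\<Theta> \<turnstile> subst (m \<triangleright> n \<triangleright> Var) ?\<tau> (Var 0 \<^bold>\<le> Var 1)" using le_succ_le[OF le] by simp
      then have "\<Theta> \<turnstile> subst (m \<triangleright> n \<triangleright> Var) ?\<tau> (Exists ?C)"
        using IH \<Theta> unfolding subst.simps(9) derivable_Imp by blast
      then show ?thesis
      proof (rule Exists_elim)
        fix \<Xi> z assume \<Xi>: "\<Theta> \<sqsubseteq> \<Xi>" and C: "\<Xi> \<turnstile> subst (z \<triangleright> m \<triangleright> n \<triangleright> Var) ?\<tau> ?C"
        from C have z: "\<Xi> \<turnstile> sum_is (Entry v (Var 0) One \<^bold>* Entry q (Var 0) One) m z"
          unfolding subst.simps(7) derivable_Conj by simp
        from C have "\<Xi> \<turnstile> subst (z \<triangleright> m \<triangleright> n \<triangleright> Var) ?\<tau> (ExistsM ?B)"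
          unfolding subst.simps(7) derivable_Conj by blast
        then show "\<Xi> \<turnstile> subst (?m \<triangleright> n \<triangleright> Var) ?\<tau> (Exists ?C)"
        proof (rule ExistsM_elim)
          fix \<Omega> u assume \<Omega>: "\<Xi> \<sqsubseteq> \<Omega>" and "\<Omega> \<turnstile> subst (z \<triangleright> m \<triangleright> n \<triangleright> Var) (u \<triangleright> ?\<tau>) ?B"
          then have u: "\<And>\<Psi> i. \<Omega> \<sqsubseteq> \<Psi> \<Longrightarrow> \<Psi> \<turnstile> index n i \<Longrightarrow>
              \<Psi> \<turnstile> sum_is (Entry v (Var 0) One \<^bold>* Entry A (lift_tm 1 i) (Var 0)) m (Entry u i One)"
            and wu: "\<Omega> \<turnstile> sum_is (Entry w (Var 0) One \<^bold>* Entry u (Var 0) One) n z"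
            unfolding B by blast+
          have sub: "\<Gamma>\<^sub>0 \<sqsubseteq> \<Omega>" "\<Gamma> \<sqsubseteq> \<Omega>" using G \<Delta> \<Theta> \<Xi> \<Omega> by auto
          have idx: "\<Omega> \<turnstile> index n ?m"
            using m le \<Theta> \<Xi> \<Omega> by (intro index_succ) (meson weaken subset_trans)+
          \<comment> \<open>The vector u grows by v(m+1) times column m + 1 of A.\<close>
          let ?r = "\<lambda>i. Entry u i One \<^bold>+ Entry v ?m One \<^bold>* Entry A i ?m"
          have ex: "\<Psi> \<turnstile> subst (i \<triangleright> ?m \<triangleright> Var) (u \<triangleright> v \<triangleright> A \<triangleright> id)
              (Exists (Var 0 \<^bold>= Entry 0 (Var 1) One \<^bold>+ Entry 1 (Var 2) One \<^bold>* Entry 2 (Var 1) (Var 2)))" for \<Psi> i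
            by (rule Exists_intro[of _ "?r i"]) (simp add: eq_refl)
          show "\<Omega> \<turnstile> subst (?m \<triangleright> n \<triangleright> Var) ?\<tau> (Exists ?C)"
            using nat_ext[OF sub(1)] ex
          proof (rule vector_choice)
            fix \<Psi> u' assume \<Psi>: "\<Omega> \<sqsubseteq> \<Psi>" and "\<And>\<Phi> i. \<Psi> \<sqsubseteq> \<Phi> \<Longrightarrow> \<Phi> \<turnstile> index n i \<Longrightarrow>
              \<Phi> \<turnstile> subst (Entry u' i One \<triangleright> i \<triangleright> ?m \<triangleright> Var) (u \<triangleright> v \<triangleright> A \<triangleright> id)
                (Var 0 \<^bold>= Entry 0 (Var 1) One \<^bold>+ Entry 1 (Var 2) One \<^bold>* Entry 2 (Var 1) (Var 2))"
            then have u': "\<Phi> \<turnstile> (Entry u' i One \<^bold>= ?r i)" if "\<Psi> \<sqsubseteq> \<Phi>" "\<Phi> \<turnstile> index n i" for \<Phi> i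
              using that by simp
            have sub': "\<Gamma>\<^sub>0 \<sqsubseteq> \<Psi>" "\<Gamma> \<sqsubseteq> \<Psi>" "\<Xi> \<sqsubseteq> \<Psi>" using sub \<Omega> \<Psi> by auto
            have "\<Phi> \<turnstile> sum_is (Entry v (Var 0) One \<^bold>* Entry A (lift_tm 1 i) (Var 0)) ?m (Entry u' i One)"
              if \<Phi>: "\<Psi> \<sqsubseteq> \<Phi>" "\<Phi> \<turnstile> index n i" for \<Phi> i
            proof (rule sum_eq[OF _ eq_refl eq_sym[OF u'[OF \<Phi>]]])
              show "\<Phi> \<turnstile> sum_is (Entry v (Var 0) One \<^bold>* Entry A (lift_tm 1 i) (Var 0)) ?m (?r i)"
                using sum_succ[OF u[OF subset_trans[OF \<Psi> \<Phi>(1)] \<Phi>(2)]] by simp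
            qed
            \<comment> \<open>Accordingly w . u grows by v(m+1) times the product of w with column m
              + 1, and the latter is q(m+1) as an entry of A^T w: the same increment as that of v .
              q.\<close>
            moreover have "\<Psi> \<turnstile> sum_is (Entry w (Var 0) One \<^bold>* Entry u' (Var 0) One) n
                (z \<^bold>+ Entry v ?m One \<^bold>* Entry q ?m One)"
              using nat_ext[OF sub'(1)] _ weaken[OF wu \<Psi>] gramD(5)[OF g sub'(2) weaken[OF idx \<Psi>]]
            proof (rule sum_linear)
              fix \<Phi> i assume "\<Psi> \<sqsubseteq> \<Phi>" "\<Phi> \<turnstile> index n i"
              from u'[OF this] show "\<Phi> \<turnstile> (ap (Entry w (Var 0) One \<^bold>* Entry u' (Var 0) One) i \<^bold>=
                  ap (Entry w (Var 0) One \<^bold>* Entry u (Var 0) One) i \<^bold>+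
                  Entry v ?m One \<^bold>* ap (Entry w (Var 0) One \<^bold>* Entry A (Var 0) (lift_tm 1 ?m)) i)"
                by (rule eq_cert1[where k="rt (Entry w i One)"]) (simp add: algebra_simps subst_tm_lift_tm)
            qed
            ultimately have "\<Psi> \<turnstile> subst (z \<^bold>+ Entry v ?m One \<^bold>* Entry q ?m One \<triangleright> ?m \<triangleright> n \<triangleright> Var) (u' \<triangleright> ?\<tau>) ?B"
              unfolding B by blast
            then have "\<Psi> \<turnstile> subst (z \<^bold>+ Entry v ?m One \<^bold>* Entry q ?m One \<triangleright> ?m \<triangleright> n \<triangleright> Var) ?\<tau> (ExistsM ?B)"
              by (rule ExistsM_intro)
            then have "\<Psi> \<turnstile> subst (z \<^bold>+ Entry v ?m One \<^bold>* Entry q ?m One \<triangleright> ?m \<triangleright> n \<triangleright> Var) ?\<tau> ?C"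
              using sum_succ[OF weaken[OF z sub'(3)]] unfolding subst.simps(7) derivable_Conj by simp
            then show "\<Psi> \<turnstile> subst (?m \<triangleright> n \<triangleright> Var) ?\<tau> (Exists ?C)" by (rule Exists_intro)
          qed
        qed
      qed
    qed
    then show "\<Delta> \<turnstile> subst (?m \<triangleright> n \<triangleright> Var) ?\<tau> ?P"
      unfolding subst.simps(9) derivable_Imp by simp
  qed
  moreover have "\<Gamma> \<turnstile> subst (n \<triangleright> n \<triangleright> Var) ?\<tau> (Var 0 \<^bold>\<le> Var 1)" by (simp add: le_self)
  ultimately have "\<Gamma> \<turnstile> subst (n \<triangleright> n \<triangleright> Var) ?\<tau> (Exists ?C)"
    unfolding subst.simps(9) by (rule impE)
  then show ?thesis
  proof (rule Exists_elim)
    fix \<Delta> z' assume \<Delta>: "\<Gamma> \<sqsubseteq> \<Delta>" and C: "\<Delta> \<turnstile> subst (z' \<triangleright> n \<triangleright> n \<triangleright> Var) ?\<tau> ?C"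
    from C have z': "\<Delta> \<turnstile> sum_is (Entry v (Var 0) One \<^bold>* Entry q (Var 0) One) n z'"
      unfolding subst.simps(7) derivable_Conj by simp
    from C have "\<Delta> \<turnstile> subst (z' \<triangleright> n \<triangleright> n \<triangleright> Var) ?\<tau> (ExistsM ?B)"
      unfolding subst.simps(7) derivable_Conj by blast
    then show "\<Delta> \<turnstile> sum_is (Entry w (Var 0) One \<^bold>* Entry w (Var 0) One) n z"
    proof (rule ExistsM_elim)
      fix \<Theta> u assume \<Theta>: "\<Delta> \<sqsubseteq> \<Theta>" and "\<Theta> \<turnstile> subst (z' \<triangleright> n \<triangleright> n \<triangleright> Var) (u \<triangleright> ?\<tau>) ?B"
      then have u: "\<And>\<Psi> i. \<Theta> \<sqsubseteq> \<Psi> \<Longrightarrow> \<Psi> \<turnstile> index n i \<Longrightarrow>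
          \<Psi> \<turnstile> sum_is (Entry v (Var 0) One \<^bold>* Entry A (lift_tm 1 i) (Var 0)) n (Entry u i One)"
        and wu: "\<Theta> \<turnstile> sum_is (Entry w (Var 0) One \<^bold>* Entry u (Var 0) One) n z'"
        unfolding B by blast+
      have sub: "\<Gamma>\<^sub>0 \<sqsubseteq> \<Theta>" "\<Gamma> \<sqsubseteq> \<Theta>" using G \<Delta> \<Theta> by auto
      \<comment> \<open>With all n columns counted, u and w are both A v, so uniqueness of sums
        identifies them.\<close>
      have "\<Theta> \<turnstile> sum_is (Entry w (Var 0) One \<^bold>* Entry w (Var 0) One) n z'"
        using nat_ext[OF sub(1)] _ wu
      proof (rule sum_cong)
        fix \<Psi> i assume \<Psi>: "\<Theta> \<sqsubseteq> \<Psi>" and i: "\<Psi> \<turnstile> index n i"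
        have sub': "\<Gamma>\<^sub>0 \<sqsubseteq> \<Psi>" "\<Gamma> \<sqsubseteq> \<Psi>" using sub \<Psi> by auto
        have "\<Psi> \<turnstile> (Entry w i One \<^bold>= Entry u i One)"
          by (rule sum_unique[OF nat_ext[OF sub'(1)] gramD(4)[OF g sub'(2) i] u[OF \<Psi> i]])
        then show "\<Psi> \<turnstile> (ap (Entry w (Var 0) One \<^bold>* Entry w (Var 0) One) i \<^bold>=
            ap (Entry w (Var 0) One \<^bold>* Entry u (Var 0) One) i)"
          by (simp add: eq_mul eq_refl)
      qed
      moreover have "\<Theta> \<turnstile> (z' \<^bold>= z)"
        by (rule sum_unique[OF nat_ext[OF sub(1)] weaken[OF z' \<Theta>] weaken[OF z sub(2)]])
      ultimately show "\<Theta> \<turnstile> sum_is (Entry w (Var 0) One \<^bold>* Entry w (Var 0) One) n z"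
        using sum_eq eq_refl by blast
    qed
  qed
qed

end

lemma subst_non_singular [simp]:
  "subst \<sigma> \<tau> (non_singular n A) = non_singular (subst_tm \<sigma> \<tau> n) (\<tau> A)"
  by (simp add: non_singular_def subst.simps upM_def subst_tm_liftM_tm subst_tm_lift_tm up_def)
    (simp add: lift_tm_def liftM_tm_def subst_tm_subst_tm)

lemma non_singularD:
  assumes A: "\<Gamma> \<turnstile> non_singular n A"
    and v: "\<And>\<Delta> i. \<Gamma> \<sqsubseteq> \<Delta> \<Longrightarrow> \<Delta> \<turnstile> index n i \<Longrightarrow>
      \<Delta> \<turnstile> sum_is (Entry v (Var 0) One \<^bold>* Entry A (lift_tm 1 i) (Var 0)) n Zero"
    and j: "\<Gamma> \<turnstile> index n j"
  shows "\<Gamma> \<turnstile> (Entry v j One \<^bold>= Zero)"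
proof -
  have "\<Delta> \<turnstile> (Entry v j One \<^bold>= Zero)"
    if "\<Gamma> \<sqsubseteq> \<Delta>" "\<Delta> \<turnstile> index n j" "\<And>i \<Theta>. \<Delta> \<sqsubseteq> \<Theta> \<Longrightarrow> \<Theta> \<turnstile> index n i \<Longrightarrow>
      \<Theta> \<turnstile> sum_is (Entry v (Var 0) One \<^bold>* Entry A (lift_tm 1 i) (Var 0)) n Zero" for \<Delta>
    using A that unfolding non_singular_def
    by (simp add: forces subst_tm_lift_tm subst_tm_liftM_tm)
  then show ?thesis using v j by blast
qed

locale regular_field_matrix = field_matrix +
  assumes regular: "\<Gamma>\<^sub>0 \<turnstile> non_singular n A"
begin

text \<open>If \<open>v \<bullet> q = v\<^sub>j q\<^sub>j = q\<^sub>j\<close> vanished, then \<open>A v\<close> and hence \<open>v\<close> would vanish.\<close>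

lemma pivot_apart:
  assumes G: "\<Gamma>\<^sub>0 \<sqsubseteq> \<Gamma>" and g: "\<Gamma> \<turnstile> gram F n A v w q" and j: "\<Gamma> \<turnstile> index n j"
    and vj: "\<Gamma> \<turnstile> (Entry v j One \<^bold>= One)"
    and vq: "\<And>\<Delta> l. \<Gamma> \<sqsubseteq> \<Delta> \<Longrightarrow> \<Delta> \<turnstile> index n l \<Longrightarrow> \<Delta> \<turnstile> (\<^bold>\<not> l \<^bold>= j) \<Longrightarrow>
      \<Delta> \<turnstile> (Entry v l One \<^bold>* Entry q l One \<^bold>= Zero)"
  shows "\<Gamma> \<turnstile> apart0 (Entry q j One)"
\<comment> \<open>The entry lies in \<open>F\<close> by \<open>gram\<close>, so Markov's principle
  applies and only a contradiction from its vanishing is left to derive.\<close>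
proof (rule markov[OF field_ext[OF G] gramD(3)[OF g subset_refl j]], unfold derivable_Imp, intro allI HOL.impI)
  fix \<Delta> assume \<Delta>: "\<Gamma> \<sqsubseteq> \<Delta>" and qj: "\<Delta> \<turnstile> (Entry q j One \<^bold>= Zero)"
  have G': "\<Gamma>\<^sub>0 \<sqsubseteq> \<Delta>" using G \<Delta> by auto
  show "\<Delta> \<turnstile> \<^bold>\<bottom>"
  proof (rule sum_exists[OF field_ext[OF G'] nat_ext[OF G'], where f="Entry v (Var 0) One \<^bold>* Entry q (Var 0) One"])
    fix \<Theta> i assume \<Theta>: "\<Delta> \<sqsubseteq> \<Theta>" and i: "\<Theta> \<turnstile> index n i"
    have "\<Gamma> \<sqsubseteq> \<Theta>" "\<Gamma>\<^sub>0 \<sqsubseteq> \<Theta>" using \<Delta> \<Theta> G' by auto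
    then show "\<Theta> \<turnstile> PVar F [ap (Entry v (Var 0) One \<^bold>* Entry q (Var 0) One) i]"
      using gramD[OF g _ i] by (simp add: field_mul field_ext)
  next
    fix \<Theta> z assume \<Theta>: "\<Delta> \<sqsubseteq> \<Theta>" and z: "\<Theta> \<turnstile> sum_is (Entry v (Var 0) One \<^bold>* Entry q (Var 0) One) n z"
    have sub: "\<Gamma> \<sqsubseteq> \<Theta>" "\<Gamma>\<^sub>0 \<sqsubseteq> \<Theta>" using \<Delta> \<Theta> G' by auto
    have "\<Theta> \<turnstile> (z \<^bold>= ap (Entry v (Var 0) One \<^bold>* Entry q (Var 0) One) j)"
      using nat_ext[OF sub(2)] weaken[OF j sub(1)] _ z
    proof (rule sum_single)
      fix \<Xi> i assume "\<Theta> \<sqsubseteq> \<Xi>" "\<Xi> \<turnstile> index n i" "\<Xi> \<turnstile> (\<^bold>\<not> i \<^bold>= j)"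
      then show "\<Xi> \<turnstile> (ap (Entry v (Var 0) One \<^bold>* Entry q (Var 0) One) i \<^bold>= Zero)"
        using sub by (simp, intro vq) auto
    qed
    then have z0: "\<Theta> \<turnstile> (z \<^bold>= Zero)"
      by (rule eq_cert2[OF _ weaken[OF qj \<Theta>], where k=1 and k'="rt (Entry v j One)"])
        (simp add: algebra_simps)
    have ww: "\<Theta> \<turnstile> sum_is (Entry w (Var 0) One \<^bold>* Entry w (Var 0) One) n z"
      by (rule gram_quadratic_form[OF sub(2) weaken[OF g sub(1)] z])
    have "\<Theta> \<turnstile> (Entry v j One \<^bold>= Zero)"
      using weaken[OF regular sub(2)] _ weaken[OF j sub(1)]
    proof (rule non_singularD)
      fix \<Xi> i assume \<Xi>: "\<Theta> \<sqsubseteq> \<Xi>" and i: "\<Xi> \<turnstile> index n i"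
      have sub': "\<Gamma> \<sqsubseteq> \<Xi>" "\<Gamma>\<^sub>0 \<sqsubseteq> \<Xi>" using sub \<Xi> by auto
      \<comment> \<open>Each square is bounded by the whole sum of squares, which is 0; so all
        entries of A v vanish, and non-singularity gives v = 0.\<close>
      have "\<Xi> \<turnstile> (ap (Entry w (Var 0) One \<^bold>* Entry w (Var 0) One) i \<^bold>\<le> z)"
        using nat_ext[OF sub'(2)] _ weaken[OF ww \<Xi>] i
        by (rule sum_nonneg_term_le) (simp add: square_nonneg)
      then have "\<Xi> \<turnstile> (Entry w i One \<^bold>* Entry w i One \<^bold>\<le> z)" by simp
      then have "\<Xi> \<turnstile> (Entry w i One \<^bold>= Zero)"
        by (intro square_zero le_transD[OF _ eq_imp_le[OF weaken[OF z0 \<Xi>]]])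
      then show "\<Xi> \<turnstile> sum_is (Entry v (Var 0) One \<^bold>* Entry A (lift_tm 1 i) (Var 0)) n Zero"
        by (rule sum_eq[OF gramD(4)[OF g sub'(1) i] eq_refl])
    qed
    then show "\<Theta> \<turnstile> \<^bold>\<bottom>"
      using one_le_zero eq_imp_le eq_trans[OF eq_sym[OF weaken[OF vj sub(1)]]] by blast
  qed
qed

end

section \<open>Elimination\<close>

context regular_field_matrix
begin

text \<open>By induction on \<open>m\<close> one makes \<open>q\<close> vanish at all \<open>l \<le> m\<close> with \<open>l \<noteq> k\<close> without changing \<open>v\<close> at \<open>k\<close> and
  beyond \<open>m\<close>.  The induction hypothesis for the \<open>(m+1)\<close>-st unit vector supplies the pivot row.\<close>

lemma elimination:
  assumes G: "\<Gamma>\<^sub>0 \<sqsubseteq> \<Gamma>" and k: "\<Gamma> \<turnstile> index n k" and v: "\<Gamma> \<turnstile> vector_in F n v"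
    and D: "\<And>\<Delta> v' w q. \<Gamma> \<sqsubseteq> \<Delta> \<Longrightarrow> \<Delta> \<turnstile> gram F n A v' w q \<Longrightarrow>
      \<Delta> \<turnstile> (Entry v' k One \<^bold>= Entry v k One) \<Longrightarrow>
      (\<And>\<Theta> l. \<Delta> \<sqsubseteq> \<Theta> \<Longrightarrow> \<Theta> \<turnstile> index n l \<Longrightarrow> \<Theta> \<turnstile> (\<^bold>\<not> l \<^bold>= k) \<Longrightarrow> \<Theta> \<turnstile> (Entry q l One \<^bold>= Zero)) \<Longrightarrow>
      \<Delta> \<turnstile> D"
  shows "\<Gamma> \<turnstile> D"
proof -
  \<comment> \<open>Outside the quantifiers the matrix variables 0 to 4 are q, w, v', v and A, and
    the real variables 0 to 2 are m, n and k.\<close>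
  let ?B = "gram F (Var 1) 4 2 1 0 \<^bold>\<and>
    Forall (index (Var 2) (Var 0) \<^bold>\<and> Var 1 \<^bold>+ One \<^bold>\<le> Var 0 \<^bold>\<rightarrow> Entry 2 (Var 0) One \<^bold>= Entry 3 (Var 0) One) \<^bold>\<and>
    Entry 2 (Var 2) One \<^bold>= Entry 3 (Var 2) One \<^bold>\<and>
    Forall (index (Var 2) (Var 0) \<^bold>\<and> Var 0 \<^bold>\<le> Var 1 \<^bold>\<and> (\<^bold>\<not> Var 0 \<^bold>= Var 3) \<^bold>\<rightarrow> Entry 0 (Var 0) One \<^bold>= Zero)"
  let ?E = "ExistsM (ExistsM (ExistsM ?B))"
  \<comment> \<open>The quantification over all starting vectors is essential: the step uses the
    induction hypothesis twice, for the given v and for a unit vector.\<close>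
  let ?P = "ForallM (Var 0 \<^bold>\<le> Var 1 \<^bold>\<and> vector_in F (Var 1) 0 \<^bold>\<rightarrow> ?E)"
  let ?\<sigma> = "\<lambda>m. m \<triangleright> n \<triangleright> k \<triangleright> Var"
  \<comment> \<open>The invariant \<open>?B\<close> read in the forcing style, so that the
    elimination step can be carried out in HOL; \<open>good_mono\<close> is its persistence in
    larger contexts.\<close>
  define good where "good \<Delta> m v v' w q \<longleftrightarrow> (\<Delta> \<turnstile> gram F n A v' w q) \<and>
    (\<forall>j \<Theta>. \<Delta> \<sqsubseteq> \<Theta> \<longrightarrow> (\<Theta> \<turnstile> index n j) \<and> (\<Theta> \<turnstile> (m \<^bold>+ One \<^bold>\<le> j)) \<longrightarrow> (\<Theta> \<turnstile> (Entry v' j One \<^bold>= Entry v j One))) \<and>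
    (\<Delta> \<turnstile> (Entry v' k One \<^bold>= Entry v k One)) \<and>
    (\<forall>l \<Theta>. \<Delta> \<sqsubseteq> \<Theta> \<longrightarrow> (\<Theta> \<turnstile> index n l) \<and> (\<Theta> \<turnstile> (l \<^bold>\<le> m)) \<and> (\<Theta> \<turnstile> (\<^bold>\<not> l \<^bold>= k)) \<longrightarrow> (\<Theta> \<turnstile> (Entry q l One \<^bold>= Zero)))"
    for \<Delta> m v v' w q
  have B: "(\<Delta> \<turnstile> subst (?\<sigma> m) (q \<triangleright> w \<triangleright> v' \<triangleright> v \<triangleright> A \<triangleright> id) ?B) = good \<Delta> m v v' w q" for \<Delta> m v v' w q
    unfolding subst.simps(7) derivable_Conj derivable_subst_Forall subst.simps(9) good_def
    by (simp add: derivable_Imp[where A="_ \<^bold>\<and> _"] derivable_Conj numeral_eq_Suc)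
  have E_intro: "\<Delta> \<turnstile> subst (?\<sigma> m) (v \<triangleright> A \<triangleright> id) ?E" if "good \<Delta> m v v' w q" for \<Delta> m v v' w q
    by (rule ExistsM_intro[of _ _ v'], rule ExistsM_intro[of _ _ w], rule ExistsM_intro[of _ _ q])
      (unfold B, fact that)
  have E_elim: "\<Delta> \<turnstile> D"
    if E: "\<Delta> \<turnstile> subst (?\<sigma> m) (v \<triangleright> A \<triangleright> id) ?E"
      and D: "\<And>\<Theta> v' w q. \<Delta> \<sqsubseteq> \<Theta> \<Longrightarrow> good \<Theta> m v v' w q \<Longrightarrow> \<Theta> \<turnstile> D" for \<Delta> m v D
    using E
  proof (rule ExistsM_elim)
    fix \<Theta> v' assume \<Theta>: "\<Delta> \<sqsubseteq> \<Theta>" and E: "\<Theta> \<turnstile> subst (?\<sigma> m) (v' \<triangleright> v \<triangleright> A \<triangleright> id) (ExistsM (ExistsM ?B))"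
    from E show "\<Theta> \<turnstile> D"
    proof (rule ExistsM_elim)
      fix \<Xi> w assume \<Xi>: "\<Theta> \<sqsubseteq> \<Xi>" and E: "\<Xi> \<turnstile> subst (?\<sigma> m) (w \<triangleright> v' \<triangleright> v \<triangleright> A \<triangleright> id) (ExistsM ?B)"
      from E show "\<Xi> \<turnstile> D"
        by (rule ExistsM_elim) (unfold B, meson D \<Theta> \<Xi> subset_trans)
    qed
  qed
  have P: "(\<Delta> \<turnstile> subst (?\<sigma> m) (A \<triangleright> id) ?P) = (\<forall>v \<Theta>. \<Delta> \<sqsubseteq> \<Theta> \<longrightarrow>
    (\<Theta> \<turnstile> (m \<^bold>\<le> n)) \<and> (\<Theta> \<turnstile> vector_in F n v) \<longrightarrow> (\<Theta> \<turnstile> subst (?\<sigma> m) (v \<triangleright> A \<triangleright> id) ?E))" for \<Delta> m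
    unfolding derivable_subst_ForallM subst.simps(9) derivable_Imp[where B="subst _ _ (ExistsM _)"]
      subst.simps(7)[where A="_ \<^bold>\<le> _"] derivable_Conj
    by simp
  have good_mono: "good \<Theta> m v v' w q" if "good \<Delta> m v v' w q" "\<Delta> \<sqsubseteq> \<Theta>" for \<Delta> \<Theta> m v v' w q
    using that weaken unfolding good_def by (meson subset_trans)
  have "\<Gamma> \<turnstile> subst (?\<sigma> n) (A \<triangleright> id) ?P"
    using nat_ext[OF G]
  proof (rule N_induct)
    have "\<Delta> \<turnstile> subst (?\<sigma> Zero) (v \<triangleright> A \<triangleright> id) ?E"
      if \<Delta>: "\<Gamma> \<sqsubseteq> \<Delta>" and v: "\<Delta> \<turnstile> vector_in F n v" for \<Delta> v
    proof (rule gram_exists[OF subset_trans[OF G \<Delta>] v])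
      fix \<Theta> w q assume g: "\<Theta> \<turnstile> gram F n A v w q"
      have "\<Xi> \<turnstile> X" if "\<Xi> \<turnstile> index n l" "\<Xi> \<turnstile> (l \<^bold>\<le> Zero)" for \<Xi> l X
        using that one_le_zero le_transD unfolding derivable_index by blast
      with g have "good \<Theta> Zero v v w q" unfolding good_def by (blast intro: eq_refl)
      then show "\<Theta> \<turnstile> subst (?\<sigma> Zero) (v \<triangleright> A \<triangleright> id) ?E" by (rule E_intro)
    qed
    then show "\<Gamma> \<turnstile> subst (?\<sigma> Zero) (A \<triangleright> id) ?P" unfolding P by blast
  next
    fix \<Delta> m assume \<Delta>: "\<Gamma> \<sqsubseteq> \<Delta>" and m: "\<Delta> \<turnstile> N m" and IH: "\<Delta> \<turnstile> subst (?\<sigma> m) (A \<triangleright> id) ?P"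
    let ?m = "m \<^bold>+ One"
    have "\<Theta> \<turnstile> subst (?\<sigma> ?m) (v \<triangleright> A \<triangleright> id) ?E"
      if \<Theta>: "\<Delta> \<sqsubseteq> \<Theta>" and le: "\<Theta> \<turnstile> (?m \<^bold>\<le> n)" and v: "\<Theta> \<turnstile> vector_in F n v" for \<Theta> v
    proof (rule N_eq_cases[of _ ?m k])
      show "\<Theta> \<turnstile> N ?m" by (rule N_succ[OF weaken[OF m \<Theta>]])
      show "\<Theta> \<turnstile> N k" using k weaken \<Delta> \<Theta> unfolding derivable_index by blast
    next
      \<comment> \<open>At index k there is nothing to eliminate: an l \<le> m + 1 different from k
        already satisfies l \<le> m, so the vectors for m can be kept.\<close>
      fix \<Xi> assume \<Xi>: "\<Theta> \<sqsubseteq> \<Xi>" and mk: "\<Xi> \<turnstile> (?m \<^bold>= k)"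
      have "\<Xi> \<turnstile> subst (?\<sigma> m) (v \<triangleright> A \<triangleright> id) ?E"
        using IH le_succ_le[OF weaken[OF le \<Xi>]] weaken[OF v \<Xi>] \<Theta> \<Xi> unfolding P by blast
      then show "\<Xi> \<turnstile> subst (?\<sigma> ?m) (v \<triangleright> A \<triangleright> id) ?E"
      proof (rule E_elim)
        fix \<Omega> v' w q assume \<Omega>: "\<Xi> \<sqsubseteq> \<Omega>" and good: "good \<Omega> m v v' w q"
        have "\<Psi> \<turnstile> (Entry q l One \<^bold>= Zero)" if \<Psi>: "\<Omega> \<sqsubseteq> \<Psi>" and l: "\<Psi> \<turnstile> index n l" "\<Psi> \<turnstile> (l \<^bold>\<le> ?m)"
          "\<Psi> \<turnstile> (\<^bold>\<not> l \<^bold>= k)" for \<Psi> l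
        proof (rule N_le_cases[of _ l m])
          show "\<Psi> \<turnstile> N l" using l(1) by (simp add: derivable_index)
          show "\<Psi> \<turnstile> N m" using m \<Theta> \<Xi> \<Omega> \<Psi> by (meson weaken subset_trans)
        next
          fix \<Phi> assume \<Phi>: "\<Psi> \<sqsubseteq> \<Phi>" "\<Phi> \<turnstile> (l \<^bold>\<le> m)"
          then show "\<Phi> \<turnstile> (Entry q l One \<^bold>= Zero)"
            using good \<Psi> weaken[OF l(1) \<Phi>(1)] weaken[OF l(3) \<Phi>(1)] unfolding good_def by blast
        next
          fix \<Phi> assume \<Phi>: "\<Psi> \<sqsubseteq> \<Phi>" "\<Phi> \<turnstile> (?m \<^bold>\<le> l)"
          have "\<Xi> \<sqsubseteq> \<Phi>" using \<Omega> \<Psi> \<Phi> by auto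
          have "\<Phi> \<turnstile> (l \<^bold>= k)"
            by (rule eq_trans[OF le_antisymD[OF weaken[OF l(2) \<Phi>(1)] \<Phi>(2)] weaken[OF mk \<open>\<Xi> \<sqsubseteq> \<Phi>\<close>]])
          then show "\<Phi> \<turnstile> (Entry q l One \<^bold>= Zero)" by (rule botE[OF impE[OF weaken[OF l(3) \<Phi>(1)]]])
        qed
        with good have "good \<Omega> ?m v v' w q"
          unfolding good_def by (blast intro: le_succ_le)
        then show "\<Omega> \<turnstile> subst (?\<sigma> ?m) (v \<triangleright> A \<triangleright> id) ?E" by (rule E_intro)
      qed
    next
      fix \<Xi> assume \<Xi>: "\<Theta> \<sqsubseteq> \<Xi>" and mk: "\<Xi> \<turnstile> (\<^bold>\<not> ?m \<^bold>= k)"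
      have G': "\<Gamma>\<^sub>0 \<sqsubseteq> \<Xi>" using G \<Delta> \<Theta> \<Xi> by auto
      show "\<Xi> \<turnstile> subst (?\<sigma> ?m) (v \<triangleright> A \<triangleright> id) ?E"
      proof (rule unit_vector_exists[OF G', of ?m])
        show "\<Xi> \<turnstile> N ?m" using m \<Theta> \<Xi> by (meson N_succ weaken)
      next
        fix \<Xi>\<^sub>1 e assume \<Xi>\<^sub>1: "\<Xi> \<sqsubseteq> \<Xi>\<^sub>1" and e: "\<Xi>\<^sub>1 \<turnstile> vector_in F n e"
          and e1: "\<And>\<Theta> i. \<Xi>\<^sub>1 \<sqsubseteq> \<Theta> \<Longrightarrow> \<Theta> \<turnstile> index n i \<Longrightarrow> \<Theta> \<turnstile> (i \<^bold>= ?m) \<Longrightarrow> \<Theta> \<turnstile> (Entry e i One \<^bold>= One)"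
          and e0: "\<And>\<Theta> i. \<Xi>\<^sub>1 \<sqsubseteq> \<Theta> \<Longrightarrow> \<Theta> \<turnstile> index n i \<Longrightarrow> \<Theta> \<turnstile> (\<^bold>\<not> i \<^bold>= ?m) \<Longrightarrow> \<Theta> \<turnstile> (Entry e i One \<^bold>= Zero)"
        have sub1: "\<Delta> \<sqsubseteq> \<Xi>\<^sub>1" "\<Theta> \<sqsubseteq> \<Xi>\<^sub>1" using \<Theta> \<Xi> \<Xi>\<^sub>1 by auto
        have "\<Xi>\<^sub>1 \<turnstile> subst (?\<sigma> m) (e \<triangleright> A \<triangleright> id) ?E"
          using IH sub1 e le_succ_le[OF weaken[OF le sub1(2)]] unfolding P by blast
        then show "\<Xi>\<^sub>1 \<turnstile> subst (?\<sigma> ?m) (v \<triangleright> A \<triangleright> id) ?E"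
        proof (rule E_elim)
          fix \<Xi>\<^sub>2 p wp r assume \<Xi>\<^sub>2: "\<Xi>\<^sub>1 \<sqsubseteq> \<Xi>\<^sub>2" and good_p: "good \<Xi>\<^sub>2 m e p wp r"
          have sub2: "\<Delta> \<sqsubseteq> \<Xi>\<^sub>2" "\<Theta> \<sqsubseteq> \<Xi>\<^sub>2" "\<Gamma> \<sqsubseteq> \<Xi>\<^sub>2" using sub1 \<Xi>\<^sub>2 \<Delta> by auto
          have "\<Xi>\<^sub>2 \<turnstile> subst (?\<sigma> m) (v \<triangleright> A \<triangleright> id) ?E"
            using IH sub2 weaken[OF v sub2(2)] le_succ_le[OF weaken[OF le sub2(2)]] unfolding P by blast
          then show "\<Xi>\<^sub>2 \<turnstile> subst (?\<sigma> ?m) (v \<triangleright> A \<triangleright> id) ?E"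
          proof (rule E_elim)
            fix \<Omega> v' w q assume \<Omega>: "\<Xi>\<^sub>2 \<sqsubseteq> \<Omega>" and good_v: "good \<Omega> m v v' w q"
            note good_p' = good_mono[OF good_p \<Omega>]
            have sub: "\<Delta> \<sqsubseteq> \<Omega>" "\<Theta> \<sqsubseteq> \<Omega>" "\<Gamma> \<sqsubseteq> \<Omega>" "\<Gamma>\<^sub>0 \<sqsubseteq> \<Omega>" "\<Xi>\<^sub>1 \<sqsubseteq> \<Omega>" "\<Xi> \<sqsubseteq> \<Omega>"
              using sub2 \<Omega> \<Xi>\<^sub>1 \<Xi>\<^sub>2 G' by auto
            have m': "\<Psi> \<turnstile> N m" and km: "\<Psi> \<turnstile> (\<^bold>\<not> k \<^bold>= ?m)" and idk: "\<Psi> \<turnstile> index n k"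
              and idm: "\<Psi> \<turnstile> index n ?m" if "\<Omega> \<sqsubseteq> \<Psi>" for \<Psi>
            proof -
              have s: "\<Delta> \<sqsubseteq> \<Psi>" "\<Xi> \<sqsubseteq> \<Psi>" "\<Gamma> \<sqsubseteq> \<Psi>" "\<Theta> \<sqsubseteq> \<Psi>" using that sub by auto
              show "\<Psi> \<turnstile> N m" by (rule weaken[OF m s(1)])
              show "\<Psi> \<turnstile> (\<^bold>\<not> k \<^bold>= ?m)" by (rule neq_sym[OF weaken[OF mk s(2)]])
              show "\<Psi> \<turnstile> index n k" by (rule weaken[OF k s(3)])
              show "\<Psi> \<turnstile> index n ?m" by (rule index_succ[OF weaken[OF m s(1)] weaken[OF le s(4)]])
            qed
            have gp: "\<Omega> \<turnstile> gram F n A p wp r" and gv: "\<Omega> \<turnstile> gram F n A v' w q"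
              using good_p' good_v unfolding good_def by blast+
            have p_e: "\<Psi> \<turnstile> (Entry p l One \<^bold>= Entry e l One)"
              if "\<Omega> \<sqsubseteq> \<Psi>" "\<Psi> \<turnstile> index n l" "\<Psi> \<turnstile> (?m \<^bold>\<le> l)" for \<Psi> l
              using good_p' that unfolding good_def by blast
            \<comment> \<open>Position k is preserved by the invariant, and the unit vector at m + 1
              has a 0 there. This protects the k-th entry of v' when a multiple of p is
              subtracted.\<close>
            have pk: "\<Psi> \<turnstile> (Entry p k One \<^bold>= Zero)" if \<Psi>: "\<Omega> \<sqsubseteq> \<Psi>" for \<Psi>
            proof -
              have "\<Omega> \<turnstile> (Entry p k One \<^bold>= Entry e k One)" using good_p' unfolding good_def by blast
              moreover have "\<Xi>\<^sub>1 \<sqsubseteq> \<Psi>" using sub \<Psi> by auto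
              ultimately show ?thesis
                using eq_trans[OF weaken[OF _ \<Psi>] e0[OF _ idk[OF \<Psi>] km[OF \<Psi>]]] by blast
            qed
            have r0: "\<Psi> \<turnstile> (Entry r l One \<^bold>= Zero)"
              if "\<Omega> \<sqsubseteq> \<Psi>" "\<Psi> \<turnstile> index n l" "\<Psi> \<turnstile> (l \<^bold>\<le> m)" "\<Psi> \<turnstile> (\<^bold>\<not> l \<^bold>= k)" for \<Psi> l
              using good_p' that unfolding good_def by blast
            have q0: "\<Psi> \<turnstile> (Entry q l One \<^bold>= Zero)"
              if "\<Omega> \<sqsubseteq> \<Psi>" "\<Psi> \<turnstile> index n l" "\<Psi> \<turnstile> (l \<^bold>\<le> m)" "\<Psi> \<turnstile> (\<^bold>\<not> l \<^bold>= k)" for \<Psi> l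
              using good_v that unfolding good_def by blast
            \<comment> \<open>All products p(l) r(l) with l \<noteq> m + 1 vanish: by r(l) = 0 for l
              \<le> m other than k, by p(k) = 0, and by p(l) = 0 beyond m + 1. As p is 1 at m + 1,
              the pivot is p . r.\<close>
            have apart: "\<Omega> \<turnstile> apart0 (Entry r ?m One)"
              using sub(4) gp idm[OF subset_refl]
            proof (rule pivot_apart)
              show "\<Omega> \<turnstile> (Entry p ?m One \<^bold>= One)"
                by (rule eq_trans[OF p_e[OF subset_refl idm[OF subset_refl] le_self]
                      e1[OF sub(5) idm[OF subset_refl] eq_refl]])
            next
              fix \<Psi> l assume \<Psi>: "\<Omega> \<sqsubseteq> \<Psi>" and l: "\<Psi> \<turnstile> index n l" "\<Psi> \<turnstile> (\<^bold>\<not> l \<^bold>= ?m)"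
              let ?Z = "Entry p l One \<^bold>* Entry r l One \<^bold>= Zero"
              have Nl: "\<Psi> \<turnstile> N l" using l(1) by (simp add: derivable_index)
              from Nl m'[OF \<Psi>] show "\<Psi> \<turnstile> ?Z"
              proof (rule N_le_cases)
                fix \<Phi> assume \<Phi>: "\<Psi> \<sqsubseteq> \<Phi>" and lm: "\<Phi> \<turnstile> (l \<^bold>\<le> m)"
                have \<Omega>\<Phi>: "\<Omega> \<sqsubseteq> \<Phi>" using \<Psi> \<Phi> by auto
                have "\<Phi> \<turnstile> N k" using idk[OF \<Omega>\<Phi>] by (simp add: derivable_index)
                from weaken[OF Nl \<Phi>] this show "\<Phi> \<turnstile> ?Z"
                proof (rule N_eq_cases)
                  fix \<Phi>' assume \<Phi>': "\<Phi> \<sqsubseteq> \<Phi>'" and lk: "\<Phi>' \<turnstile> (l \<^bold>= k)"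
                  have "\<Omega> \<sqsubseteq> \<Phi>'" using \<Omega>\<Phi> \<Phi>' by auto
                  from eq_trans[OF eq_Entry[OF lk eq_refl] pk[OF this]] show "\<Phi>' \<turnstile> ?Z"
                    by (rule eq_cert1[where k="rt (Entry r l One)"]) (simp add: algebra_simps)
                next
                  fix \<Phi>' assume \<Phi>': "\<Phi> \<sqsubseteq> \<Phi>'" and lk: "\<Phi>' \<turnstile> (\<^bold>\<not> l \<^bold>= k)"
                  have "\<Omega> \<sqsubseteq> \<Phi>'" "\<Psi> \<sqsubseteq> \<Phi>'" using \<Omega>\<Phi> \<Phi> \<Phi>' by auto
                  from r0[OF this(1) weaken[OF l(1) this(2)] weaken[OF lm \<Phi>'] lk] show "\<Phi>' \<turnstile> ?Z"
                    by (rule eq_cert1[where k="rt (Entry p l One)"]) (simp add: algebra_simps)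
                qed
              next
                fix \<Phi> assume \<Phi>: "\<Psi> \<sqsubseteq> \<Phi>" and ml: "\<Phi> \<turnstile> (?m \<^bold>\<le> l)"
                have s: "\<Omega> \<sqsubseteq> \<Phi>" "\<Xi>\<^sub>1 \<sqsubseteq> \<Phi>" using \<Psi> \<Phi> sub by auto
                note l' = weaken[OF l(1) \<Phi>] weaken[OF l(2) \<Phi>]
                from eq_trans[OF p_e[OF s(1) l'(1) ml] e0[OF s(2) l']] show "\<Phi> \<turnstile> ?Z"
                  by (rule eq_cert1[where k="rt (Entry r l One)"]) (simp add: algebra_simps)
              qed
            qed
            \<comment> \<open>Chosen so that q - t r vanishes at m + 1. Earlier zeros survive,
              because both q and r have them.\<close>
            let ?t = "Entry q ?m One \<^bold>/ Entry r ?m One"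
            have t: "\<Omega> \<turnstile> PVar F [?t]"
              by (rule field_div[OF field_ext[OF sub(4)] gramD(3)[OF gv subset_refl idm[OF subset_refl]]
                    gramD(3)[OF gp subset_refl idm[OF subset_refl]] apart])
            have tr: "\<Omega> \<turnstile> (?t \<^bold>* Entry r ?m One \<^bold>= Entry q ?m One)"
              by (rule divide_mul[OF apart0_neq[OF apart]])
            show "\<Omega> \<turnstile> subst (?\<sigma> ?m) (v \<triangleright> A \<triangleright> id) ?E"
            proof (rule gram_comb[OF sub(4) t gv gp])
              fix \<Psi> v'' w'' q'' assume \<Psi>: "\<Omega> \<sqsubseteq> \<Psi>" and g'': "\<Psi> \<turnstile> gram F n A v'' w'' q''"
                and v'': "\<And>\<Phi> i. \<Psi> \<sqsubseteq> \<Phi> \<Longrightarrow> \<Phi> \<turnstile> index n i \<Longrightarrow>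
                  \<Phi> \<turnstile> (Entry v'' i One \<^bold>= Entry v' i One \<^bold>- ?t \<^bold>* Entry p i One)"
                and q'': "\<And>\<Phi> i. \<Psi> \<sqsubseteq> \<Phi> \<Longrightarrow> \<Phi> \<turnstile> index n i \<Longrightarrow>
                  \<Phi> \<turnstile> (Entry q'' i One \<^bold>= Entry q i One \<^bold>- ?t \<^bold>* Entry r i One)"
              \<comment> \<open>Beyond m + 1 the vector p agrees with the unit vector and is 0, so
                v' is left unchanged there.\<close>
              have "\<Phi> \<turnstile> (Entry v'' j One \<^bold>= Entry v j One)"
                if \<Phi>: "\<Psi> \<sqsubseteq> \<Phi>" and j: "\<Phi> \<turnstile> index n j" and le: "\<Phi> \<turnstile> (?m \<^bold>+ One \<^bold>\<le> j)" for \<Phi> j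
              proof -
                have s: "\<Omega> \<sqsubseteq> \<Phi>" "\<Xi>\<^sub>1 \<sqsubseteq> \<Phi>" using \<Psi> \<Phi> sub by auto
                have "\<Phi> \<turnstile> (Entry v' j One \<^bold>= Entry v j One)"
                  using good_v s(1) j le_succ_le[OF le] unfolding good_def by blast
                moreover have "\<Phi> \<turnstile> (Entry p j One \<^bold>= Zero)"
                  by (rule eq_trans[OF p_e[OF s(1) j le_succ_le[OF le]] e0[OF s(2) j neq_sym[OF neq_of_less[OF le]]]])
                ultimately show ?thesis
                  by (rule eq_cert3[OF v''[OF \<Phi> j], where k=1 and k'=1 and k''="- rt ?t"])
                    (simp add: algebra_simps)
              qed
              moreover have "\<Psi> \<turnstile> (Entry v'' k One \<^bold>= Entry v k One)"
              proof -
                have "\<Omega> \<turnstile> (Entry v' k One \<^bold>= Entry v k One)" using good_v unfolding good_def by blast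
                from v''[OF subset_refl idk[OF \<Psi>]] weaken[OF this \<Psi>] pk[OF \<Psi>] show ?thesis
                  by (rule eq_cert3[where k=1 and k'=1 and k''="- rt ?t"]) (simp add: algebra_simps)
              qed
              moreover have "\<Phi> \<turnstile> (Entry q'' l One \<^bold>= Zero)"
                if \<Phi>: "\<Psi> \<sqsubseteq> \<Phi>" and l: "\<Phi> \<turnstile> index n l" "\<Phi> \<turnstile> (l \<^bold>\<le> ?m)" "\<Phi> \<turnstile> (\<^bold>\<not> l \<^bold>= k)" for \<Phi> l
              proof (rule N_le_cases[of _ l m])
                show "\<Phi> \<turnstile> N l" using l(1) by (simp add: derivable_index)
                show "\<Phi> \<turnstile> N m" by (rule m'[OF subset_trans[OF \<Psi> \<Phi>]])
              next
                fix \<Phi>' assume \<Phi>': "\<Phi> \<sqsubseteq> \<Phi>'" and le: "\<Phi>' \<turnstile> (l \<^bold>\<le> m)"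
                have s: "\<Omega> \<sqsubseteq> \<Phi>'" "\<Psi> \<sqsubseteq> \<Phi>'" using \<Psi> \<Phi> \<Phi>' by auto
                note l' = weaken[OF l(1) \<Phi>'] le weaken[OF l(3) \<Phi>']
                from q''[OF s(2) l'(1)] q0[OF s(1) l'] r0[OF s(1) l']
                show "\<Phi>' \<turnstile> (Entry q'' l One \<^bold>= Zero)"
                  by (rule eq_cert3[where k=1 and k'=1 and k''="- rt ?t"]) (simp add: algebra_simps)
              next
                fix \<Phi>' assume \<Phi>': "\<Phi> \<sqsubseteq> \<Phi>'" and le: "\<Phi>' \<turnstile> (?m \<^bold>\<le> l)"
                have s: "\<Omega> \<sqsubseteq> \<Phi>'" "\<Psi> \<sqsubseteq> \<Phi>'" using \<Psi> \<Phi> \<Phi>' by auto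
                have "\<Phi>' \<turnstile> (l \<^bold>= ?m)" by (rule le_antisymD[OF weaken[OF l(2) \<Phi>'] le])
                then have "\<Phi>' \<turnstile> (Entry q'' l One \<^bold>= Entry q'' ?m One)" by (rule eq_Entry[OF _ eq_refl])
                from this q''[OF s(2) idm[OF s(1)]] weaken[OF tr s(1)]
                show "\<Phi>' \<turnstile> (Entry q'' l One \<^bold>= Zero)"
                  by (rule eq_cert3[where k=1 and k'=1 and k''="- 1"]) (simp add: algebra_simps)
              qed
              ultimately have "good \<Psi> ?m v v'' w'' q''" using g'' unfolding good_def by blast
              then show "\<Psi> \<turnstile> subst (?\<sigma> ?m) (v \<triangleright> A \<triangleright> id) ?E" by (rule E_intro)
            qed
          qed
        qed
      qed
    qed
    then show "\<Delta> \<turnstile> subst (?\<sigma> ?m) (A \<triangleright> id) ?P" unfolding P by blast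
  qed
  then have "\<Gamma> \<turnstile> subst (?\<sigma> n) (v \<triangleright> A \<triangleright> id) ?E" using v le_self unfolding P by blast
  then show ?thesis
  proof (rule E_elim)
    fix \<Delta> v' w q assume \<Delta>: "\<Gamma> \<sqsubseteq> \<Delta>" and good: "good \<Delta> n v v' w q"
    then show "\<Delta> \<turnstile> D"
      unfolding good_def by (intro D[of _ v' w q]) (auto simp: derivable_index)
  qed
qed

text \<open>Elimination from the k-th unit vector keeps v(k) = 1. With all q(l) for l \<noteq> k
  gone, the argument for the pivots applies once more, at j = k, and makes q(k) a legitimate
  divisor.\<close>

lemma row_exists:
  assumes G: "\<Gamma>\<^sub>0 \<sqsubseteq> \<Gamma>" and k: "\<Gamma> \<turnstile> index n k"
    and D: "\<And>\<Delta> v w q. \<Gamma> \<sqsubseteq> \<Delta> \<Longrightarrow> \<Delta> \<turnstile> gram F n A v w q \<Longrightarrow> \<Delta> \<turnstile> apart0 (Entry q k One) \<Longrightarrow>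
      (\<And>\<Theta> l. \<Delta> \<sqsubseteq> \<Theta> \<Longrightarrow> \<Theta> \<turnstile> index n l \<Longrightarrow> \<Theta> \<turnstile> (\<^bold>\<not> l \<^bold>= k) \<Longrightarrow> \<Theta> \<turnstile> (Entry q l One \<^bold>= Zero)) \<Longrightarrow>
      \<Delta> \<turnstile> D"
  shows "\<Gamma> \<turnstile> D"
proof (rule unit_vector_exists[OF G, of k])
  show "\<Gamma> \<turnstile> N k" using k by (simp add: derivable_index)
next
  fix \<Delta> e assume \<Delta>: "\<Gamma> \<sqsubseteq> \<Delta>" and e: "\<Delta> \<turnstile> vector_in F n e"
    and e1: "\<And>\<Theta> i. \<Delta> \<sqsubseteq> \<Theta> \<Longrightarrow> \<Theta> \<turnstile> index n i \<Longrightarrow> \<Theta> \<turnstile> (i \<^bold>= k) \<Longrightarrow> \<Theta> \<turnstile> (Entry e i One \<^bold>= One)"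
  have G': "\<Gamma>\<^sub>0 \<sqsubseteq> \<Delta>" using G \<Delta> by auto
  show "\<Delta> \<turnstile> D"
    using G' weaken[OF k \<Delta>] e
  proof (rule elimination)
    fix \<Theta> v w q assume \<Theta>: "\<Delta> \<sqsubseteq> \<Theta>" and g: "\<Theta> \<turnstile> gram F n A v w q"
      and vk: "\<Theta> \<turnstile> (Entry v k One \<^bold>= Entry e k One)"
      and q: "\<And>\<Xi> l. \<Theta> \<sqsubseteq> \<Xi> \<Longrightarrow> \<Xi> \<turnstile> index n l \<Longrightarrow> \<Xi> \<turnstile> (\<^bold>\<not> l \<^bold>= k) \<Longrightarrow> \<Xi> \<turnstile> (Entry q l One \<^bold>= Zero)"
    have sub: "\<Gamma> \<sqsubseteq> \<Theta>" "\<Gamma>\<^sub>0 \<sqsubseteq> \<Theta>" using \<Delta> \<Theta> G' by auto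
    note k' = weaken[OF k sub(1)]
    have "\<Theta> \<turnstile> (Entry v k One \<^bold>= One)" by (rule eq_trans[OF vk e1[OF \<Theta> k' eq_refl]])
    with sub(2) g k' have "\<Theta> \<turnstile> apart0 (Entry q k One)"
    proof (rule pivot_apart)
      fix \<Xi> l assume "\<Theta> \<sqsubseteq> \<Xi>" "\<Xi> \<turnstile> index n l" "\<Xi> \<turnstile> (\<^bold>\<not> l \<^bold>= k)"
      from q[OF this] show "\<Xi> \<turnstile> (Entry v l One \<^bold>* Entry q l One \<^bold>= Zero)"
        by (rule eq_cert1[where k="rt (Entry v l One)"]) (simp add: algebra_simps)
    qed
    with sub(1) g show "\<Theta> \<turnstile> D" using q by (rule D)
  qed
qed

end

section \<open>The rows of the inverse and their assembly\<close>

lemma subst_product_is_identity [simp]: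
  "subst \<sigma> \<tau> (product_is_identity n B A) = product_is_identity (subst_tm \<sigma> \<tau> n) (\<tau> B) (\<tau> A)"
  by (simp add: product_is_identity_def product_entry_is_def subst.simps subst_tm_lift_tm up_def)
    (simp add: lift_tm_def subst_tm_subst_tm)

text \<open>The specification of the inverse cut down to row \<open>k\<close>. It depends on
  \<open>B\<close> only through that row, so it survives the writing of other rows, as
  \<open>inverse_row_cong\<close> makes precise.\<close>

definition inverse_row :: "nat \<Rightarrow> tm \<Rightarrow> nat \<Rightarrow> nat \<Rightarrow> tm \<Rightarrow> fm"
  where "inverse_row F n A B k = Forall (index (lift_tm 1 n) (Var 0) \<^bold>\<rightarrow>
    PVar F [Entry B (lift_tm 1 k) (Var 0)] \<^bold>\<and>
    (lift_tm 1 k \<^bold>= Var 0 \<^bold>\<rightarrow> product_entry_is (lift_tm 1 n) B A (lift_tm 1 k) (Var 0) One) \<^bold>\<and>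
    ((\<^bold>\<not> lift_tm 1 k \<^bold>= Var 0) \<^bold>\<rightarrow> product_entry_is (lift_tm 1 n) B A (lift_tm 1 k) (Var 0) Zero))"

lemma subst_product_entry_is [simp]:
  "subst \<sigma> \<tau> (product_entry_is n B A k l z) =
    product_entry_is (subst_tm \<sigma> \<tau> n) (\<tau> B) (\<tau> A) (subst_tm \<sigma> \<tau> k) (subst_tm \<sigma> \<tau> l) (subst_tm \<sigma> \<tau> z)"
  by (simp add: product_entry_is_def)

lemma subst_inverse_row [simp]:
  "subst \<sigma> \<tau> (inverse_row F n A B k) = inverse_row F (subst_tm \<sigma> \<tau> n) (\<tau> A) (\<tau> B) (subst_tm \<sigma> \<tau> k)"
  by (simp add: inverse_row_def subst.simps)

lemma derivable_inverse_row:
  "(\<Gamma> \<turnstile> inverse_row F n A B k) = (\<forall>l \<Delta>. \<Gamma> \<sqsubseteq> \<Delta> \<longrightarrow> (\<Delta> \<turnstile> index n l) \<longrightarrow>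
    (\<Delta> \<turnstile> PVar F [Entry B k l]) \<and>
    (\<Delta> \<turnstile> (k \<^bold>= l \<^bold>\<rightarrow> product_entry_is n B A k l One)) \<and>
    (\<Delta> \<turnstile> ((\<^bold>\<not> k \<^bold>= l) \<^bold>\<rightarrow> product_entry_is n B A k l Zero)))"
  unfolding inverse_row_def derivable_Forall subst.simps(7,9)
  by (simp add: derivable_Imp[where B="_ \<^bold>\<and> _"] derivable_Conj)

lemma inverse_row_cong:
  assumes n: "\<Gamma> \<turnstile> N n" and row: "\<Gamma> \<turnstile> inverse_row F n A B k"
    and B': "\<And>\<Delta> j. \<Gamma> \<sqsubseteq> \<Delta> \<Longrightarrow> \<Delta> \<turnstile> (Entry B' k j \<^bold>= Entry B k j)"
  shows "\<Gamma> \<turnstile> inverse_row F n A B' k"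
proof -
  have prod: "\<Delta> \<turnstile> product_entry_is n B' A k l z"
    if \<Delta>: "\<Gamma> \<sqsubseteq> \<Delta>" and p: "\<Delta> \<turnstile> product_entry_is n B A k l z" for \<Delta> l z
    using weaken[OF n \<Delta>] _ p unfolding product_entry_is_def
  proof (rule sum_cong)
    fix \<Theta> i assume "\<Delta> \<sqsubseteq> \<Theta>"
    with \<Delta> have "\<Theta> \<turnstile> (Entry B' k i \<^bold>= Entry B k i)" by (intro B') auto
    then show "\<Theta> \<turnstile> (ap (Entry B' (lift_tm 1 k) (Var 0) \<^bold>* Entry A (Var 0) (lift_tm 1 l)) i \<^bold>=
        ap (Entry B (lift_tm 1 k) (Var 0) \<^bold>* Entry A (Var 0) (lift_tm 1 l)) i)"
      by (simp add: eq_mul eq_refl)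
  qed
  have imp: "\<Delta> \<turnstile> (X \<^bold>\<rightarrow> product_entry_is n B' A k l z)"
    if "\<Gamma> \<sqsubseteq> \<Delta>" "\<Delta> \<turnstile> (X \<^bold>\<rightarrow> product_entry_is n B A k l z)" for \<Delta> X l z
    using that prod unfolding derivable_Imp[where B="product_entry_is _ _ _ _ _ _"]
    by (meson subset_trans)
  show ?thesis
    unfolding derivable_inverse_row
    using row imp eq_PVar[OF eq_sym[OF B']] unfolding derivable_inverse_row by blast
qed

context regular_field_matrix
begin

text \<open>The new row, w divided by q(k), is written into a given array \<open>B\<close> rather
  than into a fresh one; the frame condition lets rows completed earlier persist. Its product with
  column l of A is q(l) / q(k).\<close>

lemma inverse_row_exists:
  assumes G: "\<Gamma>\<^sub>0 \<sqsubseteq> \<Gamma>" and k: "\<Gamma> \<turnstile> index n k"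
    and D: "\<And>\<Delta> B'. \<Gamma> \<sqsubseteq> \<Delta> \<Longrightarrow> \<Delta> \<turnstile> inverse_row F n A B' k \<Longrightarrow>
      (\<And>\<Theta> r j. \<Delta> \<sqsubseteq> \<Theta> \<Longrightarrow> \<Theta> \<turnstile> (\<^bold>\<not> r \<^bold>= k) \<Longrightarrow> \<Theta> \<turnstile> (Entry B' r j \<^bold>= Entry B r j)) \<Longrightarrow> \<Delta> \<turnstile> D"
  shows "\<Gamma> \<turnstile> D"
proof (rule row_exists[OF G k])
  fix \<Delta> v w q assume \<Delta>: "\<Gamma> \<sqsubseteq> \<Delta>" and g: "\<Delta> \<turnstile> gram F n A v w q" and apart: "\<Delta> \<turnstile> apart0 (Entry q k One)"
    and q0: "\<And>\<Theta> l. \<Delta> \<sqsubseteq> \<Theta> \<Longrightarrow> \<Theta> \<turnstile> index n l \<Longrightarrow> \<Theta> \<turnstile> (\<^bold>\<not> l \<^bold>= k) \<Longrightarrow> \<Theta> \<turnstile> (Entry q l One \<^bold>= Zero)"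
  have G': "\<Gamma>\<^sub>0 \<sqsubseteq> \<Delta>" using G \<Delta> by auto
  note k' = weaken[OF k \<Delta>]
  let ?r = "One \<^bold>/ Entry q k One"
  have r: "\<Delta> \<turnstile> PVar F [?r]"
    by (rule field_div[OF field_ext[OF G'] field_one[OF field_ext[OF G']] gramD(3)[OF g subset_refl k'] apart])
  have rq: "\<Delta> \<turnstile> (?r \<^bold>* Entry q k One \<^bold>= One)" by (rule divide_mul[OF apart0_neq[OF apart]])
  have ex: "\<Theta> \<turnstile> subst (i \<triangleright> ?r \<triangleright> Var) (w \<triangleright> id) (Exists (Var 0 \<^bold>= Entry 0 (Var 1) One \<^bold>* Var 2))" for \<Theta> i
    by (rule Exists_intro[of _ "Entry w i One \<^bold>* ?r"]) (simp add: eq_refl)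
  show "\<Delta> \<turnstile> D"
  proof (rule finite_choice[OF nat_ext[OF G'] ex, where c=True and k=k and a=B])
    fix \<Theta> B' assume \<Theta>: "\<Delta> \<sqsubseteq> \<Theta>"
      and b: "\<And>\<Xi> i. \<Theta> \<sqsubseteq> \<Xi> \<Longrightarrow> \<Xi> \<turnstile> index n i \<Longrightarrow> \<Xi> \<turnstile> subst (line_entry True B' k i \<triangleright> i \<triangleright> ?r \<triangleright> Var) (w \<triangleright> id)
        (Var 0 \<^bold>= Entry 0 (Var 1) One \<^bold>* Var 2)"
      and frame: "\<And>\<Xi> r j. \<Theta> \<sqsubseteq> \<Xi> \<Longrightarrow> \<Xi> \<turnstile> (\<^bold>\<not> r \<^bold>= k) \<Longrightarrow> \<Xi> \<turnstile> (line_entry True B' r j \<^bold>= line_entry True B r j)"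
    have B': "\<Xi> \<turnstile> (Entry B' k i \<^bold>= Entry w i One \<^bold>* ?r)" if "\<Theta> \<sqsubseteq> \<Xi>" "\<Xi> \<turnstile> index n i" for \<Xi> i
      using b[OF that] by (simp add: line_entry_def)
    have in_F: "\<Xi> \<turnstile> PVar F [Entry B' k l]"
      and prod: "\<Xi> \<turnstile> product_entry_is n B' A k l (Entry q l One \<^bold>* ?r)"
      if \<Xi>: "\<Theta> \<sqsubseteq> \<Xi>" and l: "\<Xi> \<turnstile> index n l" for \<Xi> l
    proof -
      have s: "\<Delta> \<sqsubseteq> \<Xi>" "\<Gamma>\<^sub>0 \<sqsubseteq> \<Xi>" using \<Theta> \<Xi> G' by auto
      show "\<Xi> \<turnstile> PVar F [Entry B' k l]"
        by (rule eq_PVar[OF eq_sym[OF B'[OF \<Xi> l]]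
              field_mul[OF field_ext[OF s(2)] gramD(2)[OF g s(1) l] weaken[OF r s(1)]]])
      \<comment> \<open>Scaling by r is fitted to the shape g + c f of \<open>sum_linear\<close> by
        taking g = f and c = r - 1.\<close>
      have "\<Xi> \<turnstile> product_entry_is n B' A k l (Entry q l One \<^bold>+ (?r \<^bold>- One) \<^bold>* Entry q l One)"
        unfolding product_entry_is_def
        using nat_ext[OF s(2)] _ gramD(5)[OF g s(1) l] gramD(5)[OF g s(1) l]
      proof (rule sum_linear)
        fix \<Psi> i assume "\<Xi> \<sqsubseteq> \<Psi>" "\<Psi> \<turnstile> index n i"
        then have "\<Psi> \<turnstile> (Entry B' k i \<^bold>= Entry w i One \<^bold>* ?r)" using \<Xi> by (intro B') auto
        then show "\<Psi> \<turnstile> (ap (Entry B' (lift_tm 1 k) (Var 0) \<^bold>* Entry A (Var 0) (lift_tm 1 l)) i \<^bold>=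
            ap (Entry w (Var 0) One \<^bold>* Entry A (Var 0) (lift_tm 1 l)) i \<^bold>+
            (?r \<^bold>- One) \<^bold>* ap (Entry w (Var 0) One \<^bold>* Entry A (Var 0) (lift_tm 1 l)) i)"
          by (rule eq_cert1[where k="rt (Entry A i l)"]) (simp add: algebra_simps)
      qed
      then show "\<Xi> \<turnstile> product_entry_is n B' A k l (Entry q l One \<^bold>* ?r)"
        unfolding product_entry_is_def
        by (rule sum_eq[OF _ eq_refl ring_eq]) (simp add: algebra_simps)
    qed
    have "\<Theta> \<turnstile> inverse_row F n A B' k"
      unfolding derivable_inverse_row
        derivable_Imp[where B="product_entry_is _ _ _ _ _ _"]
    proof (intro allI HOL.impI HOL.conjI)
      fix l \<Xi> \<Psi> assume \<Xi>: "\<Theta> \<sqsubseteq> \<Xi>" and l: "\<Xi> \<turnstile> index n l"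
      show "\<Xi> \<turnstile> PVar F [Entry B' k l]" by (rule in_F[OF \<Xi> l])
      {
        assume \<Psi>: "\<Xi> \<sqsubseteq> \<Psi>" and kl: "\<Psi> \<turnstile> (k \<^bold>= l)"
        have s: "\<Theta> \<sqsubseteq> \<Psi>" "\<Delta> \<sqsubseteq> \<Psi>" using \<Theta> \<Xi> \<Psi> by auto
        have "\<Psi> \<turnstile> (Entry q l One \<^bold>* ?r \<^bold>= One)"
          by (rule eq_cert2[OF weaken[OF rq s(2)] eq_Entry[OF kl eq_refl[of _ One], of q],
                where k=1 and k'="- rt ?r"]) (simp add: algebra_simps)
        with prod[OF s(1) weaken[OF l \<Psi>]] show "\<Psi> \<turnstile> product_entry_is n B' A k l One"
          unfolding product_entry_is_def using sum_eq eq_refl by blast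
      next
        assume \<Psi>: "\<Xi> \<sqsubseteq> \<Psi>" and kl: "\<Psi> \<turnstile> (\<^bold>\<not> k \<^bold>= l)"
        have s: "\<Theta> \<sqsubseteq> \<Psi>" "\<Delta> \<sqsubseteq> \<Psi>" using \<Theta> \<Xi> \<Psi> by auto
        have "\<Psi> \<turnstile> (Entry q l One \<^bold>* ?r \<^bold>= Zero)"
          by (rule eq_cert1[OF q0[OF s(2) weaken[OF l \<Psi>] neq_sym[OF kl]], where k="rt ?r"])
            (simp add: algebra_simps)
        with prod[OF s(1) weaken[OF l \<Psi>]] show "\<Psi> \<turnstile> product_entry_is n B' A k l Zero"
          unfolding product_entry_is_def using sum_eq eq_refl by blast
      }
    qed
    moreover have "\<Gamma> \<sqsubseteq> \<Theta>" using \<Delta> \<Theta> by auto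
    ultimately show "\<Theta> \<turnstile> D" using frame by (intro D[of _ B']) (auto simp: line_entry_def)
  qed
qed

text \<open>The principle \<open>finite_choice\<close> selects reals, whereas here whole rows are
  selected; so there is another induction, on the number m of completed rows.\<close>

lemma invertible: "\<Gamma>\<^sub>0 \<turnstile> invertible F n A"
proof -
  let ?B = "Forall (index (Var 1) (Var 0) \<^bold>\<rightarrow> inverse_row F (Var 2) 1 0 (Var 0))"
  have B: "(\<Delta> \<turnstile> subst (m \<triangleright> n \<triangleright> Var) (b \<triangleright> A \<triangleright> id) ?B) =
    (\<forall>k \<Theta>. \<Delta> \<sqsubseteq> \<Theta> \<longrightarrow> (\<Theta> \<turnstile> index m k) \<longrightarrow> (\<Theta> \<turnstile> inverse_row F n A b k))" for \<Delta> m b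
    by (simp add: forces numeral_eq_Suc)
  let ?P = "Var 0 \<^bold>\<le> Var 1 \<^bold>\<rightarrow> ExistsM ?B"
  have "\<Gamma>\<^sub>0 \<turnstile> subst (n \<triangleright> n \<triangleright> Var) (A \<triangleright> id) ?P"
    using nat
  proof (rule N_induct)
    \<comment> \<open>With no row required yet any array will do, and A is at hand.\<close>
    have "\<Delta> \<turnstile> subst (Zero \<triangleright> n \<triangleright> Var) (A \<triangleright> id) (ExistsM ?B)" for \<Delta>
      by (rule ExistsM_intro[of _ _ A]) (unfold B, blast intro: index_zero)
    then show "\<Gamma>\<^sub>0 \<turnstile> subst (Zero \<triangleright> n \<triangleright> Var) (A \<triangleright> id) ?P"
      unfolding subst.simps(9) derivable_Imp by blast
  next
    fix \<Delta> m assume \<Delta>: "\<Gamma>\<^sub>0 \<sqsubseteq> \<Delta>" and m: "\<Delta> \<turnstile> N m" and IH: "\<Delta> \<turnstile> subst (m \<triangleright> n \<triangleright> Var) (A \<triangleright> id) ?P"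
    let ?m = "m \<^bold>+ One"
    let ?G = "subst (?m \<triangleright> n \<triangleright> Var) (A \<triangleright> id) (ExistsM ?B)"
    have "\<Theta> \<turnstile> ?G" if \<Theta>: "\<Delta> \<sqsubseteq> \<Theta>" and le: "\<Theta> \<turnstile> (?m \<^bold>\<le> n)" for \<Theta>
    proof -
      have "\<Theta> \<turnstile> subst (m \<triangleright> n \<triangleright> Var) (A \<triangleright> id) (Var 0 \<^bold>\<le> Var 1)" using le_succ_le[OF le] by simp
      then have "\<Theta> \<turnstile> subst (m \<triangleright> n \<triangleright> Var) (A \<triangleright> id) (ExistsM ?B)"
        using IH \<Theta> unfolding subst.simps(9) derivable_Imp by blast
      then show ?thesis
      proof (rule ExistsM_elim)
        fix \<Xi> b assume \<Xi>: "\<Theta> \<sqsubseteq> \<Xi>" and b: "\<Xi> \<turnstile> subst (m \<triangleright> n \<triangleright> Var) (b \<triangleright> A \<triangleright> id) ?B"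
        have s: "\<Gamma>\<^sub>0 \<sqsubseteq> \<Xi>" "\<Delta> \<sqsubseteq> \<Xi>" using \<Delta> \<Theta> \<Xi> by auto
        have "\<Xi> \<turnstile> index n ?m" by (rule index_succ[OF weaken[OF m s(2)] weaken[OF le \<Xi>]])
        with s(1) show "\<Xi> \<turnstile> ?G"
        proof (rule inverse_row_exists[where B=b])
          fix \<Omega> b' assume \<Omega>: "\<Xi> \<sqsubseteq> \<Omega>" and row: "\<Omega> \<turnstile> inverse_row F n A b' ?m"
            and frame: "\<And>\<Theta> r j. \<Omega> \<sqsubseteq> \<Theta> \<Longrightarrow> \<Theta> \<turnstile> (\<^bold>\<not> r \<^bold>= ?m) \<Longrightarrow> \<Theta> \<turnstile> (Entry b' r j \<^bold>= Entry b r j)"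
          have "\<Psi> \<turnstile> inverse_row F n A b' k" if \<Psi>: "\<Omega> \<sqsubseteq> \<Psi>" and k: "\<Psi> \<turnstile> index ?m k" for \<Psi> k
          proof -
            have "\<Delta> \<sqsubseteq> \<Psi>" using s \<Omega> \<Psi> by auto
            from k weaken[OF m this] show ?thesis
            proof (rule index_succ_cases)
              fix \<Phi> assume \<Phi>: "\<Psi> \<sqsubseteq> \<Phi>" and k: "\<Phi> \<turnstile> index m k"
              have s': "\<Xi> \<sqsubseteq> \<Phi>" "\<Omega> \<sqsubseteq> \<Phi>" "\<Gamma>\<^sub>0 \<sqsubseteq> \<Phi>" using s \<Omega> \<Psi> \<Phi> by auto
              have "\<Phi> \<turnstile> inverse_row F n A b k" using b s'(1) k unfolding B by blast
              with nat_ext[OF s'(3)] show "\<Phi> \<turnstile> inverse_row F n A b' k"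
              proof (rule inverse_row_cong)
                fix \<Phi>' j assume \<Phi>': "\<Phi> \<sqsubseteq> \<Phi>'"
                with s'(2) have "\<Omega> \<sqsubseteq> \<Phi>'" by auto
                from frame[OF this index_neq[OF weaken[OF k \<Phi>']]]
                show "\<Phi>' \<turnstile> (Entry b' k j \<^bold>= Entry b k j)" .
              qed
            next
              fix \<Phi> assume \<Phi>: "\<Psi> \<sqsubseteq> \<Phi>" and k: "\<Phi> \<turnstile> (?m \<^bold>= k)"
              have "\<Omega> \<sqsubseteq> \<Phi>" using \<Psi> \<Phi> by auto
              from eq_subst_env[OF k, of "n \<triangleright> Var" "b' \<triangleright> A \<triangleright> id" "inverse_row F (Var 1) 1 0 (Var 0)"]
                weaken[OF row this]
              show "\<Phi> \<turnstile> inverse_row F n A b' k" by simp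
            qed
          qed
          then have "\<Omega> \<turnstile> subst (?m \<triangleright> n \<triangleright> Var) (b' \<triangleright> A \<triangleright> id) ?B" unfolding B by blast
          then show "\<Omega> \<turnstile> ?G" by (rule ExistsM_intro)
        qed
      qed
    qed
    then show "\<Delta> \<turnstile> subst (?m \<triangleright> n \<triangleright> Var) (A \<triangleright> id) ?P"
      unfolding subst.simps(9) derivable_Imp by simp
  qed
  moreover have "\<Gamma>\<^sub>0 \<turnstile> subst (n \<triangleright> n \<triangleright> Var) (A \<triangleright> id) (Var 0 \<^bold>\<le> Var 1)" by (simp add: le_self)
  ultimately have "\<Gamma>\<^sub>0 \<turnstile> subst (n \<triangleright> n \<triangleright> Var) (A \<triangleright> id) (ExistsM ?B)"
    unfolding subst.simps(9) by (rule impE)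
  then show ?thesis
  proof (rule ExistsM_elim)
    fix \<Delta> b assume "\<Delta> \<turnstile> subst (n \<triangleright> n \<triangleright> Var) (b \<triangleright> A \<triangleright> id) ?B"
    then have row: "\<Theta> \<turnstile> inverse_row F n A b k" if "\<Delta> \<sqsubseteq> \<Theta>" "\<Theta> \<turnstile> index n k" for \<Theta> k
      using that unfolding B by blast
    have "\<Delta> \<turnstile> entries_in F n b"
      unfolding derivable_entries_in using row subset_refl unfolding derivable_inverse_row by blast
    moreover have "\<Delta> \<turnstile> product_is_identity n b A"
    proof -
      have "\<Delta> \<turnstile> (index n k \<^bold>\<rightarrow> index n l \<^bold>\<rightarrow> (k \<^bold>= l \<^bold>\<rightarrow> product_entry_is n b A k l One) \<^bold>\<and>
          ((\<^bold>\<not> k \<^bold>= l) \<^bold>\<rightarrow> product_entry_is n b A k l Zero))" for k l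
        unfolding derivable_Imp[where A="index _ _"] derivable_Conj
        using row[unfolded derivable_inverse_row] by (meson subset_refl subset_trans weaken)
      then show ?thesis
        unfolding product_is_identity_def
        by (simp add: derivable_Forall derivable_subst_Forall subst_tm_lift_tm)
    qed
    ultimately show "\<Delta> \<turnstile> invertible F n A"
      unfolding invertible_def
      by (intro ExistsM_intro'[of _ b]) (simp add: derivable_Conj subst_tm_liftM_tm)
  qed
qed

end

lemma subst_invertible [simp]: "subst \<sigma> \<tau> (invertible F n A) = invertible F (subst_tm \<sigma> \<tau> n) (\<tau> A)"
  by (simp add: invertible_def subst.simps upM_def subst_tm_liftM_tm)
    (simp add: liftM_tm_def subst_tm_subst_tm)

theorem theorem3:
  fixes F :: nat
  shows "[] \<turnstile> (constructive_field F \<^bold>\<rightarrow>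
           Forall (N (Var 0) \<^bold>\<rightarrow>
             ForallM (entries_in F (Var 0) 0 \<^bold>\<rightarrow> non_singular (Var 0) 0 \<^bold>\<rightarrow>
               invertible F (Var 0) 0)))"
proof -
  have "\<Gamma> \<turnstile> invertible F n A" if "\<Gamma> \<turnstile> constructive_field F" "\<Gamma> \<turnstile> N n"
    "\<Gamma> \<turnstile> entries_in F n A" "\<Gamma> \<turnstile> non_singular n A" for \<Gamma> n A
  proof -
    interpret regular_field_matrix \<Gamma> F n A by unfold_locales (fact that)+
    show ?thesis by (rule invertible)
  qed
  \<comment> \<open>The hypotheses arrive in successively larger contexts and are weakened to the
    last one, which becomes the base context of the locale.\<close>
  then show ?thesis
    by (simp add: forces) (meson subset_trans weaken)
qed

end
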